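(* Suppose that the ground ring $R$ is a field. (1) The category $\mathcal{A}_{CG}^{co}$ is equivalent to its full subcategory consisting of the objects $A(0),A(1),A(2),\dots$ if $ch\,R=2$, and to its full subcategory consisting of the objects $A(0),A(2),A(4),\dots$ if $ch\,R\neq2$. (2) For objects $A(m),A(n)$ of the list in (1), the set of morphisms is $$\mathcal{A}_{CG}^{co}(A(m),A(n))=\begin{cases}R & (m=n>0)\\ 0 & (\text{otherwise}),\end{cases}$$ where for $m=n>0$ the element $r\in R$ corresponds to the morphism with $X\mapsto rX$, and $0$ denotes the set consisting only of the trivial morphism.
   Context: $ch$ denotes the characteristic of a ring; graded modules are graded by the non-negative integers. $\mathcal{A}$ is the category of connected graded $R$-algebras (associative unital graded algebras $B$ with $B_0=R$); $R$ is a zero object of $\mathcal{A}$, and the trivial morphism $A\to B$ is the composite $A\to R\to B$. $\ast$ denotes the categorical coproduct in $\mathcal{A}$ (free product). A cogroup in $\mathcal{A}$ is an object $A$ with a coassociative and counital morphism $\Phi:A\to A\ast A$ in $\mathcal{A}$ that admits an inverse, i.e. a morphism $\nu:A\to A$ in $\mathcal{A}$ such that the composites of $\Phi$ with $(1_A,\nu)$ and $(\nu,1_A):A\ast A\to A$ are the trivial morphism. $\mathcal{A}_{CG}$ is the category of cogroups in $\mathcal{A}$ and morphisms of $\mathcal{A}$ commuting with the comultiplications. $\mathcal{A}_{CG}^{co}$ is the full subcategory of cogroups whose underlying algebra is graded commutative ($ab=(-1)^{pq}ba$ for $a\in A_p$, $b\in A_q$). $A(0)$ is the graded algebra $R$ with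 its obvious cogroup structure. For $n>0$, $A(n)$ is the cogroup in $\mathcal{A}$ whose underlying graded algebra is the polynomial ring $R[X]$ on a generator $X$ of degree $n$, with comultiplication $\Phi:R[X]\to R[X]\ast R[X]$ and inverse $\nu:R[X]\to R[X]$ the graded algebra homomorphisms determined by $\Phi(X)=X'+X''$ and $\nu(X)=-X$, where $X',X''$ are the images of $X$ under the canonical inclusions to the first and second factors of $R[X]\ast R[X]$. *)

theory Defs
  imports "HOL-Algebra.UnivPoly" "HOL-Algebra.QuotRing" "HOL-Algebra.Multiplicative_Group"
begin

section \<open>Categories\<close>

text \<open>Hom-sets of different pairs of objects need not be disjoint, so composition takes the
  three objects as arguments: \<open>comp_mor C A B D g f\<close> is \<open>g \<circ> f\<close> for \<open>f : A \<rightarrow> B\<close>, \<open>g : B \<rightarrow> D\<close>.\<close>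

record ('o, 'm) category =
  objects :: "'o set"
  hom_set :: "'o \<Rightarrow> 'o \<Rightarrow> 'm set"
  ident :: "'o \<Rightarrow> 'm"
  comp_mor :: "'o \<Rightarrow> 'o \<Rightarrow> 'o \<Rightarrow> 'm \<Rightarrow> 'm \<Rightarrow> 'm"

definition is_category :: "('o, 'm) category \<Rightarrow> bool" where
  "is_category C \<longleftrightarrow>
    (\<forall>A\<in>objects C. ident C A \<in> hom_set C A A) \<and>
    (\<forall>A\<in>objects C. \<forall>B\<in>objects C. \<forall>D\<in>objects C. \<forall>f\<in>hom_set C A B. \<forall>g\<in>hom_set C B D.
       comp_mor C A B D g f \<in> hom_set C A D) \<and>
    (\<forall>A\<in>objects C. \<forall>B\<in>objects C. \<forall>f\<in>hom_set C A B.
       comp_mor C A A B f (ident C A) = f \<and> comp_mor C A B B (ident C B) f = f) \<and>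
    (\<forall>A\<in>objects C. \<forall>B\<in>objects C. \<forall>D\<in>objects C. \<forall>E\<in>objects C.
     \<forall>f\<in>hom_set C A B. \<forall>g\<in>hom_set C B D. \<forall>h\<in>hom_set C D E.
       comp_mor C A D E h (comp_mor C A B D g f) = comp_mor C A B E (comp_mor C B D E h g) f)"

definition full_subcategory :: "('o, 'm) category \<Rightarrow> 'o set \<Rightarrow> ('o, 'm) category" where
  "full_subcategory C S = C\<lparr>objects := S\<rparr>"

definition is_iso :: "('o, 'm) category \<Rightarrow> 'o \<Rightarrow> 'o \<Rightarrow> 'm \<Rightarrow> bool" where
  "is_iso C A B f \<longleftrightarrow> f \<in> hom_set C A B \<and>
    (\<exists>g\<in>hom_set C B A. comp_mor C A B A g f = ident C A \<and> comp_mor C B A B f g = ident C B)"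

record ('o, 'm, 'p, 'n) cat_functor =
  fobj :: "'o \<Rightarrow> 'p"
  fmap :: "'o \<Rightarrow> 'o \<Rightarrow> 'm \<Rightarrow> 'n"

definition is_functor ::
  "('o, 'm) category \<Rightarrow> ('p, 'n) category \<Rightarrow> ('o, 'm, 'p, 'n) cat_functor \<Rightarrow> bool" where
  "is_functor C D F \<longleftrightarrow> is_category C \<and> is_category D \<and>
    (\<forall>A\<in>objects C. fobj F A \<in> objects D) \<and>
    (\<forall>A\<in>objects C. \<forall>B\<in>objects C. \<forall>f\<in>hom_set C A B.
       fmap F A B f \<in> hom_set D (fobj F A) (fobj F B)) \<and>
    (\<forall>A\<in>objects C. fmap F A A (ident C A) = ident D (fobj F A)) \<and>
    (\<forall>A\<in>objects C. \<forall>B\<in>objects C. \<forall>E\<in>objects C. \<forall>f\<in>hom_set C A B. \<forall>g\<in>hom_set C B E.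
       fmap F A E (comp_mor C A B E g f) =
         comp_mor D (fobj F A) (fobj F B) (fobj F E) (fmap F B E g) (fmap F A B f))"

definition id_functor :: "('o, 'm, 'o, 'm) cat_functor" where
  "id_functor = \<lparr>fobj = (\<lambda>A. A), fmap = (\<lambda>A B f. f)\<rparr>"

text \<open>The inclusion of a subcategory acts by the same formulas as the identity functor.\<close>

abbreviation inclusion_functor :: "('o, 'm, 'o, 'm) cat_functor" where
  "inclusion_functor \<equiv> id_functor"

definition comp_functor ::
  "('p, 'n, 'q, 'k) cat_functor \<Rightarrow> ('o, 'm, 'p, 'n) cat_functor \<Rightarrow> ('o, 'm, 'q, 'k) cat_functor" where
  "comp_functor G F =
    \<lparr>fobj = (\<lambda>A. fobj G (fobj F A)),
     fmap = (\<lambda>A B f. fmap G (fobj F A) (fobj F B) (fmap F A B f))\<rparr>"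

definition naturally_isomorphic ::
  "('o, 'm) category \<Rightarrow> ('p, 'n) category \<Rightarrow>
     ('o, 'm, 'p, 'n) cat_functor \<Rightarrow> ('o, 'm, 'p, 'n) cat_functor \<Rightarrow> bool" where
  "naturally_isomorphic C D F G \<longleftrightarrow>
    (\<exists>\<eta>. (\<forall>A\<in>objects C. is_iso D (fobj F A) (fobj G A) (\<eta> A)) \<and>
      (\<forall>A\<in>objects C. \<forall>B\<in>objects C. \<forall>f\<in>hom_set C A B.
         comp_mor D (fobj F A) (fobj F B) (fobj G B) (\<eta> B) (fmap F A B f) =
         comp_mor D (fobj F A) (fobj G A) (fobj G B) (fmap G A B f) (\<eta> A)))"

definition is_equivalence ::
  "('o, 'm) category \<Rightarrow> ('p, 'n) category \<Rightarrow> ('o, 'm, 'p, 'n) cat_functor \<Rightarrow> bool" where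
  "is_equivalence C D F \<longleftrightarrow> is_functor C D F \<and>
    (\<exists>G. is_functor D C G \<and>
      naturally_isomorphic C C (comp_functor G F) id_functor \<and>
      naturally_isomorphic D D (comp_functor F G) id_functor)"


section \<open>Connected graded algebras\<close>

text \<open>A graded algebra is the direct sum of its homogeneous components \<open>grade B n\<close>.\<close>

record ('r, 'a) galg = "('r, 'a) module" +
  grade :: "nat \<Rightarrow> 'a set"

locale connected_graded_algebra = module R B + ring B
  for R (structure) and B :: "('r, 'a, 'x) galg_scheme" (structure) +
  assumes smult_mult_left:
      "\<lbrakk>r \<in> carrier R; x \<in> carrier B; y \<in> carrier B\<rbrakk> \<Longrightarrow>
        (r \<odot>\<^bsub>B\<^esub> x) \<otimes>\<^bsub>B\<^esub> y = r \<odot>\<^bsub>B\<^esub> (x \<otimes>\<^bsub>B\<^esub> y)"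
    and smult_mult_right:
      "\<lbrakk>r \<in> carrier R; x \<in> carrier B; y \<in> carrier B\<rbrakk> \<Longrightarrow>
        x \<otimes>\<^bsub>B\<^esub> (r \<odot>\<^bsub>B\<^esub> y) = r \<odot>\<^bsub>B\<^esub> (x \<otimes>\<^bsub>B\<^esub> y)"
    and grade_submodule: "submodule (grade B n) R B"
    and grade_mult:
      "\<lbrakk>x \<in> grade B m; y \<in> grade B n\<rbrakk> \<Longrightarrow> x \<otimes>\<^bsub>B\<^esub> y \<in> grade B (m + n)"
    and grade_direct_sum:
      "x \<in> carrier B \<Longrightarrow>
        \<exists>!c. (\<forall>n. c n \<in> grade B n) \<and> finite {n. c n \<noteq> \<zero>\<^bsub>B\<^esub>} \<and>
             x = (\<Oplus>\<^bsub>B\<^esub>n\<in>{n. c n \<noteq> \<zero>\<^bsub>B\<^esub>}. c n)"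
    and connected: "bij_betw (\<lambda>r. r \<odot>\<^bsub>B\<^esub> \<one>\<^bsub>B\<^esub>) (carrier R) (grade B 0)"

text \<open>Morphisms are extensional functions, so that equality of morphisms is equality in HOL.\<close>

definition mor ::
  "('r, 'c) ring_scheme \<Rightarrow> ('r, 'a, 'x) galg_scheme \<Rightarrow> ('r, 'b, 'y) galg_scheme \<Rightarrow> ('a \<Rightarrow> 'b) set" where
  "mor R A B = {f \<in> ring_hom A B \<inter> extensional (carrier A).
     (\<forall>r\<in>carrier R. \<forall>x\<in>carrier A. f (r \<odot>\<^bsub>A\<^esub> x) = r \<odot>\<^bsub>B\<^esub> f x) \<and>
     (\<forall>n. f ` grade A n \<subseteq> grade B n)}"

definition id_mor :: "('a, 'x) partial_object_scheme \<Rightarrow> 'a \<Rightarrow> 'a" where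
  "id_mor A = (\<lambda>x\<in>carrier A. x)"

definition graded_commutative :: "('r, 'a, 'x) galg_scheme \<Rightarrow> bool" where
  "graded_commutative A \<longleftrightarrow>
    (\<forall>p q. \<forall>a\<in>grade A p. \<forall>b\<in>grade A q.
       a \<otimes>\<^bsub>A\<^esub> b = ((\<ominus>\<^bsub>A\<^esub> \<one>\<^bsub>A\<^esub>) [^]\<^bsub>A\<^esub> (p * q)) \<otimes>\<^bsub>A\<^esub> (b \<otimes>\<^bsub>A\<^esub> a))"

definition ground_alg :: "('r, 'c) ring_scheme \<Rightarrow> ('r, 'r) galg" where
  "ground_alg R = \<lparr>carrier = carrier R, mult = mult R, one = one R, zero = zero R, add = add R,
     smult = mult R, grade = (\<lambda>n. if n = 0 then carrier R else {\<zero>\<^bsub>R\<^esub>})\<rparr>"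

text \<open>The two descriptions below are unique because the ground ring is a zero object.\<close>

definition trivial_mor ::
  "('r, 'c) ring_scheme \<Rightarrow> ('r, 'a, 'x) galg_scheme \<Rightarrow> ('r, 'b, 'y) galg_scheme \<Rightarrow> 'a \<Rightarrow> 'b" where
  "trivial_mor R A B = compose (carrier A)
     (THE u. u \<in> mor R (ground_alg R) B) (THE e. e \<in> mor R A (ground_alg R))"


section \<open>Free products\<close>

definition free_algebra ::
  "('r, 'c) ring_scheme \<Rightarrow> 'l set \<Rightarrow> ('r, 'l list \<Rightarrow> 'r) module" where
  "free_algebra R L = \<lparr>
     carrier = {p. range p \<subseteq> carrier R \<and> finite {w. p w \<noteq> \<zero>\<^bsub>R\<^esub>} \<and>
                   (\<forall>w. p w \<noteq> \<zero>\<^bsub>R\<^esub> \<longrightarrow> w \<in> lists L)},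
     mult = (\<lambda>p q w. \<Oplus>\<^bsub>R\<^esub>i\<in>{..length w}. p (take i w) \<otimes>\<^bsub>R\<^esub> q (drop i w)),
     one = (\<lambda>w. if w = [] then \<one>\<^bsub>R\<^esub> else \<zero>\<^bsub>R\<^esub>),
     zero = (\<lambda>w. \<zero>\<^bsub>R\<^esub>),
     add = (\<lambda>p q w. p w \<oplus>\<^bsub>R\<^esub> q w),
     smult = (\<lambda>r p w. r \<otimes>\<^bsub>R\<^esub> p w)\<rparr>"

definition word :: "('r, 'c) ring_scheme \<Rightarrow> 'l list \<Rightarrow> 'l list \<Rightarrow> 'r" where
  "word R w = (\<lambda>v. if v = w then \<one>\<^bsub>R\<^esub> else \<zero>\<^bsub>R\<^esub>)"

text \<open>The relations saying that \<open>j\<close>, from \<open>A\<close> into the letters \<open>L\<close>, becomes a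
  homomorphism of unital algebras.\<close>

definition hom_relations ::
  "('r, 'c) ring_scheme \<Rightarrow> 'l set \<Rightarrow> ('r, 'a, 'x) galg_scheme \<Rightarrow> ('a \<Rightarrow> 'l) \<Rightarrow> ('l list \<Rightarrow> 'r) set" where
  "hom_relations R L A j = (let F = free_algebra R L in
     {word R [j (x \<oplus>\<^bsub>A\<^esub> y)] \<ominus>\<^bsub>F\<^esub> (word R [j x] \<oplus>\<^bsub>F\<^esub> word R [j y]) |x y.
        x \<in> carrier A \<and> y \<in> carrier A} \<union>
     {word R [j (r \<odot>\<^bsub>A\<^esub> x)] \<ominus>\<^bsub>F\<^esub> (r \<odot>\<^bsub>F\<^esub> word R [j x]) |r x.
        r \<in> carrier R \<and> x \<in> carrier A} \<union>
     {word R [j (x \<otimes>\<^bsub>A\<^esub> y)] \<ominus>\<^bsub>F\<^esub> word R [j x, j y] |x y.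
        x \<in> carrier A \<and> y \<in> carrier A} \<union>
     {word R [j \<one>\<^bsub>A\<^esub>] \<ominus>\<^bsub>F\<^esub> \<one>\<^bsub>F\<^esub>})"

definition free_product_cover ::
  "('r, 'c) ring_scheme \<Rightarrow> ('r, 'a, 'x) galg_scheme \<Rightarrow> ('r, 'b, 'y) galg_scheme \<Rightarrow>
     ('r, ('a + 'b) list \<Rightarrow> 'r) module" where
  "free_product_cover R A B = free_algebra R (carrier A <+> carrier B)"

definition free_product_ideal ::
  "('r, 'c) ring_scheme \<Rightarrow> ('r, 'a, 'x) galg_scheme \<Rightarrow> ('r, 'b, 'y) galg_scheme \<Rightarrow>
     (('a + 'b) list \<Rightarrow> 'r) set" where
  "free_product_ideal R A B =
     Idl\<^bsub>free_product_cover R A B\<^esub>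
       (hom_relations R (carrier A <+> carrier B) A Inl \<union>
        hom_relations R (carrier A <+> carrier B) B Inr)"

definition word_degree ::
  "('r, 'a, 'x) galg_scheme \<Rightarrow> ('r, 'b, 'y) galg_scheme \<Rightarrow> ('a + 'b) list \<Rightarrow> nat \<Rightarrow> bool" where
  "word_degree A B w n \<longleftrightarrow>
     (\<exists>ds. list_all2 (\<lambda>l d. l \<in> grade A d <+> grade B d) w ds \<and> sum_list ds = n)"

text \<open>The coproduct of \<open>A\<close> and \<open>B\<close>, as a quotient of the free algebra on the disjoint union
  of their elements.\<close>

definition free_product ::
  "('r, 'c) ring_scheme \<Rightarrow> ('r, 'a, 'x) galg_scheme \<Rightarrow> ('r, 'b, 'y) galg_scheme \<Rightarrow>
     ('r, (('a + 'b) list \<Rightarrow> 'r) set) galg" where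
  "free_product R A B =
    (let F = free_product_cover R A B; I = free_product_ideal R A B; Q = F Quot I in
     \<lparr>carrier = carrier Q, mult = mult Q, one = one Q, zero = zero Q, add = add Q,
      smult = (\<lambda>r X. \<Union>p\<in>X. I +>\<^bsub>F\<^esub> (r \<odot>\<^bsub>F\<^esub> p)),
      grade = (\<lambda>n. {I +>\<^bsub>F\<^esub> p |p. p \<in> carrier F \<and>
                      (\<forall>w. p w \<noteq> \<zero>\<^bsub>R\<^esub> \<longrightarrow> word_degree A B w n)})\<rparr>)"

definition incl1 ::
  "('r, 'c) ring_scheme \<Rightarrow> ('r, 'a, 'x) galg_scheme \<Rightarrow> ('r, 'b, 'y) galg_scheme \<Rightarrow>
     'a \<Rightarrow> (('a + 'b) list \<Rightarrow> 'r) set" where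
  "incl1 R A B = (\<lambda>x\<in>carrier A.
     free_product_ideal R A B +>\<^bsub>free_product_cover R A B\<^esub> word R [Inl x])"

definition incl2 ::
  "('r, 'c) ring_scheme \<Rightarrow> ('r, 'a, 'x) galg_scheme \<Rightarrow> ('r, 'b, 'y) galg_scheme \<Rightarrow>
     'b \<Rightarrow> (('a + 'b) list \<Rightarrow> 'r) set" where
  "incl2 R A B = (\<lambda>x\<in>carrier B.
     free_product_ideal R A B +>\<^bsub>free_product_cover R A B\<^esub> word R [Inr x])"

text \<open>The morphism \<open>(f, g) : A \<star> B \<rightarrow> C\<close> given by the universal property of the coproduct.\<close>

definition copair ::
  "('r, 'c) ring_scheme \<Rightarrow> ('r, 'a, 'x) galg_scheme \<Rightarrow> ('r, 'b, 'y) galg_scheme \<Rightarrow>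
     ('r, 'd, 'z) galg_scheme \<Rightarrow> ('a \<Rightarrow> 'd) \<Rightarrow> ('b \<Rightarrow> 'd) \<Rightarrow> (('a + 'b) list \<Rightarrow> 'r) set \<Rightarrow> 'd" where
  "copair R A B C f g =
    (THE h. h \<in> mor R (free_product R A B) C \<and>
       compose (carrier A) h (incl1 R A B) = f \<and> compose (carrier B) h (incl2 R A B) = g)"

text \<open>\<open>f \<star> g : A \<star> B \<rightarrow> C \<star> D\<close>\<close>

definition free_product_mor ::
  "('r, 'c) ring_scheme \<Rightarrow> ('r, 'a, 'x) galg_scheme \<Rightarrow> ('r, 'b, 'y) galg_scheme \<Rightarrow>
     ('r, 'd, 'z) galg_scheme \<Rightarrow> ('r, 'e, 'w) galg_scheme \<Rightarrow> ('a \<Rightarrow> 'd) \<Rightarrow> ('b \<Rightarrow> 'e) \<Rightarrow>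
     (('a + 'b) list \<Rightarrow> 'r) set \<Rightarrow> (('d + 'e) list \<Rightarrow> 'r) set" where
  "free_product_mor R A B C D f g =
    copair R A B (free_product R C D)
      (compose (carrier A) (incl1 R C D) f) (compose (carrier B) (incl2 R C D) g)"

text \<open>The canonical isomorphism \<open>(A \<star> A) \<star> A \<rightarrow> A \<star> (A \<star> A)\<close>.\<close>

definition assoc_mor ::
  "('r, 'c) ring_scheme \<Rightarrow> ('r, 'a, 'x) galg_scheme \<Rightarrow>
     (((('a + 'a) list \<Rightarrow> 'r) set + 'a) list \<Rightarrow> 'r) set \<Rightarrow>
     (('a + (('a + 'a) list \<Rightarrow> 'r) set) list \<Rightarrow> 'r) set" where
  "assoc_mor R A =
    (let P = free_product R A A; Q = free_product R A P in
     copair R P A Q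
       (copair R A A Q (incl1 R A P) (compose (carrier A) (incl2 R A P) (incl1 R A A)))
       (compose (carrier A) (incl2 R A P) (incl2 R A A)))"


section \<open>Cogroups\<close>

record ('r, 'a) cogroup = "('r, 'a) galg" +
  comult :: "'a \<Rightarrow> (('a + 'a) list \<Rightarrow> 'r) set"

definition coassociative :: "('r, 'c) ring_scheme \<Rightarrow> ('r, 'a) cogroup \<Rightarrow> bool" where
  "coassociative R A \<longleftrightarrow>
    (let P = free_product R A A in
     compose (carrier A) (assoc_mor R A)
       (compose (carrier A) (free_product_mor R A A P A (comult A) (id_mor A)) (comult A)) =
     compose (carrier A) (free_product_mor R A A A P (id_mor A) (comult A)) (comult A))"

text \<open>The counit is necessarily the unique morphism from \<open>A\<close> to the zero object.\<close>

definition counital :: "('r, 'c) ring_scheme \<Rightarrow> ('r, 'a) cogroup \<Rightarrow> bool" where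
  "counital R A \<longleftrightarrow>
    compose (carrier A) (copair R A A A (id_mor A) (trivial_mor R A A)) (comult A) = id_mor A \<and>
    compose (carrier A) (copair R A A A (trivial_mor R A A) (id_mor A)) (comult A) = id_mor A"

definition coinverse :: "('r, 'c) ring_scheme \<Rightarrow> ('r, 'a) cogroup \<Rightarrow> ('a \<Rightarrow> 'a) \<Rightarrow> bool" where
  "coinverse R A \<nu> \<longleftrightarrow> \<nu> \<in> mor R A A \<and>
    compose (carrier A) (copair R A A A (id_mor A) \<nu>) (comult A) = trivial_mor R A A \<and>
    compose (carrier A) (copair R A A A \<nu> (id_mor A)) (comult A) = trivial_mor R A A"

definition is_cogroup :: "('r, 'c) ring_scheme \<Rightarrow> ('r, 'a) cogroup \<Rightarrow> bool" where
  "is_cogroup R A \<longleftrightarrow> connected_graded_algebra R A \<and>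
     comult A \<in> mor R A (free_product R A A) \<and>
     coassociative R A \<and> counital R A \<and> (\<exists>\<nu>. coinverse R A \<nu>)"

definition cogroup_mor ::
  "('r, 'c) ring_scheme \<Rightarrow> ('r, 'a) cogroup \<Rightarrow> ('r, 'b) cogroup \<Rightarrow> ('a \<Rightarrow> 'b) set" where
  "cogroup_mor R A B = {f \<in> mor R A B.
     compose (carrier A) (comult B) f =
     compose (carrier A) (free_product_mor R A A B B f f) (comult A)}"

text \<open>The cogroups are those with elements in the type \<open>'u\<close>, which plays the role of a
  universe of sets.\<close>

definition cogroup_category :: "('r, 'c) ring_scheme \<Rightarrow> (('r, 'u) cogroup, 'u \<Rightarrow> 'u) category" where
  "cogroup_category R =
    \<lparr>objects = {A. is_cogroup R A},
     hom_set = cogroup_mor R,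
     ident = id_mor,
     comp_mor = (\<lambda>A B D g f. compose (carrier A) g f)\<rparr>"

definition comm_cogroup_category ::
  "('r, 'c) ring_scheme \<Rightarrow> (('r, 'u) cogroup, 'u \<Rightarrow> 'u) category" where
  "comm_cogroup_category R =
    full_subcategory (cogroup_category R)
      {A \<in> objects (cogroup_category R). graded_commutative A}"


section \<open>The cogroups A(n)\<close>

text \<open>Transport of structure along a map that is injective on the carrier; it is used to place
  the polynomial ring in the universe \<open>'u\<close>.\<close>

definition copy_alg :: "('a \<Rightarrow> 'u) \<Rightarrow> ('r, 'a) galg \<Rightarrow> ('r, 'u) galg" where
  "copy_alg \<iota> A = (let d = inv_into (carrier A) \<iota> in
     \<lparr>carrier = \<iota> ` carrier A,
      mult = (\<lambda>x y. \<iota> (d x \<otimes>\<^bsub>A\<^esub> d y)), one = \<iota> \<one>\<^bsub>A\<^esub>,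
      zero = \<iota> \<zero>\<^bsub>A\<^esub>, add = (\<lambda>x y. \<iota> (d x \<oplus>\<^bsub>A\<^esub> d y)),
      smult = (\<lambda>r x. \<iota> (r \<odot>\<^bsub>A\<^esub> d x)), grade = (\<lambda>n. \<iota> ` grade A n)\<rparr>)"

text \<open>\<open>R[X]\<close> with \<open>X\<close> in degree \<open>n > 0\<close>.\<close>

definition poly_alg :: "('r, 'c) ring_scheme \<Rightarrow> nat \<Rightarrow> ('r, nat \<Rightarrow> 'r) galg" where
  "poly_alg R n = (let P = UP R in
     \<lparr>carrier = carrier P, mult = mult P, one = one P, zero = zero P, add = add P,
      smult = smult P,
      grade = (\<lambda>k. {p \<in> carrier P. \<forall>j. coeff P p j \<noteq> \<zero>\<^bsub>R\<^esub> \<longrightarrow> j * n = k})\<rparr>)"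

definition gen :: "('r, 'c) ring_scheme \<Rightarrow> ((nat \<Rightarrow> 'r) \<Rightarrow> 'u) \<Rightarrow> 'u" where
  "gen R \<iota> = \<iota> (monom (UP R) \<one>\<^bsub>R\<^esub> 1)"

definition A_alg :: "('r, 'c) ring_scheme \<Rightarrow> ((nat \<Rightarrow> 'r) \<Rightarrow> 'u) \<Rightarrow> nat \<Rightarrow> ('r, 'u) galg" where
  "A_alg R \<iota> n =
     (if n = 0 then copy_alg (\<lambda>r. \<iota> (monom (UP R) r 0)) (ground_alg R)
      else copy_alg \<iota> (poly_alg R n))"

text \<open>For \<open>n = 0\<close> there is only one morphism from \<open>A_alg R \<iota> 0\<close>, the unit.\<close>

definition A_comult ::
  "('r, 'c) ring_scheme \<Rightarrow> ((nat \<Rightarrow> 'r) \<Rightarrow> 'u) \<Rightarrow> nat \<Rightarrow> 'u \<Rightarrow> (('u + 'u) list \<Rightarrow> 'r) set" where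
  "A_comult R \<iota> n =
     (let A = A_alg R \<iota> n; P = free_product R A A; X = gen R \<iota> in
      THE \<Phi>. \<Phi> \<in> mor R A P \<and> (n > 0 \<longrightarrow> \<Phi> X = incl1 R A A X \<oplus>\<^bsub>P\<^esub> incl2 R A A X))"

definition A_cogroup ::
  "('r, 'c) ring_scheme \<Rightarrow> ((nat \<Rightarrow> 'r) \<Rightarrow> 'u) \<Rightarrow> nat \<Rightarrow> ('r, 'u) cogroup" where
  "A_cogroup R \<iota> n = galg.extend (A_alg R \<iota> n) (cogroup.fields (A_comult R \<iota> n))"

text \<open>The additive order of \<open>1\<close>; \<^const>\<open>group.ord\<close> is \<open>0\<close> for elements of infinite order.\<close>

definition ring_char :: "('r, 'c) ring_scheme \<Rightarrow> nat" where
  "ring_char R = group.ord (add_monoid R) \<one>\<^bsub>R\<^esub>"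

end

theory Submission
  imports Defs
begin

text \<open>A full subcategory that meets every isomorphism class of a category is equivalent to it, so the
  theorem is about single cogroups: each graded commutative cogroup \<open>B\<close> over the field \<open>R\<close> has to be
  isomorphic to some \<open>A(n)\<close>, and the morphisms \<open>A(m) \<rightarrow> A(n)\<close> have to be found.

  Let \<open>\<epsilon> : B \<rightarrow> R\<close> be the augmentation and write \<open>b'\<close>, \<open>b''\<close> for the two images of \<open>b\<close> in the free
  product \<open>B \<star> B\<close>. For a linear functional \<open>\<beta> : B \<rightarrow> R\<close> the algebra \<open>B \<star> B\<close> acts on \<open>B \<times> B\<close> by
  \<open>b''(u, v) = (bu, \<epsilon>(b)v)\<close> and \<open>b'(u, v) = (\<epsilon>(b)u, bv + \<beta>(u)(b - \<epsilon>(b)))\<close>. Applied to \<open>(1, 0)\<close>, a word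
  \<open>a'b''\<close> with \<open>\<epsilon>(a) = 0\<close> gives \<open>\<beta>(b)a\<close> in the second coordinate, so these actions see the two-letter
  words of \<open>B \<star> B\<close> and make a normal form for its elements unnecessary. An element \<open>x\<close> of positive
  degree with \<open>\<Phi>(x) = x' + x''\<close> acts through \<open>\<Phi>\<close> by \<open>(u, v) \<mapsto> (xu, xv + \<beta>(u)x)\<close>. Three choices of
  \<open>\<beta>\<close> carry the proof.

  \<^item> Let \<open>x \<noteq> 0\<close> have the least positive degree \<open>n\<close> in which \<open>B\<close> does not vanish. For reasons of degree
    \<open>\<Phi>(x) = u' + v''\<close> up to a scalar, and the counit gives \<open>\<Phi>(x) = x' + x''\<close>
    (\<open>lowest_degree_primitive\<close>). If \<open>x\<^sup>k \<noteq> 0\<close>, let \<open>\<beta>\<close> be \<open>1\<close> at \<open>x\<^sup>k\<close> and \<open>0\<close> at the lower powers: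
    then \<open>x\<^sup>k\<^sup>+\<^sup>1\<close> moves \<open>(1, 0)\<close> to \<open>(x\<^sup>k\<^sup>+\<^sup>1, x)\<close>, so \<open>x\<^sup>k\<^sup>+\<^sup>1 \<noteq> 0\<close> (\<open>primitive_power_nonzero\<close>).

  \<^item> Suppose that \<open>y\<close> is homogeneous of least degree outside \<open>R[x]\<close>. Then \<open>\<Phi>(y) = u' + v'' + s\<close> with
    \<open>s\<close> a combination of words in elements of \<open>R[x]\<close>, and \<open>v \<equiv> y\<close> modulo \<open>R[x]\<close>. Let \<open>\<beta>\<close> vanish on
    \<open>R[x]\<close> with \<open>\<beta>(y) = 1\<close>. The second coordinate of \<open>(xy)(1, 0)\<close> is \<open>x\<close> while that of \<open>(yx)(1, 0)\<close> is
    \<open>0\<close>, against \<open>xy = \<plusminus>yx\<close>. Hence \<open>B = R[x]\<close> (\<open>generated_by_primitive\<close>). If \<open>n\<close> is odd, then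
    \<open>x\<^sup>2 = -x\<^sup>2 \<noteq> 0\<close> and the characteristic is \<open>2\<close>.

  \<^item> A morphism \<open>A(m) \<rightarrow> A(n)\<close> is given by the image \<open>rX\<^sup>k\<close> of the generator, where \<open>kn = m\<close>, subject to
    \<open>\<Phi>(rX\<^sup>k) = (rX\<^sup>k)' + (rX\<^sup>k)''\<close>. For \<open>k \<ge> 2\<close> the functional that is \<open>1\<close> at \<open>X\<^sup>k\<^sup>-\<^sup>1\<close> and \<open>0\<close> at the
    lower powers gives \<open>r = 0\<close> (\<open>primitive_power_not_primitive\<close>).

  That the \<open>A(n)\<close> are cogroups is checked on the generator, because \<open>R[X]\<close> is the free algebra on one
  letter and so a morphism out of \<open>A(n)\<close> is determined by the image of \<open>X\<close>.\<close>

section \<open>Equivalences of categories\<close>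

lemma is_categoryD:
  assumes "is_category C"
  shows "A \<in> objects C \<Longrightarrow> ident C A \<in> hom_set C A A"
    and "\<lbrakk>A \<in> objects C; B \<in> objects C; D \<in> objects C; f \<in> hom_set C A B; g \<in> hom_set C B D\<rbrakk>
      \<Longrightarrow> comp_mor C A B D g f \<in> hom_set C A D"
    and "\<lbrakk>A \<in> objects C; B \<in> objects C; f \<in> hom_set C A B\<rbrakk> \<Longrightarrow> comp_mor C A A B f (ident C A) = f"
    and "\<lbrakk>A \<in> objects C; B \<in> objects C; f \<in> hom_set C A B\<rbrakk> \<Longrightarrow> comp_mor C A B B (ident C B) f = f"
    and "\<lbrakk>A \<in> objects C; B \<in> objects C; D \<in> objects C; E \<in> objects C;
      f \<in> hom_set C A B; g \<in> hom_set C B D; h \<in> hom_set C D E\<rbrakk>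
      \<Longrightarrow> comp_mor C A D E h (comp_mor C A B D g f) = comp_mor C A B E (comp_mor C B D E h g) f"
  using assms unfolding is_category_def by blast+

lemma full_subcategory_simps [simp]:
  "objects (full_subcategory C S) = S"
  "hom_set (full_subcategory C S) = hom_set C"
  "ident (full_subcategory C S) = ident C"
  "comp_mor (full_subcategory C S) = comp_mor C"
  by (auto simp: full_subcategory_def)

lemma full_subcategory_is_category:
  assumes "is_category C" "S \<subseteq> objects C"
  shows "is_category (full_subcategory C S)"
  using assms unfolding is_category_def by (simp add: subset_iff)

text \<open>Choose for each object \<open>A\<close> an isomorphism \<open>e A\<close> to an object \<open>r A\<close> of the subcategory, with inverse
  \<open>i A\<close>. Conjugation by these isomorphisms turns \<open>r\<close> into a functor, and the \<open>i A\<close> themselves are the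
  components of both natural isomorphisms.\<close>

lemma full_subcategory_inclusion_equivalence:
  assumes cat: "is_category C" and S: "S \<subseteq> objects C"
    and ess: "\<And>A. A \<in> objects C \<Longrightarrow> \<exists>B\<in>S. \<exists>f. is_iso C A B f"
  shows "is_equivalence (full_subcategory C S) C inclusion_functor"
proof -
  note C = is_categoryD[OF cat]
  define D where "D = full_subcategory C S"
  have D [simp]: "objects D = S" "hom_set D = hom_set C" "ident D = ident C" "comp_mor D = comp_mor C"
    by (simp_all add: D_def)
  have Dcat: "is_category D"
    using full_subcategory_is_category[OF cat S] by (simp add: D_def)
  have "\<forall>A. \<exists>B f g. A \<in> objects C \<longrightarrow> B \<in> S \<and> f \<in> hom_set C A B \<and> g \<in> hom_set C B A \<and>
      comp_mor C A B A g f = ident C A \<and> comp_mor C B A B f g = ident C B"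
    using ess unfolding is_iso_def by meson
  then obtain r e i where "\<forall>A. A \<in> objects C \<longrightarrow> r A \<in> S \<and> e A \<in> hom_set C A (r A) \<and>
      i A \<in> hom_set C (r A) A \<and> comp_mor C A (r A) A (i A) (e A) = ident C A \<and>
      comp_mor C (r A) A (r A) (e A) (i A) = ident C (r A)"
    by metis
  then have r: "\<And>A. A \<in> objects C \<Longrightarrow> r A \<in> S"
    and e: "\<And>A. A \<in> objects C \<Longrightarrow> e A \<in> hom_set C A (r A)"
    and i: "\<And>A. A \<in> objects C \<Longrightarrow> i A \<in> hom_set C (r A) A"
    and ie: "\<And>A. A \<in> objects C \<Longrightarrow> comp_mor C A (r A) A (i A) (e A) = ident C A"
    and ei: "\<And>A. A \<in> objects C \<Longrightarrow> comp_mor C (r A) A (r A) (e A) (i A) = ident C (r A)"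
    by auto
  have r': "\<And>A. A \<in> objects C \<Longrightarrow> r A \<in> objects C"
    using r S by blast
  define G where "G = \<lparr>fobj = r,
    fmap = (\<lambda>A B f. comp_mor C (r A) A (r B) (comp_mor C A B (r B) (e B) f) (i A))\<rparr>"
  have G [simp]: "fobj G = r"
    "fmap G A B f = comp_mor C (r A) A (r B) (comp_mor C A B (r B) (e B) f) (i A)" for A B f
    by (simp_all add: G_def)
  have Gf: "is_functor C D G"
    unfolding is_functor_def
  proof (intro conjI ballI)
    fix A assume A: "A \<in> objects C"
    show "fmap G A A (ident C A) = ident D (fobj G A)"
      by (simp add: A C(3)[OF A r'[OF A] e[OF A]] ei)
  next
    fix A B E f g
    assume A: "A \<in> objects C" and B: "B \<in> objects C" and E: "E \<in> objects C"
      and f: "f \<in> hom_set C A B" and g: "g \<in> hom_set C B E"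
    let ?ef = "comp_mor C A B (r B) (e B) f" and ?eg = "comp_mor C B E (r E) (e E) g"
    have ef: "?ef \<in> hom_set C A (r B)" and eg: "?eg \<in> hom_set C B (r E)"
      by (auto intro!: C(2) A B E f g e r')
    have "comp_mor C (r A) (r B) (r E) (comp_mor C (r B) B (r E) ?eg (i B)) (comp_mor C (r A) A (r B) ?ef (i A))
      = comp_mor C (r A) A (r E) (comp_mor C A (r B) (r E) (comp_mor C (r B) B (r E) ?eg (i B)) ?ef) (i A)"
      by (intro C(5) r' A B E i ef C(2) eg)
    also have "comp_mor C A (r B) (r E) (comp_mor C (r B) B (r E) ?eg (i B)) ?ef
      = comp_mor C A B (r E) ?eg (comp_mor C A (r B) B (i B) ?ef)"
      by (intro C(5)[symmetric] r' A B E i ef eg)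
    also have "comp_mor C A (r B) B (i B) ?ef = comp_mor C A B B (comp_mor C B (r B) B (i B) (e B)) f"
      by (intro C(5) r' A B i e f)
    also have "\<dots> = f"
      by (simp add: ie B C(4)[OF A B f])
    also have "comp_mor C A B (r E) ?eg f = comp_mor C A E (r E) (e E) (comp_mor C A B E g f)"
      by (intro C(5)[symmetric] r' A B E e f g)
    finally show "fmap G A E (comp_mor C A B E g f) =
      comp_mor D (fobj G A) (fobj G B) (fobj G E) (fmap G B E g) (fmap G A B f)"
      by simp
  qed (auto intro!: cat Dcat C(2) r r' e i)
  have If: "is_functor D C id_functor"
    unfolding is_functor_def id_functor_def using cat Dcat S by auto
  have iso: "is_iso C (r A) A (i A)" if "A \<in> objects C" for A
    unfolding is_iso_def using that e i ie ei by blast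
  have nat: "comp_mor C (r A) (r B) B (i B) (fmap G A B f) = comp_mor C (r A) A B f (i A)"
    if A: "A \<in> objects C" and B: "B \<in> objects C" and f: "f \<in> hom_set C A B" for A B f
  proof -
    have "comp_mor C (r A) (r B) B (i B) (fmap G A B f) =
      comp_mor C (r A) A B (comp_mor C A (r B) B (i B) (comp_mor C A B (r B) (e B) f)) (i A)"
      unfolding G by (intro C(5) r' A B i C(2) e f)
    also have "comp_mor C A (r B) B (i B) (comp_mor C A B (r B) (e B) f) =
      comp_mor C A B B (comp_mor C B (r B) B (i B) (e B)) f"
      by (intro C(5) r' A B i e f)
    also have "\<dots> = f"
      by (simp add: ie B C(4)[OF A B f])
    finally show ?thesis .
  qed
  have "naturally_isomorphic D D (comp_functor G id_functor) id_functor"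
    unfolding naturally_isomorphic_def
    by (rule exI[of _ i]) (use iso nat S in \<open>auto simp: comp_functor_def id_functor_def is_iso_def subset_iff\<close>)
  moreover have "naturally_isomorphic C C (comp_functor id_functor G) id_functor"
    unfolding naturally_isomorphic_def
    by (rule exI[of _ i]) (use iso nat in \<open>auto simp: comp_functor_def id_functor_def\<close>)
  ultimately show ?thesis
    unfolding is_equivalence_def D_def[symmetric] using If Gf by blast
qed

section \<open>Graded algebras and their morphisms\<close>

text \<open>The part of the structure of a connected graded algebra that consists of equations and closure
  conditions. It passes to surjective images, and so to free products, without any knowledge of their
  homogeneous components. Ungraded algebras are included: give every degree the whole algebra.\<close>

locale graded_algebra = module R B + ring B
  for R :: "('r, 'c) ring_scheme" and B :: "('r, 'a, 'x) galg_scheme" (structure) +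
  assumes smult_mult_left:
      "\<lbrakk>r \<in> carrier R; x \<in> carrier B; y \<in> carrier B\<rbrakk> \<Longrightarrow>
        (r \<odot> x) \<otimes> y = r \<odot> (x \<otimes> y)"
    and smult_mult_right:
      "\<lbrakk>r \<in> carrier R; x \<in> carrier B; y \<in> carrier B\<rbrakk> \<Longrightarrow>
        x \<otimes> (r \<odot> y) = r \<odot> (x \<otimes> y)"
    and grade_submodule: "submodule (grade B n) R B"
    and grade_mult:
      "\<lbrakk>x \<in> grade B m; y \<in> grade B n\<rbrakk> \<Longrightarrow> x \<otimes> y \<in> grade B (m + n)"
    and grade_one: "\<one> \<in> grade B 0"
begin

lemma grade_carrier: "x \<in> grade B n \<Longrightarrow> x \<in> carrier B"
  using submoduleE(1)[OF grade_submodule[of n]] by blast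

lemma grade_zero: "\<zero> \<in> grade B n"
  using subgroup.one_closed[OF submodule.axioms(1)[OF grade_submodule[of n]]] by simp

lemma grade_add: "x \<in> grade B n \<Longrightarrow> y \<in> grade B n \<Longrightarrow> x \<oplus> y \<in> grade B n"
  using submoduleE(5)[OF grade_submodule[of n]] by blast

lemma grade_smult: "r \<in> carrier R \<Longrightarrow> x \<in> grade B n \<Longrightarrow> r \<odot> x \<in> grade B n"
  using submoduleE(4)[OF grade_submodule[of n]] by blast

lemma grade_uminus: "x \<in> grade B n \<Longrightarrow> \<ominus> x \<in> grade B n"
  using submoduleE(3)[OF grade_submodule[of n]] by blast

lemma grade_minus: "x \<in> grade B n \<Longrightarrow> y \<in> grade B n \<Longrightarrow> x \<ominus> y \<in> grade B n"
  by (simp add: a_minus_def grade_add grade_uminus)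

lemma grade_pow: "x \<in> grade B n \<Longrightarrow> x [^] (k::nat) \<in> grade B (k * n)"
proof (induction k)
  case (Suc k)
  then show ?case
    using grade_mult[of "x [^] k" "k * n" x n] by (simp add: add.commute)
qed (simp add: grade_one)

lemma smult_one_mult: "r \<in> carrier R \<Longrightarrow> x \<in> carrier B \<Longrightarrow> (r \<odot> \<one>) \<otimes> x = r \<odot> x"
  by (simp add: smult_mult_left)

lemma mult_smult_one: "r \<in> carrier R \<Longrightarrow> x \<in> carrier B \<Longrightarrow> x \<otimes> (r \<odot> \<one>) = r \<odot> x"
  by (simp add: smult_mult_right)

lemma uminus_eq_smult: "x \<in> carrier B \<Longrightarrow> \<ominus> x = (\<ominus>\<^bsub>R\<^esub> \<one>\<^bsub>R\<^esub>) \<odot> x"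
  by (simp add: smult_l_minus)

end

lemma connected_is_graded_algebra:
  assumes "connected_graded_algebra R B"
  shows "graded_algebra R B"
proof -
  interpret connected_graded_algebra R B by fact
  have "\<one>\<^bsub>R\<^esub> \<odot>\<^bsub>B\<^esub> \<one>\<^bsub>B\<^esub> \<in> grade B 0"
    using bij_betwE[OF connected] by blast
  then have "\<one>\<^bsub>B\<^esub> \<in> grade B 0" by simp
  then show ?thesis
    by (intro graded_algebra.intro graded_algebra_axioms.intro module_axioms ring_axioms
        smult_mult_left smult_mult_right grade_mult grade_submodule)
qed

text \<open>All axioms are equations or closure conditions, hence inherited by surjective images. This one lemma
  provides the free products, as quotients of free algebras, and the copies of the polynomial rings.\<close>

lemma graded_algebra_surjective_image:
  fixes A :: "('r, 'a, 'x) galg_scheme" and B :: "('r, 'b, 'y) galg_scheme"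
  assumes A: "graded_algebra R A" and h: "h ` carrier A = carrier B"
    and add: "\<And>x y. \<lbrakk>x \<in> carrier A; y \<in> carrier A\<rbrakk> \<Longrightarrow> h (x \<oplus>\<^bsub>A\<^esub> y) = h x \<oplus>\<^bsub>B\<^esub> h y"
    and mult: "\<And>x y. \<lbrakk>x \<in> carrier A; y \<in> carrier A\<rbrakk> \<Longrightarrow> h (x \<otimes>\<^bsub>A\<^esub> y) = h x \<otimes>\<^bsub>B\<^esub> h y"
    and smult: "\<And>r x. \<lbrakk>r \<in> carrier R; x \<in> carrier A\<rbrakk> \<Longrightarrow> h (r \<odot>\<^bsub>A\<^esub> x) = r \<odot>\<^bsub>B\<^esub> h x"
    and one: "h \<one>\<^bsub>A\<^esub> = \<one>\<^bsub>B\<^esub>" and zero: "h \<zero>\<^bsub>A\<^esub> = \<zero>\<^bsub>B\<^esub>"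
    and grade: "\<And>n. grade B n = h ` grade A n"
  shows "graded_algebra R B"
proof -
  interpret A: graded_algebra R A by fact
  have ex: "\<exists>a\<in>carrier A. x = h a" if "x \<in> carrier B" for x
    using that h by blast
  have cl: "h a \<in> carrier B" if "a \<in> carrier A" for a
    using that h by blast
  note homs = add[symmetric] mult[symmetric] smult[symmetric] one[symmetric] zero[symmetric] cl
  have ag: "abelian_group B"
  proof (rule abelian_groupI)
    fix x y z assume "x \<in> carrier B" "y \<in> carrier B" "z \<in> carrier B"
    then obtain a b c where "a \<in> carrier A" "b \<in> carrier A" "c \<in> carrier A" "x = h a" "y = h b" "z = h c"
      using ex by meson
    then show "x \<oplus>\<^bsub>B\<^esub> y \<oplus>\<^bsub>B\<^esub> z = x \<oplus>\<^bsub>B\<^esub> (y \<oplus>\<^bsub>B\<^esub> z)"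
      by (simp add: homs A.a_assoc)
  next
    fix x y assume "x \<in> carrier B" "y \<in> carrier B"
    then obtain a b where "a \<in> carrier A" "b \<in> carrier A" "x = h a" "y = h b"
      using ex by meson
    then show "x \<oplus>\<^bsub>B\<^esub> y = y \<oplus>\<^bsub>B\<^esub> x" "x \<oplus>\<^bsub>B\<^esub> y \<in> carrier B"
      by (simp_all add: homs A.a_comm)
  next
    show "\<zero>\<^bsub>B\<^esub> \<in> carrier B" by (simp add: homs)
  next
    fix x assume "x \<in> carrier B"
    then obtain a where a: "a \<in> carrier A" "x = h a"
      using ex by meson
    then show "\<zero>\<^bsub>B\<^esub> \<oplus>\<^bsub>B\<^esub> x = x" by (simp add: homs)
    show "\<exists>y\<in>carrier B. y \<oplus>\<^bsub>B\<^esub> x = \<zero>\<^bsub>B\<^esub>"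
      by (rule bexI[of _ "h (\<ominus>\<^bsub>A\<^esub> a)"]) (use a in \<open>auto simp: homs A.l_neg\<close>)
  qed
  have mon: "monoid B"
  proof (rule monoidI)
    fix x y z assume "x \<in> carrier B" "y \<in> carrier B" "z \<in> carrier B"
    then obtain a b c where "a \<in> carrier A" "b \<in> carrier A" "c \<in> carrier A" "x = h a" "y = h b" "z = h c"
      using ex by meson
    then show "x \<otimes>\<^bsub>B\<^esub> y \<otimes>\<^bsub>B\<^esub> z = x \<otimes>\<^bsub>B\<^esub> (y \<otimes>\<^bsub>B\<^esub> z)"
      by (simp add: homs A.m_assoc)
  next
    fix x y assume "x \<in> carrier B" "y \<in> carrier B"
    then obtain a b where "a \<in> carrier A" "b \<in> carrier A" "x = h a" "y = h b"
      using ex by meson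
    then show "x \<otimes>\<^bsub>B\<^esub> y \<in> carrier B"
      by (simp add: homs)
  next
    show "\<one>\<^bsub>B\<^esub> \<in> carrier B" by (simp add: homs)
  next
    fix x assume "x \<in> carrier B"
    then obtain a where a: "a \<in> carrier A" "x = h a"
      using ex by meson
    then show "\<one>\<^bsub>B\<^esub> \<otimes>\<^bsub>B\<^esub> x = x" "x \<otimes>\<^bsub>B\<^esub> \<one>\<^bsub>B\<^esub> = x" by (simp_all add: homs)
  qed
  have rng: "ring B"
  proof (rule ringI[OF ag mon])
    fix x y z assume "x \<in> carrier B" "y \<in> carrier B" "z \<in> carrier B"
    then obtain a b c where "a \<in> carrier A" "b \<in> carrier A" "c \<in> carrier A" "x = h a" "y = h b" "z = h c"
      using ex by meson
    then show "(x \<oplus>\<^bsub>B\<^esub> y) \<otimes>\<^bsub>B\<^esub> z = x \<otimes>\<^bsub>B\<^esub> z \<oplus>\<^bsub>B\<^esub> y \<otimes>\<^bsub>B\<^esub> z"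
      "z \<otimes>\<^bsub>B\<^esub> (x \<oplus>\<^bsub>B\<^esub> y) = z \<otimes>\<^bsub>B\<^esub> x \<oplus>\<^bsub>B\<^esub> z \<otimes>\<^bsub>B\<^esub> y"
      by (simp_all add: homs A.l_distr A.r_distr)
  qed
  have mod: "module R B"
  proof (rule moduleI[OF A.R.is_cring ag])
    fix r x assume "r \<in> carrier R" "x \<in> carrier B"
    then obtain a where a: "r \<in> carrier R" "a \<in> carrier A" "x = h a"
      using ex by meson
    then show "r \<odot>\<^bsub>B\<^esub> x \<in> carrier B" by (simp add: homs)
  next
    fix r s x assume "r \<in> carrier R" "s \<in> carrier R" "x \<in> carrier B"
    then obtain a where a: "r \<in> carrier R" "s \<in> carrier R" "a \<in> carrier A" "x = h a"
      using ex by meson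
    then show "(r \<oplus>\<^bsub>R\<^esub> s) \<odot>\<^bsub>B\<^esub> x = r \<odot>\<^bsub>B\<^esub> x \<oplus>\<^bsub>B\<^esub> s \<odot>\<^bsub>B\<^esub> x"
      "r \<otimes>\<^bsub>R\<^esub> s \<odot>\<^bsub>B\<^esub> x = r \<odot>\<^bsub>B\<^esub> (s \<odot>\<^bsub>B\<^esub> x)"
      by (simp_all add: homs A.smult_l_distr A.smult_assoc1)
  next
    fix r x y assume "r \<in> carrier R" "x \<in> carrier B" "y \<in> carrier B"
    then obtain a b where "r \<in> carrier R" "a \<in> carrier A" "b \<in> carrier A" "x = h a" "y = h b"
      using ex by meson
    then show "r \<odot>\<^bsub>B\<^esub> (x \<oplus>\<^bsub>B\<^esub> y) = r \<odot>\<^bsub>B\<^esub> x \<oplus>\<^bsub>B\<^esub> r \<odot>\<^bsub>B\<^esub> y"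
      by (simp add: homs A.smult_r_distr)
  next
    fix x assume "x \<in> carrier B"
    then obtain a where "a \<in> carrier A" "x = h a"
      using ex by meson
    then show "\<one>\<^bsub>R\<^esub> \<odot>\<^bsub>B\<^esub> x = x" by (simp add: homs)
  qed
  interpret B: module R B by (rule mod)
  interpret B: ring B by (rule rng)
  have inv: "\<ominus>\<^bsub>B\<^esub> h a = h (\<ominus>\<^bsub>A\<^esub> a)" if "a \<in> carrier A" for a
    using that by (intro B.M.minus_equality) (auto simp: homs A.M.l_neg)
  show ?thesis
  proof (intro graded_algebra.intro graded_algebra_axioms.intro mod rng)
    fix r x y assume "r \<in> carrier R" "x \<in> carrier B" "y \<in> carrier B"
    then obtain a b where "r \<in> carrier R" "a \<in> carrier A" "b \<in> carrier A" "x = h a" "y = h b"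
      using ex by meson
    then show "(r \<odot>\<^bsub>B\<^esub> x) \<otimes>\<^bsub>B\<^esub> y = r \<odot>\<^bsub>B\<^esub> (x \<otimes>\<^bsub>B\<^esub> y)"
      "x \<otimes>\<^bsub>B\<^esub> (r \<odot>\<^bsub>B\<^esub> y) = r \<odot>\<^bsub>B\<^esub> (x \<otimes>\<^bsub>B\<^esub> y)"
      by (simp_all add: homs A.smult_mult_left A.smult_mult_right)
  next
    fix n
    show "submodule (grade B n) R B"
    proof (rule B.submoduleI)
      show "grade B n \<subseteq> carrier B" "\<zero>\<^bsub>B\<^esub> \<in> grade B n"
        using A.grade_carrier A.grade_zero by (auto simp: grade zero[symmetric] cl)
    next
      fix x assume "x \<in> grade B n"
      then show "\<ominus>\<^bsub>B\<^esub> x \<in> grade B n"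
        by (auto simp: grade inv A.grade_uminus A.grade_carrier)
    next
      fix x y assume "x \<in> grade B n" "y \<in> grade B n"
      then show "x \<oplus>\<^bsub>B\<^esub> y \<in> grade B n"
        by (auto simp: grade add[symmetric] A.grade_add A.grade_carrier)
    next
      fix r x assume "r \<in> carrier R" "x \<in> grade B n"
      then show "r \<odot>\<^bsub>B\<^esub> x \<in> grade B n"
        by (auto simp: grade smult[symmetric] A.grade_smult A.grade_carrier)
    qed
  next
    fix x y m n assume "x \<in> grade B m" "y \<in> grade B n"
    then show "x \<otimes>\<^bsub>B\<^esub> y \<in> grade B (m + n)"
      by (auto simp: grade mult[symmetric] A.grade_mult A.grade_carrier)
  next
    show "\<one>\<^bsub>B\<^esub> \<in> grade B 0"
      by (auto simp: grade one[symmetric] A.grade_one)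
  qed
qed

subsection \<open>Morphisms\<close>

lemma morD:
  assumes "f \<in> mor R A B"
  shows "x \<in> carrier A \<Longrightarrow> f x \<in> carrier B"
    and "\<lbrakk>x \<in> carrier A; y \<in> carrier A\<rbrakk> \<Longrightarrow> f (x \<oplus>\<^bsub>A\<^esub> y) = f x \<oplus>\<^bsub>B\<^esub> f y"
    and "\<lbrakk>x \<in> carrier A; y \<in> carrier A\<rbrakk> \<Longrightarrow> f (x \<otimes>\<^bsub>A\<^esub> y) = f x \<otimes>\<^bsub>B\<^esub> f y"
    and "f \<one>\<^bsub>A\<^esub> = \<one>\<^bsub>B\<^esub>"
    and "\<lbrakk>r \<in> carrier R; x \<in> carrier A\<rbrakk> \<Longrightarrow> f (r \<odot>\<^bsub>A\<^esub> x) = r \<odot>\<^bsub>B\<^esub> f x"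
    and "x \<in> grade A n \<Longrightarrow> f x \<in> grade B n"
    and "f \<in> extensional (carrier A)"
proof -
  have h: "f \<in> ring_hom A B" and e: "f \<in> extensional (carrier A)"
    and s: "\<forall>r\<in>carrier R. \<forall>x\<in>carrier A. f (r \<odot>\<^bsub>A\<^esub> x) = r \<odot>\<^bsub>B\<^esub> f x"
    and g: "\<forall>n. f ` grade A n \<subseteq> grade B n"
    using assms by (simp_all add: mor_def)
  show "x \<in> carrier A \<Longrightarrow> f x \<in> carrier B"
    "\<lbrakk>x \<in> carrier A; y \<in> carrier A\<rbrakk> \<Longrightarrow> f (x \<oplus>\<^bsub>A\<^esub> y) = f x \<oplus>\<^bsub>B\<^esub> f y"
    "\<lbrakk>x \<in> carrier A; y \<in> carrier A\<rbrakk> \<Longrightarrow> f (x \<otimes>\<^bsub>A\<^esub> y) = f x \<otimes>\<^bsub>B\<^esub> f y"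
    "f \<one>\<^bsub>A\<^esub> = \<one>\<^bsub>B\<^esub>"
    by (simp_all add: ring_hom_closed[OF h] ring_hom_add[OF h] ring_hom_mult[OF h] ring_hom_one[OF h])
  show "\<lbrakk>r \<in> carrier R; x \<in> carrier A\<rbrakk> \<Longrightarrow> f (r \<odot>\<^bsub>A\<^esub> x) = r \<odot>\<^bsub>B\<^esub> f x"
    using s by simp
  show "x \<in> grade A n \<Longrightarrow> f x \<in> grade B n"
    using g by blast
  show "f \<in> extensional (carrier A)"
    by (rule e)
qed

lemma morI:
  assumes "\<And>x. x \<in> carrier A \<Longrightarrow> f x \<in> carrier B"
    and "\<And>x y. \<lbrakk>x \<in> carrier A; y \<in> carrier A\<rbrakk> \<Longrightarrow> f (x \<oplus>\<^bsub>A\<^esub> y) = f x \<oplus>\<^bsub>B\<^esub> f y"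
    and "\<And>x y. \<lbrakk>x \<in> carrier A; y \<in> carrier A\<rbrakk> \<Longrightarrow> f (x \<otimes>\<^bsub>A\<^esub> y) = f x \<otimes>\<^bsub>B\<^esub> f y"
    and "f \<one>\<^bsub>A\<^esub> = \<one>\<^bsub>B\<^esub>"
    and "\<And>r x. \<lbrakk>r \<in> carrier R; x \<in> carrier A\<rbrakk> \<Longrightarrow> f (r \<odot>\<^bsub>A\<^esub> x) = r \<odot>\<^bsub>B\<^esub> f x"
    and "\<And>x n. x \<in> grade A n \<Longrightarrow> f x \<in> grade B n"
    and "f \<in> extensional (carrier A)"
  shows "f \<in> mor R A B"
  using assms unfolding mor_def ring_hom_def by auto

lemma mor_zero:
  assumes "f \<in> mor R A B" "graded_algebra R A" "graded_algebra R B"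
  shows "f \<zero>\<^bsub>A\<^esub> = \<zero>\<^bsub>B\<^esub>"
proof -
  interpret A: graded_algebra R A by fact
  interpret B: graded_algebra R B by fact
  have "f (\<zero>\<^bsub>R\<^esub> \<odot>\<^bsub>A\<^esub> \<zero>\<^bsub>A\<^esub>) = \<zero>\<^bsub>R\<^esub> \<odot>\<^bsub>B\<^esub> f \<zero>\<^bsub>A\<^esub>"
    using assms(1) by (intro morD(5)) auto
  then show ?thesis
    using morD(1)[OF assms(1)] by simp
qed

lemma mor_uminus:
  assumes "f \<in> mor R A B" "graded_algebra R A" "graded_algebra R B" "x \<in> carrier A"
  shows "f (\<ominus>\<^bsub>A\<^esub> x) = \<ominus>\<^bsub>B\<^esub> f x"
proof -
  interpret A: graded_algebra R A by fact
  interpret B: graded_algebra R B by fact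
  show ?thesis
    using assms by (simp add: A.uminus_eq_smult B.uminus_eq_smult morD[OF assms(1)])
qed

lemma mor_minus:
  assumes "f \<in> mor R A B" "graded_algebra R A" "graded_algebra R B" "x \<in> carrier A" "y \<in> carrier A"
  shows "f (x \<ominus>\<^bsub>A\<^esub> y) = f x \<ominus>\<^bsub>B\<^esub> f y"
proof -
  interpret A: graded_algebra R A by fact
  interpret B: graded_algebra R B by fact
  show ?thesis
    using assms by (simp add: a_minus_def mor_uminus[OF assms(1-3)] morD[OF assms(1)])
qed

lemma mor_pow:
  assumes "f \<in> mor R A B" "graded_algebra R A" "graded_algebra R B" "x \<in> carrier A"
  shows "f (x [^]\<^bsub>A\<^esub> (n::nat)) = f x [^]\<^bsub>B\<^esub> n"
proof -
  interpret A: graded_algebra R A by fact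
  interpret B: graded_algebra R B by fact
  show ?thesis
    using assms by (induction n) (simp_all add: morD[OF assms(1)])
qed

text \<open>Morphisms are extensional, so agreement on the carrier is equality; the two codomains may differ.\<close>

lemma mor_eqI:
  assumes "f \<in> mor R A B" "g \<in> mor R A C" "\<And>x. x \<in> carrier A \<Longrightarrow> f x = g x"
  shows "f = g"
  using extensionalityI[OF morD(7)[OF assms(1)] morD(7)[OF assms(2)]] assms(3) by blast

lemma mor_compose:
  assumes "f \<in> mor R A B" "g \<in> mor R B C" "\<And>n. grade A n \<subseteq> carrier A" "\<one>\<^bsub>A\<^esub> \<in> carrier A"
    "\<And>x y. \<lbrakk>x \<in> carrier A; y \<in> carrier A\<rbrakk> \<Longrightarrow> x \<oplus>\<^bsub>A\<^esub> y \<in> carrier A \<and> x \<otimes>\<^bsub>A\<^esub> y \<in> carrier A"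
    "\<And>r x. \<lbrakk>r \<in> carrier R; x \<in> carrier A\<rbrakk> \<Longrightarrow> r \<odot>\<^bsub>A\<^esub> x \<in> carrier A"
  shows "compose (carrier A) g f \<in> mor R A C"
proof (rule morI)
  show "compose (carrier A) g f x \<in> grade C n" if "x \<in> grade A n" for x n
    using that assms(3)[of n] morD(6)[OF assms(1) that] by (auto simp: compose_eq morD[OF assms(2)])
qed (use assms(4-6) in \<open>simp_all add: compose_eq morD[OF assms(1)] morD[OF assms(2)]\<close>)

lemma mor_comp:
  assumes "graded_algebra R A" "f \<in> mor R A B" "g \<in> mor R B C"
  shows "compose (carrier A) g f \<in> mor R A C"
proof -
  interpret A: graded_algebra R A by fact
  show ?thesis
    using A.grade_carrier by (intro mor_compose[OF assms(2,3)]) auto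
qed

lemma id_mor_mor:
  assumes "graded_algebra R A"
  shows "id_mor A \<in> mor R A A"
proof -
  interpret A: graded_algebra R A by fact
  show ?thesis
    using A.grade_carrier by (intro morI) (auto simp: id_mor_def)
qed

lemma id_mor_apply [simp]: "x \<in> carrier A \<Longrightarrow> id_mor A x = x"
  by (simp add: id_mor_def)

lemma mor_PiE: "f \<in> mor R A B \<Longrightarrow> f \<in> carrier A \<rightarrow> carrier B"
  by (auto dest: morD(1))

lemma mor_compose_assoc:
  assumes "f \<in> mor R A B"
  shows "compose (carrier A) h (compose (carrier A) g f) = compose (carrier A) (compose (carrier B) h g) f"
  by (rule compose_assoc[OF mor_PiE[OF assms]])

lemma mor_compose_id:
  assumes "f \<in> mor R A B"
  shows "compose (carrier A) f (id_mor A) = f" "compose (carrier A) (id_mor B) f = f"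
  using morD(1,7)[OF assms] by (auto simp: compose_def id_mor_def fun_eq_iff extensional_def)

section \<open>Free algebras\<close>

subsection \<open>Convolution\<close>

text \<open>The multiplication of the free algebra, without any restriction on the supports. All its laws are
  proved by induction on the word at which the functions are evaluated, stripping the first letter from
  the left factor (\<open>convolution_Cons\<close>).\<close>

definition convolution :: "('r, 'c) ring_scheme \<Rightarrow> ('l list \<Rightarrow> 'r) \<Rightarrow> ('l list \<Rightarrow> 'r) \<Rightarrow> 'l list \<Rightarrow> 'r" where
  "convolution R p q w = (\<Oplus>\<^bsub>R\<^esub>i\<in>{..length w}. p (take i w) \<otimes>\<^bsub>R\<^esub> q (drop i w))"

context cring
begin

lemma convolution_Nil:
  "\<lbrakk>p \<in> UNIV \<rightarrow> carrier R; q \<in> UNIV \<rightarrow> carrier R\<rbrakk> \<Longrightarrow> convolution R p q [] = p [] \<otimes> q []"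
  by (simp add: convolution_def Pi_iff)

lemma convolution_Cons:
  assumes "p \<in> UNIV \<rightarrow> carrier R" "q \<in> UNIV \<rightarrow> carrier R"
  shows "convolution R p q (a # w) = p [] \<otimes> q (a # w) \<oplus> convolution R (\<lambda>v. p (a # v)) q w"
proof -
  have "convolution R p q (a # w) =
    (\<Oplus>i\<in>{..length w}. p (take (Suc i) (a # w)) \<otimes> q (drop (Suc i) (a # w))) \<oplus> p [] \<otimes> q (a # w)"
    unfolding convolution_def length_Cons using assms by (subst finsum_Suc2) (auto simp: Pi_iff)
  also have "(\<Oplus>i\<in>{..length w}. p (take (Suc i) (a # w)) \<otimes> q (drop (Suc i) (a # w))) =
    convolution R (\<lambda>v. p (a # v)) q w"
    by (simp add: convolution_def)
  finally show ?thesis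
    using assms by (simp add: a_comm convolution_def Pi_iff)
qed

lemma convolution_closed [simp]:
  "\<lbrakk>p \<in> UNIV \<rightarrow> carrier R; q \<in> UNIV \<rightarrow> carrier R\<rbrakk> \<Longrightarrow> convolution R p q w \<in> carrier R"
  unfolding convolution_def by (rule finsum_closed) (auto simp: Pi_iff)

lemma convolution_zero_left:
  "q \<in> UNIV \<rightarrow> carrier R \<Longrightarrow> convolution R (\<lambda>v. \<zero>) q w = \<zero>"
  by (induction w) (auto simp: convolution_Nil convolution_Cons Pi_iff)

lemma convolution_add_left:
  "\<lbrakk>p \<in> UNIV \<rightarrow> carrier R; p' \<in> UNIV \<rightarrow> carrier R; q \<in> UNIV \<rightarrow> carrier R\<rbrakk> \<Longrightarrow>
    convolution R (\<lambda>v. p v \<oplus> p' v) q w = convolution R p q w \<oplus> convolution R p' q w"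
proof (induction w arbitrary: p p')
  case Nil
  then show ?case by (simp add: convolution_Nil Pi_iff l_distr)
next
  case (Cons a w)
  have "convolution R (\<lambda>v. p (a # v)) q w \<in> carrier R" "convolution R (\<lambda>v. p' (a # v)) q w \<in> carrier R"
    using Cons.prems by (auto intro!: convolution_closed)
  then show ?case
    using Cons by (simp add: convolution_Cons Pi_iff l_distr a_ac)
qed

lemma convolution_add_right:
  "\<lbrakk>p \<in> UNIV \<rightarrow> carrier R; q' \<in> UNIV \<rightarrow> carrier R; q \<in> UNIV \<rightarrow> carrier R\<rbrakk> \<Longrightarrow>
    convolution R p (\<lambda>v. q v \<oplus> q' v) w = convolution R p q w \<oplus> convolution R p q' w"
proof (induction w arbitrary: p)
  case Nil
  then show ?case by (simp add: convolution_Nil Pi_iff r_distr)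
next
  case (Cons a w)
  have "convolution R (\<lambda>v. p (a # v)) q w \<in> carrier R" "convolution R (\<lambda>v. p (a # v)) q' w \<in> carrier R"
    using Cons.prems by (auto intro!: convolution_closed)
  then show ?case
    using Cons by (simp add: convolution_Cons Pi_iff r_distr a_ac)
qed

lemma convolution_smult_left:
  "\<lbrakk>r \<in> carrier R; p \<in> UNIV \<rightarrow> carrier R; q \<in> UNIV \<rightarrow> carrier R\<rbrakk> \<Longrightarrow>
    convolution R (\<lambda>v. r \<otimes> p v) q w = r \<otimes> convolution R p q w"
proof (induction w arbitrary: p)
  case Nil
  then show ?case by (simp add: convolution_Nil Pi_iff m_assoc)
next
  case (Cons a w)
  have "convolution R (\<lambda>v. p (a # v)) q w \<in> carrier R"
    using Cons.prems by (auto intro!: convolution_closed)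
  then show ?case
    using Cons by (simp add: convolution_Cons Pi_iff r_distr m_assoc)
qed

lemma convolution_smult_right:
  "\<lbrakk>r \<in> carrier R; p \<in> UNIV \<rightarrow> carrier R; q \<in> UNIV \<rightarrow> carrier R\<rbrakk> \<Longrightarrow>
    convolution R p (\<lambda>v. r \<otimes> q v) w = r \<otimes> convolution R p q w"
proof (induction w arbitrary: p)
  case Nil
  then show ?case by (simp add: convolution_Nil Pi_iff m_lcomm)
next
  case (Cons a w)
  have "convolution R (\<lambda>v. p (a # v)) q w \<in> carrier R"
    using Cons.prems by (auto intro!: convolution_closed)
  then show ?case
    using Cons by (simp add: convolution_Cons Pi_iff r_distr m_lcomm)
qed

lemma convolution_assoc:
  "\<lbrakk>p \<in> UNIV \<rightarrow> carrier R; q \<in> UNIV \<rightarrow> carrier R; s \<in> UNIV \<rightarrow> carrier R\<rbrakk> \<Longrightarrow>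
    convolution R (convolution R p q) s w = convolution R p (convolution R q s) w"
proof (induction w arbitrary: p)
  case Nil
  have "convolution R p q \<in> UNIV \<rightarrow> carrier R" "convolution R q s \<in> UNIV \<rightarrow> carrier R"
    using Nil by auto
  with Nil show ?case by (simp add: convolution_Nil Pi_iff m_assoc)
next
  case (Cons a w)
  have pa: "(\<lambda>v. p (a # v)) \<in> UNIV \<rightarrow> carrier R" and qa: "(\<lambda>v. q (a # v)) \<in> UNIV \<rightarrow> carrier R"
    using Cons.prems by auto
  have cl: "p [] \<in> carrier R" "q [] \<in> carrier R" "s (a # w) \<in> carrier R"
    using Cons.prems by auto
  have pq: "convolution R p q \<in> UNIV \<rightarrow> carrier R" and qs: "convolution R q s \<in> UNIV \<rightarrow> carrier R"
    and pqa: "convolution R (\<lambda>v. p (a # v)) q \<in> UNIV \<rightarrow> carrier R"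
    using Cons.prems pa by auto
  have ppqa: "(\<lambda>v. p [] \<otimes> q (a # v)) \<in> UNIV \<rightarrow> carrier R"
    using Cons.prems by auto
  have "convolution R (convolution R p q) s (a # w) =
    p [] \<otimes> q [] \<otimes> s (a # w) \<oplus>
      convolution R (\<lambda>v. p [] \<otimes> q (a # v) \<oplus> convolution R (\<lambda>v. p (a # v)) q v) s w"
    by (simp add: convolution_Cons[OF pq Cons.prems(3)] convolution_Cons[OF Cons.prems(1,2)]
      convolution_Nil[OF Cons.prems(1,2)])
  also have "convolution R (\<lambda>v. p [] \<otimes> q (a # v) \<oplus> convolution R (\<lambda>v. p (a # v)) q v) s w =
    p [] \<otimes> convolution R (\<lambda>v. q (a # v)) s w \<oplus>
      convolution R (\<lambda>v. p (a # v)) (convolution R q s) w"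
    using convolution_add_left[OF ppqa pqa Cons.prems(3)]
      convolution_smult_left[OF cl(1) qa Cons.prems(3)] Cons.IH[OF pa Cons.prems(2,3)] by simp
  also have "p [] \<otimes> q [] \<otimes> s (a # w) \<oplus> (p [] \<otimes> convolution R (\<lambda>v. q (a # v)) s w \<oplus>
      convolution R (\<lambda>v. p (a # v)) (convolution R q s) w) =
    p [] \<otimes> (q [] \<otimes> s (a # w) \<oplus> convolution R (\<lambda>v. q (a # v)) s w) \<oplus>
      convolution R (\<lambda>v. p (a # v)) (convolution R q s) w"
    using cl convolution_closed[OF qa Cons.prems(3)] convolution_closed[OF pa qs]
    by (simp add: r_distr m_assoc a_assoc)
  also have "\<dots> = convolution R p (convolution R q s) (a # w)"
    by (simp add: convolution_Cons[OF Cons.prems(1) qs] convolution_Cons[OF Cons.prems(2,3)])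
  finally show ?case .
qed

lemma word_Pi [simp]: "word R w \<in> UNIV \<rightarrow> carrier R"
  by (auto simp: word_def)

lemma convolution_one_left:
  assumes "(q :: 'l list \<Rightarrow> 'a) \<in> UNIV \<rightarrow> carrier R"
  shows "convolution R (word R []) q w = q w"
proof (cases w)
  case Nil
  then show ?thesis
    using assms by (simp add: convolution_Nil) (auto simp add: word_def Pi_iff)
next
  case (Cons a v)
  have "(\<lambda>v. word R [] (a # v)) = (\<lambda>v. \<zero>)" by (simp add: word_def)
  moreover have "word R [] ([] :: 'l list) = \<one>" by (simp add: word_def)
  moreover have "q w \<in> carrier R" using assms by auto
  ultimately show ?thesis
    using Cons assms by (simp add: convolution_Cons convolution_zero_left)
qed

lemma convolution_one_right:
  "p \<in> UNIV \<rightarrow> carrier R \<Longrightarrow> convolution R p (word R []) w = p w"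
proof (induction w arbitrary: p)
  case Nil
  then show ?case
    using Nil by (subst convolution_Nil[OF Nil word_Pi]) (auto simp: word_def Pi_iff)
next
  case (Cons a w)
  have "convolution R (\<lambda>v. p (a # v)) (word R []) w = p (a # w)"
    using Cons.prems by (intro Cons.IH) auto
  moreover have "word R [] (a # w) = \<zero>" by (simp add: word_def)
  ultimately show ?case
    unfolding convolution_Cons[OF Cons.prems word_Pi] using Cons.prems by (simp add: Pi_iff)
qed

lemma convolution_word: "convolution R (word R u) (word R v) = word R (u @ v)"
proof
  fix w
  show "convolution R (word R u) (word R v) w = word R (u @ v) w"
  proof (induction u arbitrary: w)
    case Nil
    then show ?case by (simp add: convolution_one_left)
  next
    case (Cons a u)
    have 0: "word R (a # u) [] = \<zero>" by (simp add: word_def)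
    show ?case
    proof (cases w)
      case Nil
      then show ?thesis
        using word_Pi[of v] by (simp add: convolution_Nil 0) (simp add: word_def)
    next
      case (Cons b w')
      have "(\<lambda>x. word R (a # u) (b # x)) = (if a = b then word R u else (\<lambda>x. \<zero>))"
        by (auto simp: word_def)
      moreover have "word R v w \<in> carrier R"
        using word_Pi[of v] by blast
      ultimately have "convolution R (word R (a # u)) (word R v) w =
          (if a = b then word R (u @ v) w' else \<zero>)"
        using Cons.IH[of w'] Cons
        by (simp add: convolution_Cons 0 convolution_zero_left)
      also have "\<dots> = word R ((a # u) @ v) w"
        using Cons by (simp add: word_def)
      finally show ?thesis .
    qed
  qed
qed

lemma convolution_nonzeroE:
  assumes "convolution R p q w \<noteq> \<zero>" "p \<in> UNIV \<rightarrow> carrier R" "q \<in> UNIV \<rightarrow> carrier R"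
  obtains u v where "w = u @ v" "p u \<noteq> \<zero>" "q v \<noteq> \<zero>"
proof -
  have "\<exists>i. p (take i w) \<otimes> q (drop i w) \<noteq> \<zero>"
  proof (rule ccontr)
    assume "\<not> ?thesis"
    then have "convolution R p q w = \<zero>"
      by (simp add: convolution_def)
    then show False using assms(1) by simp
  qed
  then obtain i where i: "p (take i w) \<otimes> q (drop i w) \<noteq> \<zero>" by blast
  have "p (take i w) \<noteq> \<zero>" "q (drop i w) \<noteq> \<zero>"
    using i assms(2,3) by (auto simp: Pi_iff)
  then show thesis
    using that[of "take i w" "drop i w"] by simp
qed

end

subsection \<open>Free algebras on graded letters\<close>

text \<open>The degrees of letters form a relation, since in the free algebra that covers a free product the letter
  of a zero element has every degree.\<close>

definition letters_degree :: "('l \<Rightarrow> nat \<Rightarrow> bool) \<Rightarrow> 'l list \<Rightarrow> nat \<Rightarrow> bool" where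
  "letters_degree D w n \<longleftrightarrow> (\<exists>ds. list_all2 D w ds \<and> sum_list ds = n)"

lemma letters_degree_Nil [simp]: "letters_degree D [] n \<longleftrightarrow> n = 0"
  by (auto simp: letters_degree_def)

lemma letters_degree_Cons:
  "letters_degree D (l # w) n \<longleftrightarrow> (\<exists>d k. D l d \<and> letters_degree D w k \<and> n = d + k)"
proof
  assume "letters_degree D (l # w) n"
  then obtain ds where "list_all2 D (l # w) ds" "sum_list ds = n"
    by (auto simp: letters_degree_def)
  then show "\<exists>d k. D l d \<and> letters_degree D w k \<and> n = d + k"
    by (cases ds) (auto simp: letters_degree_def)
next
  assume "\<exists>d k. D l d \<and> letters_degree D w k \<and> n = d + k"
  then obtain d ds where "D l d" "list_all2 D w ds" "n = d + sum_list ds"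
    by (auto simp: letters_degree_def)
  then have "list_all2 D (l # w) (d # ds) \<and> sum_list (d # ds) = n" by simp
  then show "letters_degree D (l # w) n"
    unfolding letters_degree_def by blast
qed

lemma letters_degree_append:
  "letters_degree D u m \<Longrightarrow> letters_degree D v n \<Longrightarrow> letters_degree D (u @ v) (m + n)"
proof (induction u arbitrary: m)
  case (Cons a u)
  then obtain d k where "D a d" "letters_degree D u k" "m = d + k"
    by (auto simp: letters_degree_Cons)
  then show ?case
    using Cons by (auto simp: letters_degree_Cons add.assoc)
qed simp

definition free_galg ::
  "('r, 'c) ring_scheme \<Rightarrow> 'l set \<Rightarrow> ('l \<Rightarrow> nat \<Rightarrow> bool) \<Rightarrow> ('r, 'l list \<Rightarrow> 'r) galg" where
  "free_galg R L D = \<lparr>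
     carrier = {p. p \<in> UNIV \<rightarrow> carrier R \<and> finite {w. p w \<noteq> \<zero>\<^bsub>R\<^esub>} \<and>
                   (\<forall>w. p w \<noteq> \<zero>\<^bsub>R\<^esub> \<longrightarrow> w \<in> lists L)},
     mult = convolution R,
     one = word R [],
     zero = (\<lambda>w. \<zero>\<^bsub>R\<^esub>),
     add = (\<lambda>p q w. p w \<oplus>\<^bsub>R\<^esub> q w),
     smult = (\<lambda>r p w. r \<otimes>\<^bsub>R\<^esub> p w),
     grade = (\<lambda>n. {p. p \<in> UNIV \<rightarrow> carrier R \<and> finite {w. p w \<noteq> \<zero>\<^bsub>R\<^esub>} \<and>
                   (\<forall>w. p w \<noteq> \<zero>\<^bsub>R\<^esub> \<longrightarrow> w \<in> lists L \<and> letters_degree D w n)})\<rparr>"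

lemma free_galg_simps:
  "p \<in> carrier (free_galg R L D) \<longleftrightarrow> p \<in> UNIV \<rightarrow> carrier R \<and> finite {w. p w \<noteq> \<zero>\<^bsub>R\<^esub>} \<and>
                   (\<forall>w. p w \<noteq> \<zero>\<^bsub>R\<^esub> \<longrightarrow> w \<in> lists L)"
  "p \<in> grade (free_galg R L D) n \<longleftrightarrow>
     p \<in> carrier (free_galg R L D) \<and> (\<forall>w. p w \<noteq> \<zero>\<^bsub>R\<^esub> \<longrightarrow> letters_degree D w n)"
  "mult (free_galg R L D) = convolution R"
  "one (free_galg R L D) = word R []"
  "zero (free_galg R L D) = (\<lambda>w. \<zero>\<^bsub>R\<^esub>)"
  "add (free_galg R L D) = (\<lambda>p q w. p w \<oplus>\<^bsub>R\<^esub> q w)"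
  "smult (free_galg R L D) = (\<lambda>r p w. r \<otimes>\<^bsub>R\<^esub> p w)"
  unfolding free_galg_def by auto

context cring
begin

lemma free_galg_add_closed:
  assumes "p \<in> carrier (free_galg R L D)" "q \<in> carrier (free_galg R L D)"
  shows "(\<lambda>w. p w \<oplus> q w) \<in> carrier (free_galg R L D)"
proof -
  have "finite {w. p w \<oplus> q w \<noteq> \<zero>}"
    by (rule finite_subset[of _ "{w. p w \<noteq> \<zero>} \<union> {w. q w \<noteq> \<zero>}"])
      (use assms in \<open>auto simp: free_galg_simps\<close>)
  moreover have "w \<in> lists L" if "p w \<oplus> q w \<noteq> \<zero>" for w
    using that assms unfolding free_galg_simps by (metis r_zero zero_closed)
  moreover have "(\<lambda>w. p w \<oplus> q w) \<in> UNIV \<rightarrow> carrier R"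
    using assms by (auto simp: free_galg_simps)
  ultimately show ?thesis
    unfolding free_galg_simps by blast
qed

lemma free_galg_smult_closed:
  assumes "r \<in> carrier R" "p \<in> carrier (free_galg R L D)"
  shows "(\<lambda>w. r \<otimes> p w) \<in> carrier (free_galg R L D)"
proof -
  have "finite {w. r \<otimes> p w \<noteq> \<zero>}"
    by (rule finite_subset[of _ "{w. p w \<noteq> \<zero>}"])
      (use assms in \<open>auto simp: free_galg_simps\<close>)
  moreover have "w \<in> lists L" if "r \<otimes> p w \<noteq> \<zero>" for w
    using that assms unfolding free_galg_simps by (metis r_null)
  moreover have "(\<lambda>w. r \<otimes> p w) \<in> UNIV \<rightarrow> carrier R"
    using assms by (auto simp: free_galg_simps)
  ultimately show ?thesis
    unfolding free_galg_simps by blast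
qed

lemma free_galg_mult_closed:
  assumes p: "p \<in> carrier (free_galg R L D)" and q: "q \<in> carrier (free_galg R L D)"
  shows "convolution R p q \<in> carrier (free_galg R L D)"
proof -
  have pq: "p \<in> UNIV \<rightarrow> carrier R" "q \<in> UNIV \<rightarrow> carrier R"
    using p q by (auto simp: free_galg_simps)
  have "{w. convolution R p q w \<noteq> \<zero>} \<subseteq> (\<lambda>(u, v). u @ v) ` ({w. p w \<noteq> \<zero>} \<times> {w. q w \<noteq> \<zero>})"
    by (auto elim!: convolution_nonzeroE[OF _ pq])
  moreover have "finite \<dots>"
    using p q by (auto simp: free_galg_simps)
  ultimately have "finite {w. convolution R p q w \<noteq> \<zero>}"
    by (rule finite_subset)
  moreover have "w \<in> lists L" if "convolution R p q w \<noteq> \<zero>" for w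
    using that p q by (elim convolution_nonzeroE[OF _ pq]) (auto simp: free_galg_simps)
  ultimately show ?thesis
    using pq unfolding free_galg_simps by auto
qed

lemma word_closed: "w \<in> lists L \<Longrightarrow> word R w \<in> carrier (free_galg R L D)"
proof -
  have "finite {v. word R w v \<noteq> \<zero>}"
    by (rule finite_subset[of _ "{w}"]) (auto simp: word_def)
  then show "w \<in> lists L \<Longrightarrow> ?thesis"
    by (auto simp: free_galg_simps) (auto simp: word_def split: if_splits)
qed

lemma free_galg_graded_algebra: "graded_algebra R (free_galg R L D)"
proof -
  let ?F = "free_galg R L D"
  have P: "p \<in> UNIV \<rightarrow> carrier R" if "p \<in> carrier ?F" for p
    using that by (simp add: free_galg_simps)
  have Pw: "p w \<in> carrier R" if "p \<in> carrier ?F" for p w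
    using P[OF that] by auto
  note cl = free_galg_add_closed[of _ L D] free_galg_smult_closed[of _ _ L D]
    free_galg_mult_closed[of _ L D] word_closed[of _ L D]
  have z: "(\<lambda>w. \<zero>) \<in> carrier ?F" by (simp add: free_galg_simps)
  have ag: "abelian_group ?F"
  proof (rule abelian_groupI)
    fix p assume p: "p \<in> carrier ?F"
    have "(\<lambda>w. (\<ominus> \<one>) \<otimes> p w) \<in> carrier ?F"
      using p by (intro cl) auto
    moreover have "(\<lambda>w. (\<ominus> \<one>) \<otimes> p w \<oplus> p w) = (\<lambda>w. \<zero>)"
      using Pw[OF p] by (auto simp: l_minus l_neg)
    ultimately show "\<exists>q\<in>carrier ?F. q \<oplus>\<^bsub>?F\<^esub> p = \<zero>\<^bsub>?F\<^esub>"
      unfolding free_galg_simps(5,6) by (intro bexI[of _ "\<lambda>w. (\<ominus> \<one>) \<otimes> p w"])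
  qed (use cl z in \<open>auto simp: free_galg_simps(3-) Pw a_ac\<close>)
  have mon: "monoid ?F"
  proof (rule monoidI)
    show "\<one>\<^bsub>?F\<^esub> \<in> carrier ?F"
      using cl(4)[of "[]"] by (simp add: free_galg_simps(4))
  qed (use cl(3) in \<open>simp_all add: free_galg_simps(3,4) P fun_eq_iff
      convolution_assoc convolution_one_left convolution_one_right\<close>)
  have rng: "ring ?F"
    by (rule ringI[OF ag mon]) (auto simp: free_galg_simps(3-) P fun_eq_iff
      convolution_add_left convolution_add_right)
  have mod: "module R ?F"
    by (rule moduleI[OF is_cring ag]) (use cl in \<open>auto simp: free_galg_simps(3-) Pw fun_eq_iff
      l_distr r_distr m_assoc\<close>)
  interpret F: module R ?F by (rule mod)
  show ?thesis
  proof (intro graded_algebra.intro graded_algebra_axioms.intro mod rng)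
    fix n
    have sm: "r \<odot>\<^bsub>?F\<^esub> p \<in> grade ?F n" if r: "r \<in> carrier R" and p: "p \<in> grade ?F n" for r p
    proof -
      have "letters_degree D w n" if "r \<otimes> p w \<noteq> \<zero>" for w
        by (cases "p w = \<zero>") (use p r that in \<open>auto simp: free_galg_simps(2)\<close>)
      then show ?thesis
        using p r cl by (simp add: free_galg_simps(2,7))
    qed
    show "submodule (grade ?F n) R ?F"
    proof (rule F.submoduleI)
      show "grade ?F n \<subseteq> carrier ?F" "\<zero>\<^bsub>?F\<^esub> \<in> grade ?F n"
        using z by (auto simp: free_galg_simps(2,5))
    next
      fix p assume p: "p \<in> grade ?F n"
      then have pF: "p \<in> carrier ?F" by (simp add: free_galg_simps(2))
      then have "\<ominus>\<^bsub>?F\<^esub> p = (\<ominus> \<one>) \<odot>\<^bsub>?F\<^esub> p"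
        by (simp add: F.smult_l_minus)
      then show "\<ominus>\<^bsub>?F\<^esub> p \<in> grade ?F n"
        using sm p by simp
    next
      fix p q assume pq: "p \<in> grade ?F n" "q \<in> grade ?F n"
      have "letters_degree D w n" if "p w \<oplus> q w \<noteq> \<zero>" for w
        using pq that unfolding free_galg_simps(2) by (metis r_zero zero_closed)
      then show "p \<oplus>\<^bsub>?F\<^esub> q \<in> grade ?F n"
        using pq cl by (simp add: free_galg_simps(2,6))
    qed (rule sm)
  next
    fix p q m n assume pq: "p \<in> grade ?F m" "q \<in> grade ?F n"
    then have pq': "p \<in> carrier ?F" "q \<in> carrier ?F" by (auto simp: free_galg_simps(2))
    have "letters_degree D w (m + n)" if "convolution R p q w \<noteq> \<zero>" for w
      using that pq
      by (elim convolution_nonzeroE[OF _ P[OF pq'(1)] P[OF pq'(2)]])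
        (auto simp: free_galg_simps(2) intro!: letters_degree_append)
    then show "p \<otimes>\<^bsub>?F\<^esub> q \<in> grade ?F (m + n)"
      using pq' cl by (simp add: free_galg_simps(2,3))
  next
    show "\<one>\<^bsub>?F\<^esub> \<in> grade ?F 0"
      using cl by (simp add: free_galg_simps(2,4)) (auto simp: word_def split: if_splits)
  qed (auto simp: free_galg_simps(3-) P fun_eq_iff convolution_smult_left convolution_smult_right)
qed

text \<open>Every element is built from \<open>0\<close> by adding its own terms one at a time.\<close>

lemma free_galg_induct [consumes 1, case_names zero add]:
  assumes "p \<in> carrier (free_galg R L D)"
    and zero: "P (\<lambda>w. \<zero>)"
    and add: "\<And>q r w. \<lbrakk>q \<in> carrier (free_galg R L D); P q; r \<in> carrier R; w \<in> lists L; p w \<noteq> \<zero>\<rbrakk>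
      \<Longrightarrow> P (\<lambda>v. q v \<oplus> r \<otimes> word R w v)"
  shows "P p"
proof -
  define restr where "restr S = (\<lambda>w. if w \<in> S then p w else \<zero>)" for S
  have cl: "restr S \<in> carrier (free_galg R L D)" for S
  proof -
    have "finite {w. restr S w \<noteq> \<zero>}"
      by (rule finite_subset[of _ "{w. p w \<noteq> \<zero>}"])
        (use assms(1) in \<open>auto simp: free_galg_simps restr_def\<close>)
    then show ?thesis
      using assms(1) by (auto simp: free_galg_simps restr_def Pi_iff)
  qed
  have pw: "p w \<in> carrier R" for w
    using assms(1) by (auto simp: free_galg_simps)
  have fin: "finite {w. p w \<noteq> \<zero>}" and supp: "\<And>w. p w \<noteq> \<zero> \<Longrightarrow> w \<in> lists L"
    using assms(1) by (auto simp: free_galg_simps)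
  have "finite S \<Longrightarrow> S \<subseteq> {w. p w \<noteq> \<zero>} \<Longrightarrow> P (restr S)" for S
  proof (induction S rule: finite_induct)
    case empty
    then show ?case using zero by (simp add: restr_def)
  next
    case (insert w S)
    have "P (\<lambda>v. restr S v \<oplus> p w \<otimes> word R w v)"
      using insert supp by (intro add cl pw) auto
    moreover have "(\<lambda>v. restr S v \<oplus> p w \<otimes> word R w v) = restr (insert w S)"
      using insert.hyps(2) pw by (auto simp: restr_def word_def fun_eq_iff)
    ultimately show ?case by simp
  qed
  from this[OF fin] have "P (restr {w. p w \<noteq> \<zero>})" by blast
  moreover have "restr {w. p w \<noteq> \<zero>} = p" by (auto simp: restr_def)
  ultimately show ?thesis by simp
qed

end

subsection \<open>The universal property of the free algebra\<close>

definition word_value :: "('b, 'x) ring_scheme \<Rightarrow> ('l \<Rightarrow> 'b) \<Rightarrow> 'l list \<Rightarrow> 'b" where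
  "word_value C \<phi> w = foldr (\<lambda>l x. \<phi> l \<otimes>\<^bsub>C\<^esub> x) w \<one>\<^bsub>C\<^esub>"

definition evaluate ::
  "('r, 'c) ring_scheme \<Rightarrow> ('r, 'b, 'x) galg_scheme \<Rightarrow> ('l \<Rightarrow> 'b) \<Rightarrow> ('l list \<Rightarrow> 'r) \<Rightarrow> 'b" where
  "evaluate R C \<phi> p = (\<Oplus>\<^bsub>C\<^esub>w\<in>{w. p w \<noteq> \<zero>\<^bsub>R\<^esub>}. p w \<odot>\<^bsub>C\<^esub> word_value C \<phi> w)"

context graded_algebra
begin

lemma word_value_closed: "\<phi> \<in> L \<rightarrow> carrier B \<Longrightarrow> w \<in> lists L \<Longrightarrow> word_value B \<phi> w \<in> carrier B"
  by (induction w) (auto simp: word_value_def)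

lemma word_value_append:
  "\<lbrakk>\<phi> \<in> L \<rightarrow> carrier B; u \<in> lists L; v \<in> lists L\<rbrakk> \<Longrightarrow>
    word_value B \<phi> (u @ v) = word_value B \<phi> u \<otimes> word_value B \<phi> v"
proof (induction u)
  case Nil
  then show ?case using word_value_closed[OF Nil(1,3)] by (simp add: word_value_def)
next
  case (Cons a u)
  then show ?case
    using word_value_closed[of \<phi> L v] word_value_closed[of \<phi> L u]
    by (simp add: word_value_def m_assoc Pi_iff)
qed

lemma word_value_grade:
  "\<lbrakk>\<And>l d. l \<in> L \<Longrightarrow> D l d \<Longrightarrow> \<phi> l \<in> grade B d; w \<in> lists L; letters_degree D w n\<rbrakk> \<Longrightarrow>
    word_value B \<phi> w \<in> grade B n"
  by (induction w arbitrary: n)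
    (auto simp: word_value_def grade_one letters_degree_Cons intro!: grade_mult)

lemma grade_finsum:
  "finite S \<Longrightarrow> (\<And>w. w \<in> S \<Longrightarrow> g w \<in> grade B n) \<Longrightarrow> (\<Oplus>w\<in>S. g w) \<in> grade B n"
proof (induction S rule: finite_induct)
  case (insert x S)
  then show ?case
    by (subst finsum_insert) (auto intro!: grade_add grade_carrier)
qed (simp add: grade_zero)

context
  fixes L :: "'l set" and D :: "'l \<Rightarrow> nat \<Rightarrow> bool" and \<phi> :: "'l \<Rightarrow> 'a"
  assumes \<phi>: "\<phi> \<in> L \<rightarrow> carrier B"
begin

private abbreviation (input) "F \<equiv> free_galg R L D"

lemma evaluate_superset:
  assumes "p \<in> carrier F" "finite S" "{w. p w \<noteq> \<zero>\<^bsub>R\<^esub>} \<subseteq> S" "S \<subseteq> lists L"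
  shows "evaluate R B \<phi> p = (\<Oplus>w\<in>S. p w \<odot> word_value B \<phi> w)"
  unfolding evaluate_def
  by (rule M.add.finprod_mono_neutral_cong_left)
    (use assms in \<open>auto simp: word_value_closed[OF \<phi>] free_galg_simps Pi_iff subset_iff\<close>)

lemma evaluate_closed: "p \<in> carrier F \<Longrightarrow> evaluate R B \<phi> p \<in> carrier B"
  unfolding evaluate_def
  by (rule finsum_closed) (auto simp: word_value_closed[OF \<phi>] free_galg_simps Pi_iff)

lemma evaluate_add:
  assumes "p \<in> carrier F" "q \<in> carrier F"
  shows "evaluate R B \<phi> (p \<oplus>\<^bsub>F\<^esub> q) = evaluate R B \<phi> p \<oplus> evaluate R B \<phi> q"
proof -
  let ?S = "{w. p w \<noteq> \<zero>\<^bsub>R\<^esub>} \<union> {w. q w \<noteq> \<zero>\<^bsub>R\<^esub>}"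
  have S: "finite ?S" "?S \<subseteq> lists L"
    using assms by (auto simp: free_galg_simps)
  have c: "p w \<in> carrier R" "q w \<in> carrier R" for w
    using assms by (auto simp: free_galg_simps)
  have wv: "w \<in> ?S \<Longrightarrow> word_value B \<phi> w \<in> carrier B" for w
    using S(2) by (intro word_value_closed[OF \<phi>]) blast
  have pq: "p \<oplus>\<^bsub>F\<^esub> q \<in> carrier F"
    using R.free_galg_add_closed[OF assms] by (simp add: free_galg_simps(6))
  have "evaluate R B \<phi> (p \<oplus>\<^bsub>F\<^esub> q) = (\<Oplus>w\<in>?S. (p w \<oplus>\<^bsub>R\<^esub> q w) \<odot> word_value B \<phi> w)"
    by (subst evaluate_superset[OF pq S(1) _ S(2)]) (auto simp: free_galg_simps(6))
  also have "\<dots> = (\<Oplus>w\<in>?S. p w \<odot> word_value B \<phi> w \<oplus> q w \<odot> word_value B \<phi> w)"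
    by (rule finsum_cong') (use c wv in \<open>auto simp: smult_l_distr\<close>)
  also have "\<dots> = evaluate R B \<phi> p \<oplus> evaluate R B \<phi> q"
    by (subst finsum_addf)
      (use c wv in \<open>auto simp: evaluate_superset[OF assms(1) S(1) _ S(2)]
        evaluate_superset[OF assms(2) S(1) _ S(2)]\<close>)
  finally show ?thesis .
qed

lemma evaluate_smult:
  assumes "r \<in> carrier R" "p \<in> carrier F"
  shows "evaluate R B \<phi> (r \<odot>\<^bsub>F\<^esub> p) = r \<odot> evaluate R B \<phi> p"
proof -
  let ?S = "{w. p w \<noteq> \<zero>\<^bsub>R\<^esub>}"
  have S: "finite ?S" "?S \<subseteq> lists L"
    using assms by (auto simp: free_galg_simps)
  have c: "p w \<in> carrier R" for w
    using assms by (auto simp: free_galg_simps)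
  have wv: "w \<in> ?S \<Longrightarrow> word_value B \<phi> w \<in> carrier B" for w
    using S(2) by (intro word_value_closed[OF \<phi>]) blast
  have rp: "r \<odot>\<^bsub>F\<^esub> p \<in> carrier F"
    using R.free_galg_smult_closed[OF assms] by (simp add: free_galg_simps(7))
  have "evaluate R B \<phi> (r \<odot>\<^bsub>F\<^esub> p) = (\<Oplus>w\<in>?S. (r \<otimes>\<^bsub>R\<^esub> p w) \<odot> word_value B \<phi> w)"
    by (subst evaluate_superset[OF rp S(1) _ S(2)]) (use assms in \<open>auto simp: free_galg_simps(7)\<close>)
  also have "\<dots> = (\<Oplus>w\<in>?S. r \<odot> (p w \<odot> word_value B \<phi> w))"
    by (rule finsum_cong') (use c wv assms in \<open>auto simp: smult_assoc1\<close>)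
  also have "\<dots> = r \<odot> evaluate R B \<phi> p"
    unfolding evaluate_def
    by (rule finsum_smult_ldistr[symmetric]) (use c wv S assms in auto)
  finally show ?thesis .
qed

lemma evaluate_word:
  assumes "w \<in> lists L"
  shows "evaluate R B \<phi> (word R w) = word_value B \<phi> w"
proof -
  have "evaluate R B \<phi> (word R w) = (\<Oplus>v\<in>{w}. word R w v \<odot> word_value B \<phi> v)"
    by (rule evaluate_superset)
      (use R.word_closed[OF assms] assms in \<open>auto simp: word_def split: if_splits\<close>)
  also have "\<dots> = word_value B \<phi> w"
    using word_value_closed[OF \<phi> assms] by (simp add: word_def)
  finally show ?thesis .
qed

text \<open>Both sides are bilinear, so it is enough to compare them on words, first in the right and then in the
  left factor.\<close>

lemma evaluate_mult:
  assumes p: "p \<in> carrier F" and q: "q \<in> carrier F"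
  shows "evaluate R B \<phi> (p \<otimes>\<^bsub>F\<^esub> q) = evaluate R B \<phi> p \<otimes> evaluate R B \<phi> q"
proof -
  interpret F: graded_algebra R F by (rule R.free_galg_graded_algebra)
  note ev = evaluate_add evaluate_smult evaluate_word evaluate_closed
  have Fadd: "(\<lambda>v. q v \<oplus>\<^bsub>R\<^esub> r \<otimes>\<^bsub>R\<^esub> word R w v) = q \<oplus>\<^bsub>F\<^esub> r \<odot>\<^bsub>F\<^esub> word R w" for q r w
    by (simp add: free_galg_simps)
  have wc: "w \<in> lists L \<Longrightarrow> word R w \<in> carrier F" for w by (rule R.word_closed)
  have zero: "evaluate R B \<phi> \<zero>\<^bsub>F\<^esub> = \<zero>"
    by (simp add: evaluate_def free_galg_simps)
  have Fz: "(\<lambda>w. \<zero>\<^bsub>R\<^esub>) = \<zero>\<^bsub>F\<^esub>" by (simp add: free_galg_simps)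
  have ww: "word R u \<otimes>\<^bsub>F\<^esub> word R v = word R (u @ v)" for u v :: "'l list"
    by (simp add: free_galg_simps R.convolution_word)
  have word_left: "evaluate R B \<phi> (word R u \<otimes>\<^bsub>F\<^esub> q) = word_value B \<phi> u \<otimes> evaluate R B \<phi> q"
    if u: "u \<in> lists L" for u
    using q
  proof (induction q rule: R.free_galg_induct)
    case zero
    then show ?case
      using wc[OF u] word_value_closed[OF \<phi> u]
      unfolding Fz by (simp add: \<open>evaluate R B \<phi> \<zero>\<^bsub>F\<^esub> = \<zero>\<close>)
  next
    case (add q r w)
    have "word R u \<otimes>\<^bsub>F\<^esub> (q \<oplus>\<^bsub>F\<^esub> r \<odot>\<^bsub>F\<^esub> word R w) = word R u \<otimes>\<^bsub>F\<^esub> q \<oplus>\<^bsub>F\<^esub> r \<odot>\<^bsub>F\<^esub> word R (u @ w)"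
      using add wc u by (simp add: F.r_distr F.smult_mult_right ww)
    then show ?case
      using add wc u wc[of "u @ w"] word_value_closed[OF \<phi>] ev(4)[of q] unfolding Fadd
      by (simp add: ev word_value_append[OF \<phi>] r_distr smult_mult_right)
  qed
  show ?thesis
    using p
  proof (induction p rule: R.free_galg_induct)
    case zero
    then show ?case
      using q ev(4) unfolding Fz by (simp add: \<open>evaluate R B \<phi> \<zero>\<^bsub>F\<^esub> = \<zero>\<close>)
  next
    case (add p r w)
    have "(p \<oplus>\<^bsub>F\<^esub> r \<odot>\<^bsub>F\<^esub> word R w) \<otimes>\<^bsub>F\<^esub> q = p \<otimes>\<^bsub>F\<^esub> q \<oplus>\<^bsub>F\<^esub> r \<odot>\<^bsub>F\<^esub> (word R w \<otimes>\<^bsub>F\<^esub> q)"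
      using add wc q by (simp add: F.l_distr F.smult_mult_left)
    then show ?case
      using add wc q word_value_closed[OF \<phi>] ev(4)[of p] ev(4)[of q] unfolding Fadd
      by (simp add: ev word_left l_distr smult_mult_left)
  qed
qed

lemma evaluate_mor:
  assumes D: "\<And>l d. \<lbrakk>l \<in> L; D l d\<rbrakk> \<Longrightarrow> \<phi> l \<in> grade B d"
  shows "restrict (evaluate R B \<phi>) (carrier F) \<in> mor R F B"
proof -
  interpret F: graded_algebra R F by (rule R.free_galg_graded_algebra)
  have one: "evaluate R B \<phi> \<one>\<^bsub>F\<^esub> = \<one>"
    by (simp add: free_galg_simps evaluate_word word_value_def)
  have gr: "evaluate R B \<phi> p \<in> grade B n" if p: "p \<in> grade F n" for p n
    unfolding evaluate_def
  proof (rule grade_finsum)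
    show "finite {w. p w \<noteq> \<zero>\<^bsub>R\<^esub>}"
      using p by (simp add: free_galg_simps)
    fix w assume w: "w \<in> {w. p w \<noteq> \<zero>\<^bsub>R\<^esub>}"
    then have "w \<in> lists L" "letters_degree D w n" "p w \<in> carrier R"
      using p unfolding free_galg_simps by blast+
    then show "p w \<odot> word_value B \<phi> w \<in> grade B n"
      by (intro grade_smult word_value_grade[of L D \<phi>] D) auto
  qed
  show ?thesis
    by (rule morI)
      (use F.grade_carrier in \<open>simp_all add: evaluate_closed evaluate_add evaluate_mult evaluate_smult one gr\<close>)
qed

end

lemma free_galg_mor_exists:
  assumes \<phi>: "\<And>l. l \<in> L \<Longrightarrow> \<phi> l \<in> carrier B"
    and D: "\<And>l d. \<lbrakk>l \<in> L; D l d\<rbrakk> \<Longrightarrow> \<phi> l \<in> grade B d"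
  obtains f where "f \<in> mor R (free_galg R L D) B" "\<And>l. l \<in> L \<Longrightarrow> f (word R [l]) = \<phi> l"
proof
  have \<phi>': "\<phi> \<in> L \<rightarrow> carrier B" using \<phi> by blast
  let ?f = "restrict (evaluate R B \<phi>) (carrier (free_galg R L D))"
  show "?f \<in> mor R (free_galg R L D) B"
    by (rule evaluate_mor[OF \<phi>' D])
  show "?f (word R [l]) = \<phi> l" if "l \<in> L" for l
    using that \<phi> by (simp add: evaluate_word[OF \<phi>'] R.word_closed word_value_def)
qed

end

text \<open>A morphism maps \<open>p\<close> into the span of the images of the words that occur in \<open>p\<close>. Restricting to these
  words keeps track of degrees when \<open>p\<close> is homogeneous.\<close>

lemma free_galg_image_in_span:
  assumes F: "F = free_galg R L D" and C: "graded_algebra R C"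
    and hom: "f \<in> mor R F C" and p: "p \<in> carrier F"
    and S: "submodule S R C"
    and word: "\<And>w. \<lbrakk>w \<in> lists L; p w \<noteq> \<zero>\<^bsub>R\<^esub>\<rbrakk> \<Longrightarrow> f (word R w) \<in> S"
  shows "f p \<in> S"
proof -
  interpret C: graded_algebra R C by fact
  interpret F: graded_algebra R F unfolding F by (rule C.R.free_galg_graded_algebra)
  have wc: "w \<in> lists L \<Longrightarrow> word R w \<in> carrier F" for w unfolding F by (rule C.R.word_closed)
  have Fadd: "(\<lambda>v. q v \<oplus>\<^bsub>R\<^esub> r \<otimes>\<^bsub>R\<^esub> word R w v) = q \<oplus>\<^bsub>F\<^esub> r \<odot>\<^bsub>F\<^esub> word R w" for q r w
    by (simp add: F free_galg_simps)
  show ?thesis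
    using p unfolding F
  proof (induction p rule: C.R.free_galg_induct)
    case zero
    have "(\<lambda>w. \<zero>\<^bsub>R\<^esub>) = \<zero>\<^bsub>F\<^esub>" by (simp add: F free_galg_simps)
    moreover have "f \<zero>\<^bsub>F\<^esub> = \<zero>\<^bsub>C\<^esub>"
      by (rule mor_zero[OF hom F.graded_algebra_axioms C])
    ultimately show ?case
      using subgroup.one_closed[OF submodule.axioms(1)[OF S]] by simp
  next
    case (add q r w)
    have q: "q \<in> carrier F" and w: "w \<in> lists L" and r: "r \<in> carrier R" and IH: "f q \<in> S"
      and "p w \<noteq> \<zero>\<^bsub>R\<^esub>"
      using add by (simp_all add: F)
    have "f (q \<oplus>\<^bsub>F\<^esub> r \<odot>\<^bsub>F\<^esub> word R w) = f q \<oplus>\<^bsub>C\<^esub> r \<odot>\<^bsub>C\<^esub> f (word R w)"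
      using q r wc[OF w] by (simp add: morD[OF hom])
    then show ?case
      unfolding Fadd using r IH word[OF w \<open>p w \<noteq> \<zero>\<^bsub>R\<^esub>\<close>] C.submoduleE(4,5)[OF S] by simp
  qed
qed

lemma free_galg_word_Cons_image:
  assumes "graded_algebra R C" "f \<in> mor R (free_galg R L D) C" "l \<in> L" "w \<in> lists L"
  shows "f (word R (l # w)) = f (word R [l]) \<otimes>\<^bsub>C\<^esub> f (word R w)"
proof -
  interpret C: graded_algebra R C by fact
  have "word R (l # w) = word R [l] \<otimes>\<^bsub>free_galg R L D\<^esub> word R w"
    using C.R.convolution_word[of "[l]" w] by (simp add: free_galg_simps)
  moreover have "f (word R [l] \<otimes>\<^bsub>free_galg R L D\<^esub> word R w) = f (word R [l]) \<otimes>\<^bsub>C\<^esub> f (word R w)"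
    by (rule morD(3)[OF assms(2)]) (use assms(3,4) in \<open>simp_all add: C.R.word_closed\<close>)
  ultimately show ?thesis by simp
qed

text \<open>Closure under left multiplication by letters suffices to reach all words.\<close>

lemma free_galg_generated:
  assumes C: "graded_algebra R C"
    and hom: "f \<in> mor R (free_galg R L D) C" and p: "p \<in> carrier (free_galg R L D)"
    and S: "submodule S R C" "\<one>\<^bsub>C\<^esub> \<in> S"
    and mult: "\<And>l s. \<lbrakk>l \<in> L; s \<in> S\<rbrakk> \<Longrightarrow> f (word R [l]) \<otimes>\<^bsub>C\<^esub> s \<in> S"
  shows "f p \<in> S"
proof (rule free_galg_image_in_span[OF refl C hom p S(1)])
  show "f (word R w) \<in> S" if "w \<in> lists L" for w
    using that
  proof (induction w)
    case Nil
    have "word R [] = \<one>\<^bsub>free_galg R L D\<^esub>" by (simp add: free_galg_simps)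
    then show ?case using S(2) morD(4)[OF hom] by simp
  next
    case (Cons a w)
    then show ?case
      using mult[of a "f (word R w)"] free_galg_word_Cons_image[OF C hom, of a w] by simp
  qed
qed

lemma free_galg_mor_eqI:
  assumes C: "graded_algebra R C" and f: "f \<in> mor R (free_galg R L D) C" and g: "g \<in> mor R (free_galg R L D) C"
    and eq: "\<And>l. l \<in> L \<Longrightarrow> f (word R [l]) = g (word R [l])"
  shows "f = g"
proof (rule mor_eqI[OF f g])
  interpret C: graded_algebra R C by fact
  let ?F = "free_galg R L D"
  interpret F: graded_algebra R ?F by (rule C.R.free_galg_graded_algebra)
  note fD = morD[OF f] and gD = morD[OF g]
  let ?S = "{p \<in> carrier ?F. f p = g p}"
  have sub: "submodule ?S R ?F"
    by (rule F.submoduleI) (auto simp: fD gD mor_zero[OF f F.graded_algebra_axioms C]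
      mor_zero[OF g F.graded_algebra_axioms C] mor_uminus[OF f F.graded_algebra_axioms C]
      mor_uminus[OF g F.graded_algebra_axioms C])
  fix p assume p: "p \<in> carrier ?F"
  have wc: "word R [l] \<in> carrier ?F" if "l \<in> L" for l using that by (intro C.R.word_closed) simp
  have "id_mor ?F p \<in> ?S"
    by (rule free_galg_generated[OF F.graded_algebra_axioms id_mor_mor[OF F.graded_algebra_axioms] p sub])
      (auto simp: fD gD wc eq)
  then show "f p = g p" using p by simp
qed

section \<open>Free products\<close>

text \<open>The ring axioms do not see the record type; this moves them between different extensions of
  the type of rings.\<close>

lemma ring_transfer:
  assumes "ring A" "carrier B = carrier A" "mult B = mult A" "one B = one A" "zero B = zero A" "add B = add A"
  shows "ring B"
proof -
  have "id \<in> ring_hom A B"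
    using assms(2-) by (auto simp: ring_hom_def)
  from ring.ring_hom_imp_img_ring[OF assms(1) this] show ?thesis
    by (simp add: assms(2)[symmetric] assms(5)[symmetric])
qed

context
  fixes R :: "('r, 'c) ring_scheme" and A :: "('r, 'a, 'x) galg_scheme" and B :: "('r, 'b, 'y) galg_scheme"
  assumes A: "graded_algebra R A" and B: "graded_algebra R B"
begin

interpretation A: graded_algebra R A by (rule A)
interpretation B: graded_algebra R B by (rule B)

private abbreviation (input) "L \<equiv> carrier A <+> carrier B"
private abbreviation (input) "D \<equiv> (\<lambda>l d. l \<in> grade A d <+> grade B d)"
private abbreviation (input) "F \<equiv> free_galg R L D"
private abbreviation (input) "K \<equiv> free_product_cover R A B"
private abbreviation (input) "I \<equiv> free_product_ideal R A B"
private abbreviation (input) "P \<equiv> free_product R A B"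

interpretation F: graded_algebra R F by (rule A.R.free_galg_graded_algebra)

text \<open>The free algebra that covers the free product has no grading of its own. It is identified here with
  the free algebra on the same letters in which the homogeneous elements of \<open>A\<close> and \<open>B\<close> keep their
  degrees.\<close>

lemma cover_simps:
  "carrier K = carrier F" "mult K = mult F" "one K = one F" "zero K = zero F" "add K = add F" "smult K = smult F"
proof -
  show "carrier K = carrier F"
    by (rule Set.set_eqI) (simp add: free_product_cover_def free_algebra_def free_galg_simps(1) image_subset_iff_funcset)
qed (simp_all add: free_product_cover_def free_algebra_def free_galg_def convolution_def word_def fun_eq_iff)

interpretation K: ring K
  by (rule ring_transfer[OF F.ring_axioms]) (simp_all add: cover_simps)

lemma cover_uminus: "y \<in> carrier F \<Longrightarrow> \<ominus>\<^bsub>K\<^esub> y = \<ominus>\<^bsub>F\<^esub> y"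
  by (rule K.minus_equality) (simp_all add: cover_simps F.l_neg)

lemma cover_minus: "y \<in> carrier F \<Longrightarrow> x \<ominus>\<^bsub>K\<^esub> y = x \<ominus>\<^bsub>F\<^esub> y"
  by (simp add: a_minus_def cover_simps cover_uminus)

lemma letter_closed:
  "x \<in> carrier A \<Longrightarrow> word R [Inl x] \<in> carrier F" "y \<in> carrier B \<Longrightarrow> word R [Inr y] \<in> carrier F"
  by (rule A.R.word_closed, simp add: InlI InrI)+

lemma letters_closed:
  assumes "u \<in> L" "v \<in> L"
  shows "word R [u, v] \<in> carrier F" "word R [u, v] = word R [u] \<otimes>\<^bsub>F\<^esub> word R [v]"
proof -
  show "word R [u, v] \<in> carrier F"
    by (rule A.R.word_closed) (use assms in simp)
  show "word R [u, v] = word R [u] \<otimes>\<^bsub>F\<^esub> word R [v]"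
    by (simp add: free_galg_simps A.R.convolution_word)
qed

lemma relations_cover_eq:
  "hom_relations R L A Inl = (
     {word R [Inl (x \<oplus>\<^bsub>A\<^esub> y)] \<ominus>\<^bsub>F\<^esub> (word R [Inl x] \<oplus>\<^bsub>F\<^esub> word R [Inl y]) |x y.
        x \<in> carrier A \<and> y \<in> carrier A} \<union>
     {word R [Inl (r \<odot>\<^bsub>A\<^esub> x)] \<ominus>\<^bsub>F\<^esub> (r \<odot>\<^bsub>F\<^esub> word R [Inl x]) |r x.
        r \<in> carrier R \<and> x \<in> carrier A} \<union>
     {word R [Inl (x \<otimes>\<^bsub>A\<^esub> y)] \<ominus>\<^bsub>F\<^esub> word R [Inl x] \<otimes>\<^bsub>F\<^esub> word R [Inl y] |x y.
        x \<in> carrier A \<and> y \<in> carrier A} \<union>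
     {word R [Inl \<one>\<^bsub>A\<^esub>] \<ominus>\<^bsub>F\<^esub> \<one>\<^bsub>F\<^esub>})" (is "_ = ?A")
  "hom_relations R L B Inr = (
     {word R [Inr (x \<oplus>\<^bsub>B\<^esub> y)] \<ominus>\<^bsub>F\<^esub> (word R [Inr x] \<oplus>\<^bsub>F\<^esub> word R [Inr y]) |x y.
        x \<in> carrier B \<and> y \<in> carrier B} \<union>
     {word R [Inr (r \<odot>\<^bsub>B\<^esub> x)] \<ominus>\<^bsub>F\<^esub> (r \<odot>\<^bsub>F\<^esub> word R [Inr x]) |r x.
        r \<in> carrier R \<and> x \<in> carrier B} \<union>
     {word R [Inr (x \<otimes>\<^bsub>B\<^esub> y)] \<ominus>\<^bsub>F\<^esub> word R [Inr x] \<otimes>\<^bsub>F\<^esub> word R [Inr y] |x y.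
        x \<in> carrier B \<and> y \<in> carrier B} \<union>
     {word R [Inr \<one>\<^bsub>B\<^esub>] \<ominus>\<^bsub>F\<^esub> \<one>\<^bsub>F\<^esub>})" (is "_ = ?B")
proof -
  have c: "free_algebra R L = K" by (simp add: free_product_cover_def)
  note cl = letter_closed letters_closed InlI InrI
  show "hom_relations R L A Inl = ?A"
    unfolding hom_relations_def Let_def c
    by (intro arg_cong2[where f="(\<union>)"] Collect_cong ex_cong1 arg_cong2[where f=insert] refl)
      (auto simp: cover_minus cover_simps cl)
  show "hom_relations R L B Inr = ?B"
    unfolding hom_relations_def Let_def c
    by (intro arg_cong2[where f="(\<union>)"] Collect_cong ex_cong1 arg_cong2[where f=insert] refl)
      (auto simp: cover_minus cover_simps cl)
qed

lemma relations_closed: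
  "hom_relations R L A Inl \<union> hom_relations R L B Inr \<subseteq> carrier K"
  unfolding relations_cover_eq cover_simps
  by (auto simp: letter_closed intro!: F.minus_closed)

interpretation I: ideal I K
  unfolding free_product_ideal_def by (rule K.genideal_ideal[OF relations_closed])

lemma coset_eq_iff:
  assumes "p \<in> carrier F" "q \<in> carrier F"
  shows "I +>\<^bsub>K\<^esub> p = I +>\<^bsub>K\<^esub> q \<longleftrightarrow> p \<ominus>\<^bsub>F\<^esub> q \<in> I"
  using K.quotient_eq_iff_same_a_r_cos[OF I.is_ideal, of p q] assms by (simp add: cover_simps cover_minus)

lemma ideal_smult:
  assumes "r \<in> carrier R" "p \<in> I"
  shows "r \<odot>\<^bsub>F\<^esub> p \<in> I"
proof -
  have p: "p \<in> carrier F" using I.a_subset assms(2) by (auto simp: cover_simps)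
  have "(r \<odot>\<^bsub>F\<^esub> \<one>\<^bsub>F\<^esub>) \<otimes>\<^bsub>K\<^esub> p \<in> I"
    by (rule I.I_l_closed[OF assms(2)]) (use assms in \<open>simp add: cover_simps\<close>)
  then show ?thesis
    using assms p by (simp add: cover_simps F.smult_one_mult)
qed

text \<open>Facts about the free product are obtained by pushing facts about words along this projection.\<close>

definition coset_map where "coset_map = (\<lambda>p\<in>carrier F. I +>\<^bsub>K\<^esub> p)"

lemma coset_map_eq: "p \<in> carrier F \<Longrightarrow> coset_map p = I +>\<^bsub>K\<^esub> p"
  by (simp add: coset_map_def)

lemma coset_map_surj: "coset_map ` carrier F = carrier P"
  by (auto simp: coset_map_def free_product_def Let_def FactRing_def A_RCOSETS_def' cover_simps)

lemma coset_map_hom: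
  "\<lbrakk>x \<in> carrier F; y \<in> carrier F\<rbrakk> \<Longrightarrow> coset_map (x \<oplus>\<^bsub>F\<^esub> y) = coset_map x \<oplus>\<^bsub>P\<^esub> coset_map y"
  "\<lbrakk>x \<in> carrier F; y \<in> carrier F\<rbrakk> \<Longrightarrow> coset_map (x \<otimes>\<^bsub>F\<^esub> y) = coset_map x \<otimes>\<^bsub>P\<^esub> coset_map y"
  "\<lbrakk>r \<in> carrier R; x \<in> carrier F\<rbrakk> \<Longrightarrow> coset_map (r \<odot>\<^bsub>F\<^esub> x) = r \<odot>\<^bsub>P\<^esub> coset_map x"
  "coset_map \<one>\<^bsub>F\<^esub> = \<one>\<^bsub>P\<^esub>" "coset_map \<zero>\<^bsub>F\<^esub> = \<zero>\<^bsub>P\<^esub>"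
  "grade P n = coset_map ` grade F n"
proof -
  note h = I.rcos_ring_hom
  show "coset_map (x \<oplus>\<^bsub>F\<^esub> y) = coset_map x \<oplus>\<^bsub>P\<^esub> coset_map y"
    if "x \<in> carrier F" "y \<in> carrier F"
    using ring_hom_add[OF h, of x y] that
    by (simp add: coset_map_def free_product_def Let_def cover_simps)
  show "coset_map (x \<otimes>\<^bsub>F\<^esub> y) = coset_map x \<otimes>\<^bsub>P\<^esub> coset_map y"
    if "x \<in> carrier F" "y \<in> carrier F"
    using ring_hom_mult[OF h, of x y] that
    by (simp add: coset_map_def free_product_def Let_def cover_simps)
  show "coset_map \<one>\<^bsub>F\<^esub> = \<one>\<^bsub>P\<^esub>"
    using ring_hom_one[OF h]
    by (simp add: coset_map_def free_product_def Let_def cover_simps)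
  show "coset_map \<zero>\<^bsub>F\<^esub> = \<zero>\<^bsub>P\<^esub>"
    using K.a_coset_add_zero[OF I.a_subset]
    by (simp add: coset_map_def free_product_def Let_def cover_simps FactRing_def)
  show "coset_map (r \<odot>\<^bsub>F\<^esub> x) = r \<odot>\<^bsub>P\<^esub> coset_map x"
    if r: "r \<in> carrier R" and x: "x \<in> carrier F"
  proof -
    have "I +>\<^bsub>K\<^esub> (r \<odot>\<^bsub>F\<^esub> p) = I +>\<^bsub>K\<^esub> (r \<odot>\<^bsub>F\<^esub> x)" if p: "p \<in> I +>\<^bsub>K\<^esub> x" for p
    proof -
      obtain i where i: "i \<in> I" "p = i \<oplus>\<^bsub>F\<^esub> x"
        using p by (auto simp: a_r_coset_def' cover_simps)
      then have iF: "i \<in> carrier F" using I.a_subset by (auto simp: cover_simps)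
      have "r \<odot>\<^bsub>F\<^esub> p \<ominus>\<^bsub>F\<^esub> r \<odot>\<^bsub>F\<^esub> x = r \<odot>\<^bsub>F\<^esub> i"
        using r x i iF by (simp add: F.smult_r_distr a_minus_def F.a_assoc F.r_neg)
      then show ?thesis
        using r x i iF ideal_smult[OF r i(1)] by (subst coset_eq_iff) simp_all
    qed
    moreover have "x \<in> I +>\<^bsub>K\<^esub> x"
      by (rule I.a_rcos_self) (simp add: x cover_simps)
    ultimately have "(\<Union>p\<in>I +>\<^bsub>K\<^esub> x. I +>\<^bsub>K\<^esub> (r \<odot>\<^bsub>F\<^esub> p)) = I +>\<^bsub>K\<^esub> (r \<odot>\<^bsub>F\<^esub> x)"
      by blast
    then show ?thesis
      using r x by (simp add: coset_map_def free_product_def Let_def cover_simps)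
  qed
  have wd: "word_degree A B = letters_degree D"
    by (simp add: word_degree_def letters_degree_def fun_eq_iff)
  show "grade P n = coset_map ` grade F n"
    unfolding free_product_def Let_def wd
    by (auto simp: free_galg_simps(2) coset_map_def cover_simps image_iff)
qed

lemma free_product_graded_algebra: "graded_algebra R P"
  by (rule graded_algebra_surjective_image[OF F.graded_algebra_axioms coset_map_surj coset_map_hom])

interpretation P: graded_algebra R P by (rule free_product_graded_algebra)

lemma coset_map_mor: "coset_map \<in> mor R F P"
proof (rule morI)
  show "coset_map x \<in> carrier P" if "x \<in> carrier F" for x
    using that coset_map_surj by blast
  show "coset_map x \<in> grade P n" if "x \<in> grade F n" for x n
    using that coset_map_hom(6) by blast
  show "coset_map \<in> extensional (carrier F)"
    by (simp add: coset_map_def)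
qed (simp_all add: coset_map_hom)

lemma incl_coset_map:
  "x \<in> carrier A \<Longrightarrow> incl1 R A B x = coset_map (word R [Inl x])"
  "y \<in> carrier B \<Longrightarrow> incl2 R A B y = coset_map (word R [Inr y])"
  by (simp_all add: incl1_def incl2_def coset_map_def letter_closed)

lemma coset_map_eqI:
  "\<lbrakk>p \<ominus>\<^bsub>F\<^esub> q \<in> hom_relations R L A Inl \<union> hom_relations R L B Inr; p \<in> carrier F; q \<in> carrier F\<rbrakk>
    \<Longrightarrow> coset_map p = coset_map q"
  using K.genideal_self[OF relations_closed] coset_eq_iff[of p q] coset_map_eq[of p] coset_map_eq[of q]
  unfolding free_product_ideal_def by blast

lemma incl1_mor: "incl1 R A B \<in> mor R A P"
proof (rule morI)
  show "incl1 R A B x \<in> grade P n" if "x \<in> grade A n" for x n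
  proof -
    have x: "x \<in> carrier A" using A.grade_carrier[OF that] .
    have "letters_degree D [Inl x] n"
      using that by (simp add: letters_degree_Cons InlI)
    moreover have "w = [Inl x]" if "word R [Inl x] w \<noteq> \<zero>\<^bsub>R\<^esub>" for w
      using that by (simp add: word_def split: if_splits)
    ultimately have "word R [Inl x] \<in> grade F n"
      unfolding free_galg_simps(2) using letter_closed(1)[OF x] by blast
    then show ?thesis
      using incl_coset_map(1)[OF x] morD(6)[OF coset_map_mor] by simp
  qed
  show "incl1 R A B (x \<oplus>\<^bsub>A\<^esub> y) = incl1 R A B x \<oplus>\<^bsub>P\<^esub> incl1 R A B y"
    if "x \<in> carrier A" "y \<in> carrier A" for x y
    using that
    by (simp add: incl_coset_map letter_closed flip: coset_map_hom)
      (rule coset_map_eqI, unfold relations_cover_eq, blast, simp_all add: letter_closed)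
  show "incl1 R A B (x \<otimes>\<^bsub>A\<^esub> y) = incl1 R A B x \<otimes>\<^bsub>P\<^esub> incl1 R A B y"
    if "x \<in> carrier A" "y \<in> carrier A" for x y
    using that
    by (simp add: incl_coset_map letter_closed flip: coset_map_hom)
      (rule coset_map_eqI, unfold relations_cover_eq, blast, simp_all add: letter_closed)
  show "incl1 R A B (r \<odot>\<^bsub>A\<^esub> x) = r \<odot>\<^bsub>P\<^esub> incl1 R A B x"
    if "r \<in> carrier R" "x \<in> carrier A" for r x
    using that
    by (simp add: incl_coset_map letter_closed flip: coset_map_hom)
      (rule coset_map_eqI, unfold relations_cover_eq, blast, simp_all add: letter_closed)
  show "incl1 R A B \<one>\<^bsub>A\<^esub> = \<one>\<^bsub>P\<^esub>"
    by (simp add: incl_coset_map letter_closed flip: coset_map_hom)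
      (rule coset_map_eqI, unfold relations_cover_eq, blast, simp_all add: letter_closed)
  show "incl1 R A B x \<in> carrier P" if "x \<in> carrier A" for x
    using that by (simp add: incl_coset_map morD(1)[OF coset_map_mor] letter_closed)
  show "incl1 R A B \<in> extensional (carrier A)" by (simp add: incl1_def)
qed

lemma incl2_mor: "incl2 R A B \<in> mor R B P"
proof (rule morI)
  show "incl2 R A B x \<in> grade P n" if "x \<in> grade B n" for x n
  proof -
    have x: "x \<in> carrier B" using B.grade_carrier[OF that] .
    have "letters_degree D [Inr x] n"
      using that by (simp add: letters_degree_Cons InrI)
    moreover have "w = [Inr x]" if "word R [Inr x] w \<noteq> \<zero>\<^bsub>R\<^esub>" for w
      using that by (simp add: word_def split: if_splits)
    ultimately have "word R [Inr x] \<in> grade F n"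
      unfolding free_galg_simps(2) using letter_closed(2)[OF x] by blast
    then show ?thesis
      using incl_coset_map(2)[OF x] morD(6)[OF coset_map_mor] by simp
  qed
  show "incl2 R A B (x \<oplus>\<^bsub>B\<^esub> y) = incl2 R A B x \<oplus>\<^bsub>P\<^esub> incl2 R A B y"
    if "x \<in> carrier B" "y \<in> carrier B" for x y
    using that
    by (simp add: incl_coset_map letter_closed flip: coset_map_hom)
      (rule coset_map_eqI, unfold relations_cover_eq, blast, simp_all add: letter_closed)
  show "incl2 R A B (x \<otimes>\<^bsub>B\<^esub> y) = incl2 R A B x \<otimes>\<^bsub>P\<^esub> incl2 R A B y"
    if "x \<in> carrier B" "y \<in> carrier B" for x y
    using that
    by (simp add: incl_coset_map letter_closed flip: coset_map_hom)
      (rule coset_map_eqI, unfold relations_cover_eq, blast, simp_all add: letter_closed)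
  show "incl2 R A B (r \<odot>\<^bsub>B\<^esub> x) = r \<odot>\<^bsub>P\<^esub> incl2 R A B x"
    if "r \<in> carrier R" "x \<in> carrier B" for r x
    using that
    by (simp add: incl_coset_map letter_closed flip: coset_map_hom)
      (rule coset_map_eqI, unfold relations_cover_eq, blast, simp_all add: letter_closed)
  show "incl2 R A B \<one>\<^bsub>B\<^esub> = \<one>\<^bsub>P\<^esub>"
    by (simp add: incl_coset_map letter_closed flip: coset_map_hom)
      (rule coset_map_eqI, unfold relations_cover_eq, blast, simp_all add: letter_closed)
  show "incl2 R A B x \<in> carrier P" if "x \<in> carrier B" for x
    using that by (simp add: incl_coset_map morD(1)[OF coset_map_mor] letter_closed)
  show "incl2 R A B \<in> extensional (carrier B)" by (simp add: incl2_def)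
qed

lemma free_product_generated:
  assumes S: "submodule S R P" "\<one>\<^bsub>P\<^esub> \<in> S"
    and mult: "\<And>x s. \<lbrakk>x \<in> carrier A; s \<in> S\<rbrakk> \<Longrightarrow> incl1 R A B x \<otimes>\<^bsub>P\<^esub> s \<in> S"
      "\<And>x s. \<lbrakk>x \<in> carrier B; s \<in> S\<rbrakk> \<Longrightarrow> incl2 R A B x \<otimes>\<^bsub>P\<^esub> s \<in> S"
    and z: "z \<in> carrier P"
  shows "z \<in> S"
proof -
  obtain p where p: "p \<in> carrier F" "z = coset_map p"
    using z coset_map_surj by blast
  have "coset_map p \<in> S"
    by (rule free_galg_generated[OF P.graded_algebra_axioms coset_map_mor p(1) S])
      (use mult in \<open>auto simp flip: incl_coset_map\<close>)
  then show ?thesis using p by simp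
qed

lemma free_product_mor_eqI:
  assumes C: "graded_algebra R C" and h: "h \<in> mor R P C" "h' \<in> mor R P C"
    and eq: "\<And>x. x \<in> carrier A \<Longrightarrow> h (incl1 R A B x) = h' (incl1 R A B x)"
      "\<And>x. x \<in> carrier B \<Longrightarrow> h (incl2 R A B x) = h' (incl2 R A B x)"
  shows "h = h'"
proof (rule mor_eqI[OF h])
  interpret C: graded_algebra R C by fact
  fix z assume z: "z \<in> carrier P"
  note hD = morD[OF h(1)] and hD' = morD[OF h(2)]
  let ?S = "{z \<in> carrier P. h z = h' z}"
  have "submodule ?S R P"
    by (rule P.submoduleI) (auto simp: hD hD' mor_zero[OF h(1) P.graded_algebra_axioms C]
      mor_zero[OF h(2) P.graded_algebra_axioms C] mor_uminus[OF h(1) P.graded_algebra_axioms C]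
      mor_uminus[OF h(2) P.graded_algebra_axioms C])
  then have "z \<in> ?S"
    by (rule free_product_generated)
      (use z eq hD hD' morD(1)[OF incl1_mor] morD(1)[OF incl2_mor] in auto)
  then show "h z = h' z" by simp
qed

text \<open>The two morphisms define one on the letters, which extends to the free algebra. Its kernel is an ideal
  that contains the defining relations, so it factors through the quotient.\<close>

lemma free_product_mor_exists:
  assumes C: "graded_algebra R C" and f: "f \<in> mor R A C" and g: "g \<in> mor R B C"
  obtains h where "h \<in> mor R P C" "\<And>x. x \<in> carrier A \<Longrightarrow> h (incl1 R A B x) = f x"
    "\<And>x. x \<in> carrier B \<Longrightarrow> h (incl2 R A B x) = g x"
proof -
  interpret C: graded_algebra R C by fact
  note fD = morD[OF f] and gD = morD[OF g]
  obtain e where e: "e \<in> mor R F C" and el: "\<And>l. l \<in> L \<Longrightarrow> e (word R [l]) = case_sum f g l"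
    by (rule C.free_galg_mor_exists[of L "case_sum f g" D]) (use fD gD in auto)
  note eD = morD[OF e]
  note e_minus = mor_minus[OF e F.graded_algebra_axioms C]
  have letters: "x \<in> carrier A \<Longrightarrow> e (word R [Inl x]) = f x" "y \<in> carrier B \<Longrightarrow> e (word R [Inr y]) = g y" for x y
    using el[of "Inl x"] el[of "Inr y"] by (simp_all add: InlI InrI)
  define N where "N = {p \<in> carrier F. e p = \<zero>\<^bsub>C\<^esub>}"
  have "ideal N K"
  proof (rule idealI[OF K.ring_axioms])
    show "subgroup N (add_monoid K)"
      by (rule K.add.subgroupI)
        (auto simp: N_def cover_simps cover_uminus eD mor_zero[OF e F.graded_algebra_axioms C]
          mor_uminus[OF e F.graded_algebra_axioms C])
  qed (auto simp: N_def cover_simps eD)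
  moreover have "hom_relations R L A Inl \<union> hom_relations R L B Inr \<subseteq> N"
    unfolding relations_cover_eq
    by (auto simp: N_def letter_closed e_minus eD letters fD gD C.minus_eq C.r_neg intro!: F.minus_closed)
  ultimately have IN: "I \<subseteq> N"
    unfolding free_product_ideal_def by (rule K.genideal_minimal)
  have e_cong: "e p = e q" if "p \<in> carrier F" "q \<in> carrier F" "coset_map p = coset_map q" for p q
  proof -
    have "p \<ominus>\<^bsub>F\<^esub> q \<in> N"
      using that IN by (auto simp: coset_map_eq coset_eq_iff)
    then have "e p \<ominus>\<^bsub>C\<^esub> e q = \<zero>\<^bsub>C\<^esub>"
      using that by (simp add: N_def e_minus)
    then show ?thesis
      using that eD(1) by simp
  qed
  define h where "h = (\<lambda>z\<in>carrier P. e (SOME p. p \<in> carrier F \<and> coset_map p = z))"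
  have h: "h (coset_map p) = e p" if p: "p \<in> carrier F" for p
  proof -
    have "\<exists>q. q \<in> carrier F \<and> coset_map q = coset_map p" using p by blast
    from someI_ex[OF this] have "e (SOME q. q \<in> carrier F \<and> coset_map q = coset_map p) = e p"
      using p by (intro e_cong) blast+
    then show ?thesis
      using morD(1)[OF coset_map_mor p] by (simp add: h_def)
  qed
  have ex: "\<exists>p\<in>carrier F. z = coset_map p" if "z \<in> carrier P" for z
    using that coset_map_surj by blast
  have "h \<in> mor R P C"
  proof (rule morI)
    show "h x \<in> grade C n" if "x \<in> grade P n" for x n
      using that by (auto simp: coset_map_hom(6) h eD F.grade_carrier)
    show "h x \<in> carrier C" if "x \<in> carrier P" for x
      using ex[OF that] by (auto simp: h eD)
    show "h (x \<oplus>\<^bsub>P\<^esub> y) = h x \<oplus>\<^bsub>C\<^esub> h y" if "x \<in> carrier P" "y \<in> carrier P" for x y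
      using ex[OF that(1)] ex[OF that(2)] by (auto simp: h eD simp flip: coset_map_hom)
    show "h (x \<otimes>\<^bsub>P\<^esub> y) = h x \<otimes>\<^bsub>C\<^esub> h y" if "x \<in> carrier P" "y \<in> carrier P" for x y
      using ex[OF that(1)] ex[OF that(2)] by (auto simp: h eD simp flip: coset_map_hom)
    show "h (r \<odot>\<^bsub>P\<^esub> x) = r \<odot>\<^bsub>C\<^esub> h x" if "r \<in> carrier R" "x \<in> carrier P" for r x
      using ex[OF that(2)] that(1) by (auto simp: h eD simp flip: coset_map_hom)
    show "h \<one>\<^bsub>P\<^esub> = \<one>\<^bsub>C\<^esub>"
      by (auto simp: h eD simp flip: coset_map_hom)
    show "h \<in> extensional (carrier P)"
      by (simp add: h_def)
  qed
  moreover have "h (incl1 R A B x) = f x" if "x \<in> carrier A" for x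
    using that by (simp add: incl_coset_map h letter_closed letters)
  moreover have "h (incl2 R A B x) = g x" if "x \<in> carrier B" for x
    using that by (simp add: incl_coset_map h letter_closed letters)
  ultimately show thesis using that by blast
qed

lemma copair_properties:
  assumes C: "graded_algebra R C" and f: "f \<in> mor R A C" and g: "g \<in> mor R B C"
  shows copair_mor: "copair R A B C f g \<in> mor R P C"
    and copair_incl1: "x \<in> carrier A \<Longrightarrow> copair R A B C f g (incl1 R A B x) = f x"
    and copair_incl2: "y \<in> carrier B \<Longrightarrow> copair R A B C f g (incl2 R A B y) = g y"
proof -
  obtain h where h: "h \<in> mor R P C" and h1: "\<And>x. x \<in> carrier A \<Longrightarrow> h (incl1 R A B x) = f x"
    and h2: "\<And>x. x \<in> carrier B \<Longrightarrow> h (incl2 R A B x) = g x"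
    using free_product_mor_exists[OF C f g] by blast
  have "copair R A B C f g = h"
    unfolding copair_def
  proof (rule the_equality)
    have "compose (carrier A) h (incl1 R A B) = f"
      by (rule extensionalityI[of _ "carrier A"]) (use morD(7)[OF f] h1 in \<open>simp_all add: compose_eq\<close>)
    moreover have "compose (carrier B) h (incl2 R A B) = g"
      by (rule extensionalityI[of _ "carrier B"]) (use morD(7)[OF g] h2 in \<open>simp_all add: compose_eq\<close>)
    ultimately show "h \<in> mor R P C \<and> compose (carrier A) h (incl1 R A B) = f \<and> compose (carrier B) h (incl2 R A B) = g"
      using h by simp
  next
    fix h' assume h': "h' \<in> mor R P C \<and> compose (carrier A) h' (incl1 R A B) = f \<and> compose (carrier B) h' (incl2 R A B) = g"
    show "h' = h"
    proof (rule free_product_mor_eqI[OF C])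
      show "h' (incl1 R A B x) = h (incl1 R A B x)" if "x \<in> carrier A" for x
        using that h' h1 compose_eq[of x "carrier A" h' "incl1 R A B"] by simp
      show "h' (incl2 R A B x) = h (incl2 R A B x)" if "x \<in> carrier B" for x
        using that h' h2 compose_eq[of x "carrier B" h' "incl2 R A B"] by simp
    qed (use h h' in auto)
  qed
  with h h1 h2 show "copair R A B C f g \<in> mor R P C"
    "x \<in> carrier A \<Longrightarrow> copair R A B C f g (incl1 R A B x) = f x"
    "y \<in> carrier B \<Longrightarrow> copair R A B C f g (incl2 R A B y) = g y"
    by auto
qed

text \<open>A homogeneous element is the image of a combination of words of its degree, so membership in a
  submodule can be tested on these words.\<close>

lemma free_product_homogeneous_span:
  assumes z: "z \<in> grade P n" and S: "submodule S R P"
    and word: "\<And>w. \<lbrakk>w \<in> lists L; letters_degree D w n\<rbrakk> \<Longrightarrow> coset_map (word R w) \<in> S"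
  shows "z \<in> S"
proof -
  obtain p where p: "p \<in> grade F n" "z = coset_map p"
    using z coset_map_hom(6) by blast
  have "coset_map p \<in> S"
    by (rule free_galg_image_in_span[OF refl P.graded_algebra_axioms coset_map_mor _ S])
      (use p(1) word in \<open>auto simp: free_galg_simps(2)\<close>)
  then show ?thesis using p by simp
qed

lemma coset_map_word_Cons:
  "\<lbrakk>l \<in> L; w \<in> lists L\<rbrakk> \<Longrightarrow>
    coset_map (word R (l # w)) = case_sum (incl1 R A B) (incl2 R A B) l \<otimes>\<^bsub>P\<^esub> coset_map (word R w)"
  using free_galg_word_Cons_image[OF P.graded_algebra_axioms coset_map_mor, of l w]
  by (cases l) (auto simp: incl_coset_map)

lemma coset_map_word_Nil: "coset_map (word R []) = \<one>\<^bsub>P\<^esub>"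
  using coset_map_hom(4) by (simp add: free_galg_simps)

end

subsection \<open>Functoriality\<close>

lemma free_product_mor_properties:
  assumes A: "graded_algebra R A" and B: "graded_algebra R B" and C: "graded_algebra R C" and D: "graded_algebra R D"
    and f: "f \<in> mor R A C" and g: "g \<in> mor R B D"
  shows free_product_mor_mor: "free_product_mor R A B C D f g \<in> mor R (free_product R A B) (free_product R C D)"
    and free_product_mor_incl1:
      "x \<in> carrier A \<Longrightarrow> free_product_mor R A B C D f g (incl1 R A B x) = incl1 R C D (f x)"
    and free_product_mor_incl2:
      "y \<in> carrier B \<Longrightarrow> free_product_mor R A B C D f g (incl2 R A B y) = incl2 R C D (g y)"
proof -
  have 1: "compose (carrier A) (incl1 R C D) f \<in> mor R A (free_product R C D)"
    by (rule mor_comp[OF A f incl1_mor[OF C D]])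
  have 2: "compose (carrier B) (incl2 R C D) g \<in> mor R B (free_product R C D)"
    by (rule mor_comp[OF B g incl2_mor[OF C D]])
  note c = copair_properties[OF A B free_product_graded_algebra[OF C D] 1 2]
  show "free_product_mor R A B C D f g \<in> mor R (free_product R A B) (free_product R C D)"
    "x \<in> carrier A \<Longrightarrow> free_product_mor R A B C D f g (incl1 R A B x) = incl1 R C D (f x)"
    "y \<in> carrier B \<Longrightarrow> free_product_mor R A B C D f g (incl2 R A B y) = incl2 R C D (g y)"
    using c unfolding free_product_mor_def by (simp_all add: compose_eq)
qed

lemma free_product_mor_compose:
  assumes A: "graded_algebra R A" and B: "graded_algebra R B" and C: "graded_algebra R C"
    and f: "f \<in> mor R A B" and g: "g \<in> mor R B C" and z: "z \<in> carrier (free_product R A A)"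
  shows "free_product_mor R A A C C (compose (carrier A) g f) (compose (carrier A) g f) z =
    free_product_mor R B B C C g g (free_product_mor R A A B B f f z)"
proof -
  let ?gf = "compose (carrier A) g f"
  note gf = mor_comp[OF A f g]
  note PA = free_product_graded_algebra[OF A A] and PC = free_product_graded_algebra[OF C C]
  note p = free_product_mor_properties[OF A A B B f f] free_product_mor_properties[OF B B C C g g]
    free_product_mor_properties[OF A A C C gf gf]
  have "free_product_mor R A A C C ?gf ?gf =
    compose (carrier (free_product R A A)) (free_product_mor R B B C C g g) (free_product_mor R A A B B f f)"
    by (rule free_product_mor_eqI[OF A A PC p(7) mor_comp[OF PA p(1) p(4)]])
      (simp_all add: p(2,3,5,6,8,9) compose_eq morD(1)[OF f]
        morD(1)[OF incl1_mor[OF A A]] morD(1)[OF incl2_mor[OF A A]])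
  then show ?thesis
    using z by (simp add: compose_eq)
qed

lemma free_product_mor_id:
  assumes A: "graded_algebra R A" and z: "z \<in> carrier (free_product R A A)"
  shows "free_product_mor R A A A A (id_mor A) (id_mor A) z = z"
proof -
  note i = id_mor_mor[OF A]
  note PA = free_product_graded_algebra[OF A A]
  note p = free_product_mor_properties[OF A A A A i i]
  have "free_product_mor R A A A A (id_mor A) (id_mor A) = id_mor (free_product R A A)"
    by (rule free_product_mor_eqI[OF A A PA p(1) id_mor_mor[OF PA]])
      (simp_all add: p morD(1)[OF incl1_mor[OF A A]] morD(1)[OF incl2_mor[OF A A]])
  then show ?thesis using z by simp
qed

lemma assoc_mor_properties:
  assumes A: "graded_algebra R A"
  defines "P \<equiv> free_product R A A"
  defines "Q \<equiv> free_product R A P"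
  shows "assoc_mor R A \<in> mor R (free_product R P A) Q"
    and "x \<in> carrier A \<Longrightarrow> assoc_mor R A (incl1 R P A (incl1 R A A x)) = incl1 R A P x"
    and "x \<in> carrier A \<Longrightarrow> assoc_mor R A (incl1 R P A (incl2 R A A x)) = incl2 R A P (incl1 R A A x)"
    and "x \<in> carrier A \<Longrightarrow> assoc_mor R A (incl2 R P A x) = incl2 R A P (incl2 R A A x)"
proof -
  have P: "graded_algebra R P" unfolding P_def by (rule free_product_graded_algebra[OF A A])
  have Q: "graded_algebra R Q" unfolding Q_def by (rule free_product_graded_algebra[OF A P])
  have i: "incl1 R A A \<in> mor R A P" "incl2 R A A \<in> mor R A P"
    unfolding P_def by (rule incl1_mor[OF A A], rule incl2_mor[OF A A])
  have j: "incl1 R A P \<in> mor R A Q" "incl2 R A P \<in> mor R P Q"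
    unfolding Q_def by (rule incl1_mor[OF A P], rule incl2_mor[OF A P])
  let ?u = "compose (carrier A) (incl2 R A P) (incl1 R A A)" and ?v = "compose (carrier A) (incl2 R A P) (incl2 R A A)"
  have u: "?u \<in> mor R A Q" and v: "?v \<in> mor R A Q"
    by (rule mor_comp[OF A i(1) j(2)], rule mor_comp[OF A i(2) j(2)])
  note c = copair_properties[OF A A Q j(1) u, folded P_def]
  note d = copair_properties[OF P A Q c(1) v]
  have a: "assoc_mor R A = copair R P A Q (copair R A A Q (incl1 R A P) ?u) ?v"
    by (simp add: assoc_mor_def Let_def P_def Q_def)
  show "assoc_mor R A \<in> mor R (free_product R P A) Q"
    unfolding a by (rule d(1))
  show "assoc_mor R A (incl1 R P A (incl1 R A A x)) = incl1 R A P x" if x: "x \<in> carrier A"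
    unfolding a d(2)[OF morD(1)[OF i(1) x]] by (rule c(2)[OF x])
  show "assoc_mor R A (incl1 R P A (incl2 R A A x)) = incl2 R A P (incl1 R A A x)" if x: "x \<in> carrier A"
    unfolding a d(2)[OF morD(1)[OF i(2) x]] c(3)[OF x] by (rule compose_eq[OF x])
  show "assoc_mor R A (incl2 R P A x) = incl2 R A P (incl2 R A A x)" if x: "x \<in> carrier A"
    unfolding a d(3)[OF x] by (rule compose_eq[OF x])
qed

subsection \<open>The category of cogroups\<close>

lemma is_cogroupD:
  assumes "is_cogroup R A"
  shows "connected_graded_algebra R A" "graded_algebra R A" "comult A \<in> mor R A (free_product R A A)"
    "counital R A"
  using assms connected_is_graded_algebra by (auto simp: is_cogroup_def)

lemma cogroup_mor_iff:
  "f \<in> cogroup_mor R A B \<longleftrightarrow> f \<in> mor R A B \<and>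
    (\<forall>x\<in>carrier A. comult B (f x) = free_product_mor R A A B B f f (comult A x))"
  by (auto simp: cogroup_mor_def compose_def restrict_def fun_eq_iff)

lemma cogroup_mor_mor: "f \<in> cogroup_mor R A B \<Longrightarrow> f \<in> mor R A B"
  by (simp add: cogroup_mor_def)

lemma cogroup_mor_compose:
  assumes "is_cogroup R A" "is_cogroup R B" "is_cogroup R C"
    and f: "f \<in> cogroup_mor R A B" and g: "g \<in> cogroup_mor R B C"
  shows "compose (carrier A) g f \<in> cogroup_mor R A C"
proof -
  note A = is_cogroupD[OF assms(1)] and B = is_cogroupD[OF assms(2)] and C = is_cogroupD[OF assms(3)]
  have f': "f \<in> mor R A B" "\<And>x. x \<in> carrier A \<Longrightarrow> comult B (f x) = free_product_mor R A A B B f f (comult A x)"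
    and g': "g \<in> mor R B C" "\<And>x. x \<in> carrier B \<Longrightarrow> comult C (g x) = free_product_mor R B B C C g g (comult B x)"
    using f g by (auto simp: cogroup_mor_iff)
  show ?thesis
    unfolding cogroup_mor_iff
    using mor_comp[OF A(2) f'(1) g'(1)] free_product_mor_compose[OF A(2) B(2) C(2) f'(1) g'(1)]
    by (auto simp: compose_eq f' g' morD(1)[OF f'(1)] morD(1)[OF A(3)])
qed

lemma id_mor_cogroup_mor:
  assumes "is_cogroup R A"
  shows "id_mor A \<in> cogroup_mor R A A"
  unfolding cogroup_mor_iff
  using is_cogroupD[OF assms] by (auto simp: id_mor_mor free_product_mor_id morD(1))

lemma cogroup_category_is_category: "is_category (cogroup_category R)"
  unfolding is_category_def cogroup_category_def
  by (auto simp: mor_compose_id[OF cogroup_mor_mor] intro: cogroup_mor_compose id_mor_cogroup_mor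
    mor_compose_assoc cogroup_mor_mor)

lemma comm_cogroup_category_is_category: "is_category (comm_cogroup_category R)"
  unfolding comm_cogroup_category_def
  by (rule full_subcategory_is_category[OF cogroup_category_is_category]) auto

lemma comm_cogroup_category_simps [simp]:
  "objects (comm_cogroup_category R) = {A. is_cogroup R A \<and> graded_commutative A}"
  "hom_set (comm_cogroup_category R) = cogroup_mor R"
  "ident (comm_cogroup_category R) = id_mor"
  "comp_mor (comm_cogroup_category R) A B C g f = compose (carrier A) g f"
  by (simp_all add: comm_cogroup_category_def cogroup_category_def)

text \<open>Bijective morphisms of cogroups are isomorphisms as soon as the inverse preserves the algebra
  structure: cancel \<open>f \<star> f\<close> from \<open>\<Phi> f g = (f \<star> f) \<Phi> g\<close> by applying \<open>g \<star> g\<close>.\<close>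

lemma cogroup_mor_inverse:
  assumes "is_cogroup R A" "is_cogroup R B" and f: "f \<in> cogroup_mor R A B" and g: "g \<in> mor R B A"
    and gf: "\<And>x. x \<in> carrier A \<Longrightarrow> g (f x) = x" and fg: "\<And>y. y \<in> carrier B \<Longrightarrow> f (g y) = y"
  shows "g \<in> cogroup_mor R B A"
  unfolding cogroup_mor_iff
proof (intro conjI ballI g)
  note A = is_cogroupD[OF assms(1)] and B = is_cogroupD[OF assms(2)]
  have f': "f \<in> mor R A B" "\<And>x. x \<in> carrier A \<Longrightarrow> comult B (f x) = free_product_mor R A A B B f f (comult A x)"
    using f by (auto simp: cogroup_mor_iff)
  have id: "compose (carrier A) g f = id_mor A"
    using gf by (auto simp: compose_def id_mor_def)
  fix y assume y: "y \<in> carrier B"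
  then have gy: "g y \<in> carrier A" by (rule morD(1)[OF g])
  then have c: "comult A (g y) \<in> carrier (free_product R A A)" by (rule morD(1)[OF A(3)])
  have "comult A (g y) = free_product_mor R A A A A (id_mor A) (id_mor A) (comult A (g y))"
    by (simp add: free_product_mor_id[OF A(2) c])
  also have "\<dots> = free_product_mor R B B A A g g (free_product_mor R A A B B f f (comult A (g y)))"
    using free_product_mor_compose[OF A(2) B(2) A(2) f'(1) g c] by (simp add: id)
  also have "free_product_mor R A A B B f f (comult A (g y)) = comult B y"
    using f'(2)[OF gy] y by (simp add: fg)
  finally show "comult A (g y) = free_product_mor R B B A A g g (comult B y)" .
qed

section \<open>Connected algebras\<close>

text \<open>The same axioms as for a connected graded algebra, stated over the smaller locale so that its theory
  applies.\<close>

locale connected_algebra = graded_algebra R B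
  for R :: "('r, 'c) ring_scheme" and B :: "('r, 'a, 'x) galg_scheme" (structure) +
  assumes grade_direct_sum:
      "x \<in> carrier B \<Longrightarrow>
        \<exists>!c. (\<forall>n. c n \<in> grade B n) \<and> finite {n. c n \<noteq> \<zero>} \<and>
             x = (\<Oplus>n\<in>{n. c n \<noteq> \<zero>}. c n)"
    and connected: "bij_betw (\<lambda>r. r \<odot> \<one>) (carrier R) (grade B 0)"

lemma connected_algebra_iff: "connected_graded_algebra R B \<longleftrightarrow> connected_algebra R B"
proof
  assume c: "connected_graded_algebra R B"
  show "connected_algebra R B"
    by (intro connected_algebra.intro connected_is_graded_algebra[OF c] connected_algebra_axioms.intro
      connected_graded_algebra.grade_direct_sum[OF c] connected_graded_algebra.connected[OF c])
next
  assume "connected_algebra R B"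
  then interpret connected_algebra R B .
  show "connected_graded_algebra R B"
    by (intro connected_graded_algebra.intro connected_graded_algebra_axioms.intro module_axioms ring_axioms
        smult_mult_left smult_mult_right grade_mult grade_submodule grade_direct_sum connected)
qed

definition component :: "('r, 'a, 'x) galg_scheme \<Rightarrow> 'a \<Rightarrow> nat \<Rightarrow> 'a" where
  "component B x = (THE c. (\<forall>n. c n \<in> grade B n) \<and> finite {n. c n \<noteq> \<zero>\<^bsub>B\<^esub>} \<and>
             x = (\<Oplus>\<^bsub>B\<^esub>n\<in>{n. c n \<noteq> \<zero>\<^bsub>B\<^esub>}. c n))"

definition augmentation :: "('r, 'c) ring_scheme \<Rightarrow> ('r, 'a, 'x) galg_scheme \<Rightarrow> 'a \<Rightarrow> 'r" where
  "augmentation R B x = inv_into (carrier R) (\<lambda>r. r \<odot>\<^bsub>B\<^esub> \<one>\<^bsub>B\<^esub>) (component B x 0)"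

context connected_algebra
begin

lemma component_props:
  assumes "x \<in> carrier B"
  shows "component B x n \<in> grade B n" "finite {n. component B x n \<noteq> \<zero>}"
    "x = (\<Oplus>n\<in>{n. component B x n \<noteq> \<zero>}. component B x n)"
  using theI'[OF grade_direct_sum[OF assms]] unfolding component_def[symmetric] by blast+

lemma component_closed: "x \<in> carrier B \<Longrightarrow> component B x n \<in> carrier B"
  by (rule grade_carrier[OF component_props(1)])

lemma sum_support:
  assumes "finite S" "{n. c n \<noteq> \<zero>} \<subseteq> S" "\<And>n. c n \<in> carrier B"
  shows "(\<Oplus>n\<in>S. c n) = (\<Oplus>n\<in>{n. c n \<noteq> \<zero>}. c n)"
  by (rule M.add.finprod_mono_neutral_cong_right) (use assms in auto)

text \<open>The index set \<open>S\<close> may be larger than the support, which is what sums of two families produce.\<close>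

lemma component_unique:
  assumes c: "\<And>n. c n \<in> grade B n" and S: "finite S" "{n. c n \<noteq> \<zero>} \<subseteq> S"
    and x: "x = (\<Oplus>n\<in>S. c n)"
  shows "component B x = c"
proof -
  have cc: "c n \<in> carrier B" for n by (rule grade_carrier[OF c])
  have xc: "x \<in> carrier B" unfolding x by (rule finsum_closed) (use cc in auto)
  have "(\<forall>n. c n \<in> grade B n) \<and> finite {n. c n \<noteq> \<zero>} \<and> x = (\<Oplus>n\<in>{n. c n \<noteq> \<zero>}. c n)"
    using c finite_subset[OF S(2,1)] x sum_support[OF S cc] by simp
  then show ?thesis
    unfolding component_def by (rule the1_equality[OF grade_direct_sum[OF xc]])
qed

lemma component_homogeneous:
  assumes "x \<in> grade B n"
  shows "component B x = (\<lambda>k. if k = n then x else \<zero>)"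
  by (rule component_unique[of _ "{n}"]) (use assms grade_carrier[OF assms] in \<open>auto simp: grade_zero\<close>)

lemma component_add:
  assumes x: "x \<in> carrier B" and y: "y \<in> carrier B"
  shows "component B (x \<oplus> y) n = component B x n \<oplus> component B y n"
proof -
  let ?S = "{n. component B x n \<noteq> \<zero>} \<union> {n. component B y n \<noteq> \<zero>}"
  note cx = component_props[OF x] and cy = component_props[OF y]
  note ccx = component_closed[OF x] and ccy = component_closed[OF y]
  have S: "finite ?S" using cx cy by blast
  have "component B (x \<oplus> y) = (\<lambda>n. component B x n \<oplus> component B y n)"
  proof (rule component_unique[OF _ S])
    have "x \<oplus> y = (\<Oplus>n\<in>?S. component B x n) \<oplus> (\<Oplus>n\<in>?S. component B y n)"
      using cx(3) cy(3) sum_support[OF S, of "component B x"] sum_support[OF S, of "component B y"] ccx ccy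
      by simp
    then show "x \<oplus> y = (\<Oplus>n\<in>?S. component B x n \<oplus> component B y n)"
      by (subst finsum_addf) (use ccx ccy in auto)
  qed (use cx cy in \<open>auto intro!: grade_add\<close>)
  then show ?thesis by simp
qed

lemma homogeneous_induct [consumes 1, case_names homogeneous add]:
  assumes x: "x \<in> carrier B" and h: "\<And>n x. x \<in> grade B n \<Longrightarrow> Q x"
    and a: "\<And>x y. \<lbrakk>x \<in> carrier B; y \<in> carrier B; Q x; Q y\<rbrakk> \<Longrightarrow> Q (x \<oplus> y)"
  shows "Q x"
proof -
  note c = component_props[OF x] and cc = component_closed[OF x]
  have "Q (\<Oplus>n\<in>S. component B x n)" if "finite S" for S
    using that
  proof induction
    case empty
    then show ?case using h[OF grade_zero] by simp
  next
    case (insert n S)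
    then show ?case
      by (subst finsum_insert) (auto intro!: a cc finsum_closed h[OF c(1)])
  qed
  with c(2,3) show ?thesis by metis
qed

lemma component_smult:
  assumes x: "x \<in> carrier B" and r: "r \<in> carrier R"
  shows "component B (r \<odot> x) n = r \<odot> component B x n"
  using x
proof (induction rule: homogeneous_induct)
  case (homogeneous k x)
  then show ?case
    using r by (simp add: component_homogeneous[OF homogeneous] component_homogeneous[OF grade_smult[OF r homogeneous]])
next
  case (add x y)
  then show ?case
    using r by (simp add: smult_r_distr component_add component_closed)
qed

lemma scalar_eq_iff: "\<lbrakk>r \<in> carrier R; s \<in> carrier R\<rbrakk> \<Longrightarrow> r \<odot> \<one> = s \<odot> \<one> \<longleftrightarrow> r = s"
  using connected by (auto simp: bij_betw_def inj_on_def)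

lemma grade_0E:
  assumes "x \<in> grade B 0"
  obtains r where "r \<in> carrier R" "x = r \<odot> \<one>"
  using assms connected by (auto simp: bij_betw_def)

lemma scalar_grade: "r \<in> carrier R \<Longrightarrow> r \<odot> \<one> \<in> grade B 0"
  by (rule grade_smult[OF _ grade_one])

abbreviation "aug \<equiv> augmentation R B"

lemma aug_component: "x \<in> carrier B \<Longrightarrow> aug x \<odot> \<one> = component B x 0"
  unfolding augmentation_def
  by (rule f_inv_into_f[of _ "\<lambda>r. r \<odot> \<one>"])
    (use component_props(1)[of x 0] connected in \<open>auto simp: bij_betw_def\<close>)

lemma aug_closed [simp]: "x \<in> carrier B \<Longrightarrow> aug x \<in> carrier R"
  unfolding augmentation_def
  by (rule inv_into_into) (use component_props(1)[of x 0] connected in \<open>auto simp: bij_betw_def\<close>)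

lemma aug_eqI: "\<lbrakk>x \<in> carrier B; r \<in> carrier R; component B x 0 = r \<odot> \<one>\<rbrakk> \<Longrightarrow> aug x = r"
  using aug_component[of x] scalar_eq_iff[of "aug x" r] by simp

lemma aug_scalar: "r \<in> carrier R \<Longrightarrow> aug (r \<odot> \<one>) = r"
  using component_homogeneous[OF scalar_grade] by (intro aug_eqI) auto

lemma aug_one: "aug \<one> = \<one>\<^bsub>R\<^esub>"
  using aug_scalar[of "\<one>\<^bsub>R\<^esub>"] by simp

lemma aug_positive: "x \<in> grade B n \<Longrightarrow> n > 0 \<Longrightarrow> aug x = \<zero>\<^bsub>R\<^esub>"
  using component_homogeneous[of x n] by (intro aug_eqI) (auto simp: grade_carrier)

lemma aug_add: "\<lbrakk>x \<in> carrier B; y \<in> carrier B\<rbrakk> \<Longrightarrow> aug (x \<oplus> y) = aug x \<oplus>\<^bsub>R\<^esub> aug y"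
  by (rule aug_eqI) (auto simp: component_add smult_l_distr aug_component)

lemma aug_smult: "\<lbrakk>r \<in> carrier R; x \<in> carrier B\<rbrakk> \<Longrightarrow> aug (r \<odot> x) = r \<otimes>\<^bsub>R\<^esub> aug x"
  by (rule aug_eqI) (auto simp: component_smult smult_assoc1 aug_component)

lemma aug_mult:
  assumes "x \<in> carrier B" "y \<in> carrier B"
  shows "aug (x \<otimes> y) = aug x \<otimes>\<^bsub>R\<^esub> aug y"
  using assms
proof (induction x rule: homogeneous_induct)
  case (homogeneous m x)
  from homogeneous(2) show ?case
  proof (induction y rule: homogeneous_induct)
    case (homogeneous n y)
    note x = \<open>x \<in> grade B m\<close> and y = \<open>y \<in> grade B n\<close>
    have c: "x \<in> carrier B" "y \<in> carrier B" using x y grade_carrier by auto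
    show ?case
    proof (cases "m = 0")
      case True
      then obtain r where "r \<in> carrier R" "x = r \<odot> \<one>" using x grade_0E by blast
      then show ?thesis using c by (simp add: smult_one_mult aug_smult aug_one)
    next
      case False
      then show ?thesis
        using aug_positive[OF x] aug_positive[OF grade_mult[OF x y]] c by simp
    qed
  next
    case (add y z)
    then show ?case
      using homogeneous(1) grade_carrier[OF homogeneous(1)] by (simp add: r_distr R.r_distr aug_add)
  qed
next
  case (add x z)
  then show ?case by (simp add: l_distr R.l_distr aug_add)
qed

lemma trivial_mor_exists: 
  assumes C: "graded_algebra R C"
  shows "(\<lambda>x\<in>carrier B. aug x \<odot>\<^bsub>C\<^esub> \<one>\<^bsub>C\<^esub>) \<in> mor R B C"
proof -
  interpret C: graded_algebra R C by (rule C)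
  have pos: "aug x \<odot>\<^bsub>C\<^esub> \<one>\<^bsub>C\<^esub> \<in> grade C n" if "x \<in> grade B n" for x n
    using that aug_positive[OF that] C.grade_zero C.grade_smult[OF aug_closed C.grade_one, of x] grade_carrier
    by (cases "n = 0") auto
  show ?thesis
    by (rule morI) (simp_all add: aug_add aug_mult aug_smult aug_one C.smult_l_distr C.smult_assoc1
      C.smult_one_mult pos grade_carrier)
qed

end

lemma ground_alg_graded_algebra:
  assumes "cring R"
  shows "graded_algebra R (ground_alg R)"
proof -
  interpret R: cring R by fact
  have r: "ring (ground_alg R)"
    by (rule ring_transfer[OF R.ring_axioms]) (simp_all add: ground_alg_def)
  interpret G: ring "ground_alg R" by (rule r)
  have m: "module R (ground_alg R)"
    by (rule moduleI[OF assms G.is_abelian_group])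
      (simp_all add: ground_alg_def R.l_distr R.r_distr R.m_assoc)
  interpret G: module R "ground_alg R" by (rule m)
  have inv: "\<ominus>\<^bsub>ground_alg R\<^esub> x = \<ominus>\<^bsub>R\<^esub> x" if "x \<in> carrier R" for x
    by (rule G.minus_equality) (use that in \<open>simp_all add: ground_alg_def R.l_neg\<close>)
  show ?thesis
  proof (intro graded_algebra.intro graded_algebra_axioms.intro r m)
    show "submodule (grade (ground_alg R) n) R (ground_alg R)" for n
    proof (rule G.submoduleI)
      show "grade (ground_alg R) n \<subseteq> carrier (ground_alg R)"
        by (auto simp: ground_alg_def)
      then show "\<ominus>\<^bsub>ground_alg R\<^esub> x \<in> grade (ground_alg R) n" if "x \<in> grade (ground_alg R) n" for x
        using that inv[of x] by (auto simp: ground_alg_def split: if_splits)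
    qed (auto simp: ground_alg_def split: if_splits)
  qed (auto simp: ground_alg_def R.m_assoc R.m_lcomm split: if_splits)
qed

text \<open>The trivial morphism is the augmentation followed by the unit. Both descriptions in its definition
  are unique: a morphism from \<open>R\<close> is determined by the image of \<open>1\<close>, and one to \<open>R\<close> vanishes in
  positive degrees.\<close>

lemma trivial_mor_eq:
  assumes B: "connected_algebra R B" and C: "graded_algebra R C"
  shows "trivial_mor R B C = (\<lambda>x\<in>carrier B. augmentation R B x \<odot>\<^bsub>C\<^esub> \<one>\<^bsub>C\<^esub>)"
proof -
  interpret B: connected_algebra R B by (rule B)
  interpret C: graded_algebra R C by (rule C)
  let ?G = "ground_alg R"
  note G = ground_alg_graded_algebra[OF B.R.is_cring]
  interpret G: graded_algebra R ?G by (rule G)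
  have gs: "carrier ?G = carrier R" "one ?G = \<one>\<^bsub>R\<^esub>" "smult ?G = mult R" "add ?G = add R" "mult ?G = mult R" "zero ?G = \<zero>\<^bsub>R\<^esub>"
    "n > 0 \<Longrightarrow> grade ?G n = {\<zero>\<^bsub>R\<^esub>}" "grade ?G 0 = carrier R" for n
    by (simp_all add: ground_alg_def)
  have u: "(THE u. u \<in> mor R ?G C) = (\<lambda>r\<in>carrier R. r \<odot>\<^bsub>C\<^esub> \<one>\<^bsub>C\<^esub>)"
  proof (rule the_equality)
    show "(\<lambda>r\<in>carrier R. r \<odot>\<^bsub>C\<^esub> \<one>\<^bsub>C\<^esub>) \<in> mor R ?G C"
    proof (rule morI)
      show "(\<lambda>r\<in>carrier R. r \<odot>\<^bsub>C\<^esub> \<one>\<^bsub>C\<^esub>) x \<in> grade C n" if "x \<in> grade ?G n" for x n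
        using that C.grade_zero C.grade_smult[OF _ C.grade_one, of x] by (cases "n = 0") (auto simp: gs)
    qed (simp_all add: gs C.smult_l_distr C.smult_assoc1 C.smult_one_mult)
    fix u assume u: "u \<in> mor R ?G C"
    show "u = (\<lambda>r\<in>carrier R. r \<odot>\<^bsub>C\<^esub> \<one>\<^bsub>C\<^esub>)"
    proof (rule extensionalityI[of _ "carrier R"])
      fix r assume r: "r \<in> carrier R"
      have "u (r \<odot>\<^bsub>?G\<^esub> \<one>\<^bsub>?G\<^esub>) = r \<odot>\<^bsub>C\<^esub> u \<one>\<^bsub>?G\<^esub>"
        by (rule morD(5)[OF u]) (use r in \<open>simp_all add: gs\<close>)
      then show "u r = (\<lambda>r\<in>carrier R. r \<odot>\<^bsub>C\<^esub> \<one>\<^bsub>C\<^esub>) r"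
        using r morD(4)[OF u] by (simp add: gs)
    qed (use morD(7)[OF u] in \<open>simp_all add: gs\<close>)
  qed
  have e: "(THE e. e \<in> mor R B ?G) = (\<lambda>x\<in>carrier B. augmentation R B x)"
  proof (rule the_equality)
    have "(\<lambda>x\<in>carrier B. augmentation R B x \<odot>\<^bsub>?G\<^esub> \<one>\<^bsub>?G\<^esub>) = (\<lambda>x\<in>carrier B. augmentation R B x)"
      by (rule restrict_ext) (simp add: gs)
    then show "(\<lambda>x\<in>carrier B. augmentation R B x) \<in> mor R B ?G"
      using B.trivial_mor_exists[OF G] by simp
    fix e assume e: "e \<in> mor R B ?G"
    note eD = morD[OF e]
    show "e = (\<lambda>x\<in>carrier B. augmentation R B x)"
    proof (rule extensionalityI[of _ "carrier B"])
      fix x assume "x \<in> carrier B"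
      then have "e x = augmentation R B x"
      proof (induction rule: B.homogeneous_induct)
        case (homogeneous n x)
        show ?case
        proof (cases "n = 0")
          case True
          then obtain r where r: "r \<in> carrier R" "x = r \<odot>\<^bsub>B\<^esub> \<one>\<^bsub>B\<^esub>" using homogeneous B.grade_0E by blast
          then have "e x = r \<odot>\<^bsub>?G\<^esub> e \<one>\<^bsub>B\<^esub>" by (simp add: eD)
          then show ?thesis using r eD(4) by (simp add: gs B.aug_scalar)
        next
          case False
          then show ?thesis using eD(6)[OF homogeneous] B.aug_positive[OF homogeneous] by (simp add: gs)
        qed
      next
        case (add x y)
        then show ?case by (simp add: eD B.aug_add gs)
      qed
      then show "e x = (\<lambda>x\<in>carrier B. augmentation R B x) x" using \<open>x \<in> carrier B\<close> by simp
    qed (use eD(7) in simp_all)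
  qed
  show ?thesis
    unfolding trivial_mor_def u e by (auto simp: compose_def fun_eq_iff)
qed

lemma trivial_mor_mor:
  assumes "connected_algebra R B" "graded_algebra R C"
  shows "trivial_mor R B C \<in> mor R B C"
  unfolding trivial_mor_eq[OF assms] by (rule connected_algebra.trivial_mor_exists[OF assms])

lemma trivial_mor_apply:
  assumes "connected_algebra R B" "graded_algebra R C" "x \<in> carrier B"
  shows "trivial_mor R B C x = augmentation R B x \<odot>\<^bsub>C\<^esub> \<one>\<^bsub>C\<^esub>"
  unfolding trivial_mor_eq[OF assms(1,2)] using assms(3) by simp

section \<open>Endomorphism algebras and linear functionals\<close>

text \<open>Giving every degree the whole algebra makes the universal property of the free product, which is
  stated for graded algebras, apply to arbitrary pairs of representations on \<open>V\<close>.\<close>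

definition endomorphism_algebra :: "('r, 'c) ring_scheme \<Rightarrow> ('r, 'v, 'x) module_scheme \<Rightarrow> ('r, 'v \<Rightarrow> 'v) galg" where
  "endomorphism_algebra R V = (let E = {f \<in> extensional (carrier V) \<inter> (carrier V \<rightarrow> carrier V).
       (\<forall>x\<in>carrier V. \<forall>y\<in>carrier V. f (x \<oplus>\<^bsub>V\<^esub> y) = f x \<oplus>\<^bsub>V\<^esub> f y) \<and>
       (\<forall>r\<in>carrier R. \<forall>x\<in>carrier V. f (r \<odot>\<^bsub>V\<^esub> x) = r \<odot>\<^bsub>V\<^esub> f x)} in
     \<lparr>carrier = E,
      mult = (\<lambda>f g. compose (carrier V) f g),
      one = (\<lambda>x\<in>carrier V. x),
      zero = (\<lambda>x\<in>carrier V. \<zero>\<^bsub>V\<^esub>),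
      add = (\<lambda>f g. \<lambda>x\<in>carrier V. f x \<oplus>\<^bsub>V\<^esub> g x),
      smult = (\<lambda>r f. \<lambda>x\<in>carrier V. r \<odot>\<^bsub>V\<^esub> f x),
      grade = (\<lambda>n. E)\<rparr>)"

lemma (in module) endomorphism_algebra_graded_algebra:
  "graded_algebra R (endomorphism_algebra R M)"
proof -
  let ?E = "endomorphism_algebra R M"
  have simps: "mult ?E = (\<lambda>f g. compose (carrier M) f g)" "one ?E = (\<lambda>x\<in>carrier M. x)"
    "zero ?E = (\<lambda>x\<in>carrier M. \<zero>\<^bsub>M\<^esub>)" "add ?E = (\<lambda>f g. \<lambda>x\<in>carrier M. f x \<oplus>\<^bsub>M\<^esub> g x)"
    "smult ?E = (\<lambda>r f. \<lambda>x\<in>carrier M. r \<odot>\<^bsub>M\<^esub> f x)" "grade ?E = (\<lambda>n. carrier ?E)"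
    by (simp_all add: endomorphism_algebra_def Let_def)
  have mem: "f \<in> carrier ?E \<longleftrightarrow> f \<in> extensional (carrier M) \<and> (\<forall>x\<in>carrier M. f x \<in> carrier M) \<and>
       (\<forall>x\<in>carrier M. \<forall>y\<in>carrier M. f (x \<oplus>\<^bsub>M\<^esub> y) = f x \<oplus>\<^bsub>M\<^esub> f y) \<and>
       (\<forall>r\<in>carrier R. \<forall>x\<in>carrier M. f (r \<odot>\<^bsub>M\<^esub> x) = r \<odot>\<^bsub>M\<^esub> f x)" for f
    by (auto simp: endomorphism_algebra_def Let_def)
  have ext: "f \<in> extensional (carrier M)" and cl: "x \<in> carrier M \<Longrightarrow> f x \<in> carrier M"
    and add: "\<lbrakk>x \<in> carrier M; y \<in> carrier M\<rbrakk> \<Longrightarrow> f (x \<oplus>\<^bsub>M\<^esub> y) = f x \<oplus>\<^bsub>M\<^esub> f y"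
    and smult: "\<lbrakk>r \<in> carrier R; x \<in> carrier M\<rbrakk> \<Longrightarrow> f (r \<odot>\<^bsub>M\<^esub> x) = r \<odot>\<^bsub>M\<^esub> f x"
    if "f \<in> carrier ?E" for f r x y
    using that by (simp_all add: mem)
  note eq = extensionalityI[of _ "carrier M"]
  have add_closed: "f \<oplus>\<^bsub>?E\<^esub> g \<in> carrier ?E" if f: "f \<in> carrier ?E" and g: "g \<in> carrier ?E" for f g
    unfolding mem by (simp add: simps cl[OF f] cl[OF g] add[OF f] add[OF g] smult[OF f] smult[OF g]
      smult_r_distr M.a_ac)
  have smult_closed': "r \<odot>\<^bsub>?E\<^esub> f \<in> carrier ?E" if r: "r \<in> carrier R" and f: "f \<in> carrier ?E" for r f
    unfolding mem using r by (simp add: simps cl[OF f] add[OF f] smult[OF f] smult_r_distr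
      smult_assoc1[symmetric] R.m_comm)
  have zero_closed: "\<zero>\<^bsub>?E\<^esub> \<in> carrier ?E" and one_closed: "\<one>\<^bsub>?E\<^esub> \<in> carrier ?E"
    unfolding mem by (simp_all add: simps)
  have mult_closed: "f \<otimes>\<^bsub>?E\<^esub> g \<in> carrier ?E" if f: "f \<in> carrier ?E" and g: "g \<in> carrier ?E" for f g
    unfolding mem by (simp add: simps compose_eq cl[OF f] cl[OF g] add[OF f] add[OF g] smult[OF f] smult[OF g])
  have ag: "abelian_group ?E"
  proof (rule abelian_groupI)
    fix f assume f: "f \<in> carrier ?E"
    have "(\<ominus>\<^bsub>R\<^esub> \<one>\<^bsub>R\<^esub>) \<odot>\<^bsub>?E\<^esub> f \<oplus>\<^bsub>?E\<^esub> f = \<zero>\<^bsub>?E\<^esub>"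
      by (rule eq) (simp_all add: simps cl[OF f] smult_l_minus M.l_neg)
    moreover have "(\<ominus>\<^bsub>R\<^esub> \<one>\<^bsub>R\<^esub>) \<odot>\<^bsub>?E\<^esub> f \<in> carrier ?E"
      by (rule smult_closed'[OF _ f]) simp
    ultimately show "\<exists>g\<in>carrier ?E. g \<oplus>\<^bsub>?E\<^esub> f = \<zero>\<^bsub>?E\<^esub>" by blast
    show "\<zero>\<^bsub>?E\<^esub> \<oplus>\<^bsub>?E\<^esub> f = f"
      by (rule eq) (simp_all add: simps cl[OF f] ext[OF f])
  next
    fix f g assume f: "f \<in> carrier ?E" and g: "g \<in> carrier ?E"
    show "f \<oplus>\<^bsub>?E\<^esub> g = g \<oplus>\<^bsub>?E\<^esub> f"
      by (rule eq) (simp_all add: simps cl[OF f] cl[OF g] M.a_comm)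
    fix h assume h: "h \<in> carrier ?E"
    show "f \<oplus>\<^bsub>?E\<^esub> g \<oplus>\<^bsub>?E\<^esub> h = f \<oplus>\<^bsub>?E\<^esub> (g \<oplus>\<^bsub>?E\<^esub> h)"
      by (rule eq) (simp_all add: simps cl[OF f] cl[OF g] cl[OF h] M.a_assoc)
  qed (rule add_closed zero_closed, assumption+, rule zero_closed)
  have mon: "monoid ?E"
  proof (rule monoidI)
    fix f assume f: "f \<in> carrier ?E"
    show "\<one>\<^bsub>?E\<^esub> \<otimes>\<^bsub>?E\<^esub> f = f" "f \<otimes>\<^bsub>?E\<^esub> \<one>\<^bsub>?E\<^esub> = f"
      by (rule eq, simp_all add: simps cl[OF f] ext[OF f] compose_eq)+
  next
    fix f g h assume f: "f \<in> carrier ?E" and g: "g \<in> carrier ?E" and h: "h \<in> carrier ?E"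
    show "f \<otimes>\<^bsub>?E\<^esub> g \<otimes>\<^bsub>?E\<^esub> h = f \<otimes>\<^bsub>?E\<^esub> (g \<otimes>\<^bsub>?E\<^esub> h)"
      by (rule eq) (simp_all add: simps cl[OF f] cl[OF g] cl[OF h] compose_eq)
  qed (rule mult_closed one_closed, assumption+, rule one_closed)
  have rng: "ring ?E"
  proof (rule ringI[OF ag mon])
    fix f g h assume f: "f \<in> carrier ?E" and g: "g \<in> carrier ?E" and h: "h \<in> carrier ?E"
    show "(f \<oplus>\<^bsub>?E\<^esub> g) \<otimes>\<^bsub>?E\<^esub> h = f \<otimes>\<^bsub>?E\<^esub> h \<oplus>\<^bsub>?E\<^esub> g \<otimes>\<^bsub>?E\<^esub> h"
      by (rule eq) (simp_all add: simps cl[OF f] cl[OF g] cl[OF h] compose_eq)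
    show "h \<otimes>\<^bsub>?E\<^esub> (f \<oplus>\<^bsub>?E\<^esub> g) = h \<otimes>\<^bsub>?E\<^esub> f \<oplus>\<^bsub>?E\<^esub> h \<otimes>\<^bsub>?E\<^esub> g"
      by (rule eq) (simp_all add: simps cl[OF f] cl[OF g] cl[OF h] compose_eq add[OF h])
  qed
  have mod: "module R ?E"
  proof (rule moduleI[OF R.is_cring ag smult_closed'])
    fix f r s assume r: "r \<in> carrier R" and s: "s \<in> carrier R" and f: "f \<in> carrier ?E"
    show "(r \<oplus>\<^bsub>R\<^esub> s) \<odot>\<^bsub>?E\<^esub> f = r \<odot>\<^bsub>?E\<^esub> f \<oplus>\<^bsub>?E\<^esub> s \<odot>\<^bsub>?E\<^esub> f"
      "r \<otimes>\<^bsub>R\<^esub> s \<odot>\<^bsub>?E\<^esub> f = r \<odot>\<^bsub>?E\<^esub> (s \<odot>\<^bsub>?E\<^esub> f)"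
      by (rule eq, simp_all add: simps r s cl[OF f] smult_l_distr smult_assoc1)+
  next
    fix f g r assume r: "r \<in> carrier R" and f: "f \<in> carrier ?E" and g: "g \<in> carrier ?E"
    show "r \<odot>\<^bsub>?E\<^esub> (f \<oplus>\<^bsub>?E\<^esub> g) = r \<odot>\<^bsub>?E\<^esub> f \<oplus>\<^bsub>?E\<^esub> r \<odot>\<^bsub>?E\<^esub> g"
      by (rule eq, simp_all add: simps r cl[OF f] cl[OF g] smult_r_distr)
  next
    fix f assume f: "f \<in> carrier ?E"
    show "\<one>\<^bsub>R\<^esub> \<odot>\<^bsub>?E\<^esub> f = f"
      by (rule eq, simp_all add: simps cl[OF f] ext[OF f])
  qed
  interpret E: module R ?E by (rule mod)
  show ?thesis
  proof (intro graded_algebra.intro graded_algebra_axioms.intro mod rng)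
    fix f g r assume r: "r \<in> carrier R" and f: "f \<in> carrier ?E" and g: "g \<in> carrier ?E"
    show "(r \<odot>\<^bsub>?E\<^esub> f) \<otimes>\<^bsub>?E\<^esub> g = r \<odot>\<^bsub>?E\<^esub> (f \<otimes>\<^bsub>?E\<^esub> g)"
      "f \<otimes>\<^bsub>?E\<^esub> (r \<odot>\<^bsub>?E\<^esub> g) = r \<odot>\<^bsub>?E\<^esub> (f \<otimes>\<^bsub>?E\<^esub> g)"
      by (rule eq, simp_all add: simps r cl[OF f] cl[OF g] smult[OF f] compose_eq)+
  qed (simp_all add: simps(6) E.carrier_is_submodule mult_closed one_closed)
qed

definition product_module :: "('r, 'v, 'x) module_scheme \<Rightarrow> ('r, 'v \<times> 'v) module" where
  "product_module V = \<lparr>carrier = carrier V \<times> carrier V, mult = undefined, one = undefined,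
     zero = (\<zero>\<^bsub>V\<^esub>, \<zero>\<^bsub>V\<^esub>), add = (\<lambda>(a, b) (c, d). (a \<oplus>\<^bsub>V\<^esub> c, b \<oplus>\<^bsub>V\<^esub> d)),
     smult = (\<lambda>r (a, b). (r \<odot>\<^bsub>V\<^esub> a, r \<odot>\<^bsub>V\<^esub> b))\<rparr>"

lemma product_module_simps [simp]:
  "carrier (product_module V) = carrier V \<times> carrier V"
  "zero (product_module V) = (\<zero>\<^bsub>V\<^esub>, \<zero>\<^bsub>V\<^esub>)"
  "(a, b) \<oplus>\<^bsub>product_module V\<^esub> (c, d) = (a \<oplus>\<^bsub>V\<^esub> c, b \<oplus>\<^bsub>V\<^esub> d)"
  "r \<odot>\<^bsub>product_module V\<^esub> (a, b) = (r \<odot>\<^bsub>V\<^esub> a, r \<odot>\<^bsub>V\<^esub> b)"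
  by (simp_all add: product_module_def)

lemma (in module) product_module_module: "module R (product_module M)"
proof (rule moduleI[OF R.is_cring])
  show "abelian_group (product_module M)"
  proof (rule abelian_groupI)
    fix x assume "x \<in> carrier (product_module M)"
    then obtain a b where x: "x = (a, b)" "a \<in> carrier M" "b \<in> carrier M" by auto
    show "\<exists>y\<in>carrier (product_module M). y \<oplus>\<^bsub>product_module M\<^esub> x = \<zero>\<^bsub>product_module M\<^esub>"
      by (rule bexI[of _ "(\<ominus>\<^bsub>M\<^esub> a, \<ominus>\<^bsub>M\<^esub> b)"]) (simp_all add: x M.l_neg)
  next
    fix x y assume "x \<in> carrier (product_module M)" "y \<in> carrier (product_module M)"
    then obtain a b c d where "x = (a, b)" "y = (c, d)"
      "a \<in> carrier M" "b \<in> carrier M" "c \<in> carrier M" "d \<in> carrier M" by auto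
    then show "x \<oplus>\<^bsub>product_module M\<^esub> y = y \<oplus>\<^bsub>product_module M\<^esub> x"
      by (simp add: M.a_comm)
  next
    fix x y z assume "x \<in> carrier (product_module M)" "y \<in> carrier (product_module M)"
      "z \<in> carrier (product_module M)"
    then obtain a b c d e f where "x = (a, b)" "y = (c, d)" "z = (e, f)"
      "a \<in> carrier M" "b \<in> carrier M" "c \<in> carrier M" "d \<in> carrier M" "e \<in> carrier M" "f \<in> carrier M"
      by auto
    then show "x \<oplus>\<^bsub>product_module M\<^esub> y \<oplus>\<^bsub>product_module M\<^esub> z =
        x \<oplus>\<^bsub>product_module M\<^esub> (y \<oplus>\<^bsub>product_module M\<^esub> z)"
      by (simp add: M.a_assoc)
  qed (auto simp: M.zero_closed)
next
  fix r x y assume r: "r \<in> carrier R" and "x \<in> carrier (product_module M)" "y \<in> carrier (product_module M)"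
  then obtain a b c d where "x = (a, b)" "y = (c, d)"
    "a \<in> carrier M" "b \<in> carrier M" "c \<in> carrier M" "d \<in> carrier M" by auto
  then show "r \<odot>\<^bsub>product_module M\<^esub> (x \<oplus>\<^bsub>product_module M\<^esub> y) =
      r \<odot>\<^bsub>product_module M\<^esub> x \<oplus>\<^bsub>product_module M\<^esub> r \<odot>\<^bsub>product_module M\<^esub> y"
    using r by (simp add: smult_r_distr)
next
  fix r s x assume r: "r \<in> carrier R" "s \<in> carrier R" and "x \<in> carrier (product_module M)"
  then obtain a b where "x = (a, b)" "a \<in> carrier M" "b \<in> carrier M" by auto
  then show "(r \<oplus>\<^bsub>R\<^esub> s) \<odot>\<^bsub>product_module M\<^esub> x =
      r \<odot>\<^bsub>product_module M\<^esub> x \<oplus>\<^bsub>product_module M\<^esub> s \<odot>\<^bsub>product_module M\<^esub> x"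
    "r \<otimes>\<^bsub>R\<^esub> s \<odot>\<^bsub>product_module M\<^esub> x = r \<odot>\<^bsub>product_module M\<^esub> (s \<odot>\<^bsub>product_module M\<^esub> x)"
    using r by (simp_all add: smult_l_distr smult_assoc1)
qed auto

definition linear_functional ::
  "('r, 'c) ring_scheme \<Rightarrow> ('r, 'v, 'x) module_scheme \<Rightarrow> ('v \<Rightarrow> 'r) \<Rightarrow> bool" where
  "linear_functional R M \<beta> \<longleftrightarrow> (\<forall>a\<in>carrier M. \<beta> a \<in> carrier R) \<and>
     (\<forall>a\<in>carrier M. \<forall>b\<in>carrier M. \<beta> (a \<oplus>\<^bsub>M\<^esub> b) = \<beta> a \<oplus>\<^bsub>R\<^esub> \<beta> b) \<and>
     (\<forall>r\<in>carrier R. \<forall>a\<in>carrier M. \<beta> (r \<odot>\<^bsub>M\<^esub> a) = r \<otimes>\<^bsub>R\<^esub> \<beta> a)"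

text \<open>Over a field, Zorn's lemma gives a submodule \<open>N \<supseteq> M'\<close> that is maximal among those avoiding \<open>y\<close>. By
  maximality every element is \<open>n + r y\<close> for some \<open>n \<in> N\<close>, with a unique \<open>r\<close>, and \<open>\<beta>\<close> is this coefficient.\<close>

lemma (in module) linear_functional_exists:
  assumes "field R" and M': "submodule M' R M" and y: "y \<in> carrier M" "y \<notin> M'"
  obtains (functional) \<beta> where "linear_functional R M \<beta>"
    "\<And>a. a \<in> M' \<Longrightarrow> \<beta> a = \<zero>\<^bsub>R\<^esub>" "\<beta> y = \<one>\<^bsub>R\<^esub>"
proof -
  interpret field R by fact
  define \<S> where "\<S> = {N. submodule N R M \<and> M' \<subseteq> N \<and> y \<notin> N}"
  have "\<exists>N\<in>\<S>. \<forall>X\<in>\<S>. N \<subseteq> X \<longrightarrow> X = N"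
  proof (rule subset_Zorn_nonempty)
    show "\<S> \<noteq> {}" using M' y by (auto simp: \<S>_def)
    fix \<N> assume ne: "\<N> \<noteq> {}" and chain: "subset.chain \<S> \<N>"
    have sub: "submodule N R M" if "N \<in> \<N>" for N
      using that chain unfolding subset_chain_def \<S>_def by blast
    note subE = submoduleE[OF sub]
    have "submodule (\<Union>\<N>) R M"
    proof (rule submoduleI)
      show "\<Union>\<N> \<subseteq> carrier M" using subE(1) by blast
      show "\<zero>\<^bsub>M\<^esub> \<in> \<Union>\<N>"
        using ne subgroup.one_closed[OF submodule.axioms(1)[OF sub]] by auto
      show "\<ominus>\<^bsub>M\<^esub> a \<in> \<Union>\<N>" if "a \<in> \<Union>\<N>" for a using that subE(3) by blast
      show "r \<odot>\<^bsub>M\<^esub> a \<in> \<Union>\<N>" if "r \<in> carrier R" "a \<in> \<Union>\<N>" for r a using that subE(4) by blast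
      fix a b assume "a \<in> \<Union>\<N>" "b \<in> \<Union>\<N>"
      then obtain N1 N2 where "N1 \<in> \<N>" "a \<in> N1" "N2 \<in> \<N>" "b \<in> N2" by blast
      moreover have "N1 \<subseteq> N2 \<or> N2 \<subseteq> N1"
        using calculation chain unfolding subset_chain_def by blast
      ultimately obtain N where "N \<in> \<N>" "a \<in> N" "b \<in> N"
        by blast
      then show "a \<oplus>\<^bsub>M\<^esub> b \<in> \<Union>\<N>" using subE(5) by blast
    qed
    moreover have "M' \<subseteq> N \<and> y \<notin> N" if "N \<in> \<N>" for N
      using that chain unfolding subset_chain_def \<S>_def by blast
    ultimately show "\<Union>\<N> \<in> \<S>"
      unfolding \<S>_def using ne by blast
  qed
  then obtain N where NS: "N \<in> \<S>" and maxS: "\<forall>X\<in>\<S>. N \<subseteq> X \<longrightarrow> X = N" ..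
  then have N: "submodule N R M" "M' \<subseteq> N" "y \<notin> N"
    by (simp_all add: \<S>_def)
  have max: "X = N" if "submodule X R M" "M' \<subseteq> X" "y \<notin> X" "N \<subseteq> X" for X
    using maxS[rule_format, of X] that by (simp add: \<S>_def)
  note NE = submoduleE[OF N(1)]
  have N0: "\<zero>\<^bsub>M\<^esub> \<in> N"
    using subgroup.one_closed[OF submodule.axioms(1)[OF N(1)]] by simp
  have Nc: "a \<in> N \<Longrightarrow> a \<in> carrier M" for a using NE(1) by blast
  have ex: "\<exists>r\<in>carrier R. \<exists>n\<in>N. a = n \<oplus>\<^bsub>M\<^esub> r \<odot>\<^bsub>M\<^esub> y" if a: "a \<in> carrier M" for a
  proof (cases "a \<in> N")
    case True
    then have "a = a \<oplus>\<^bsub>M\<^esub> \<zero>\<^bsub>R\<^esub> \<odot>\<^bsub>M\<^esub> y" using a y by simp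
    then show ?thesis using True by blast
  next
    case False
    \<comment> \<open>Adjoining \<open>a\<close> to \<open>N\<close> must capture \<open>y\<close>; solving for \<open>a\<close> gives its decomposition.\<close>
    let ?X = "{n \<oplus>\<^bsub>M\<^esub> s \<odot>\<^bsub>M\<^esub> a |n s. n \<in> N \<and> s \<in> carrier R}"
    have "submodule ?X R M"
    proof (rule submoduleI)
      show "?X \<subseteq> carrier M" using a Nc by auto
      have "\<zero>\<^bsub>M\<^esub> = \<zero>\<^bsub>M\<^esub> \<oplus>\<^bsub>M\<^esub> \<zero>\<^bsub>R\<^esub> \<odot>\<^bsub>M\<^esub> a" using a by simp
      then show "\<zero>\<^bsub>M\<^esub> \<in> ?X" using N0 by blast
      fix u assume "u \<in> ?X"
      then obtain n s where u: "u = n \<oplus>\<^bsub>M\<^esub> s \<odot>\<^bsub>M\<^esub> a" "n \<in> N" "s \<in> carrier R" by blast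
      have "\<ominus>\<^bsub>M\<^esub> u = \<ominus>\<^bsub>M\<^esub> n \<oplus>\<^bsub>M\<^esub> (\<ominus>\<^bsub>R\<^esub> s) \<odot>\<^bsub>M\<^esub> a"
        using u a Nc by (simp add: M.minus_add smult_l_minus)
      then show "\<ominus>\<^bsub>M\<^esub> u \<in> ?X" using u NE(3) by blast
      show "r \<odot>\<^bsub>M\<^esub> u \<in> ?X" if r: "r \<in> carrier R" for r
      proof -
        have "r \<odot>\<^bsub>M\<^esub> u = r \<odot>\<^bsub>M\<^esub> n \<oplus>\<^bsub>M\<^esub> (r \<otimes>\<^bsub>R\<^esub> s) \<odot>\<^bsub>M\<^esub> a"
          using u a Nc r by (simp add: smult_r_distr smult_assoc1)
        then show ?thesis using u NE(4) r by blast
      qed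
      fix v assume "v \<in> ?X"
      then obtain n' s' where v: "v = n' \<oplus>\<^bsub>M\<^esub> s' \<odot>\<^bsub>M\<^esub> a" "n' \<in> N" "s' \<in> carrier R" by blast
      have "u \<oplus>\<^bsub>M\<^esub> v = (n \<oplus>\<^bsub>M\<^esub> n') \<oplus>\<^bsub>M\<^esub> (s \<oplus>\<^bsub>R\<^esub> s') \<odot>\<^bsub>M\<^esub> a"
        using u v a Nc by (simp add: smult_l_distr M.a_ac)
      then show "u \<oplus>\<^bsub>M\<^esub> v \<in> ?X" using u v NE(5) by blast
    qed
    moreover have NX: "N \<subseteq> ?X"
    proof
      fix n assume n: "n \<in> N"
      then have "n = n \<oplus>\<^bsub>M\<^esub> \<zero>\<^bsub>R\<^esub> \<odot>\<^bsub>M\<^esub> a" using a Nc by simp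
      then show "n \<in> ?X" using n by blast
    qed
    moreover have "a \<in> ?X"
    proof -
      have "a = \<zero>\<^bsub>M\<^esub> \<oplus>\<^bsub>M\<^esub> \<one>\<^bsub>R\<^esub> \<odot>\<^bsub>M\<^esub> a" using a by simp
      then show ?thesis using N0 by blast
    qed
    ultimately have "y \<in> ?X"
      using max[of ?X] N(2) False by blast
    then obtain n s where ns: "y = n \<oplus>\<^bsub>M\<^esub> s \<odot>\<^bsub>M\<^esub> a" "n \<in> N" "s \<in> carrier R" by blast
    have "s \<noteq> \<zero>\<^bsub>R\<^esub>"
      using ns N(3) a Nc[OF ns(2)] by auto
    then have s: "inv\<^bsub>R\<^esub> s \<in> carrier R" "inv\<^bsub>R\<^esub> s \<otimes>\<^bsub>R\<^esub> s = \<one>\<^bsub>R\<^esub>"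
      using ns(3) field_Units by auto
    have "inv\<^bsub>R\<^esub> s \<odot>\<^bsub>M\<^esub> y = inv\<^bsub>R\<^esub> s \<odot>\<^bsub>M\<^esub> n \<oplus>\<^bsub>M\<^esub> a"
      using ns s a Nc by (simp add: smult_r_distr smult_assoc1[symmetric])
    then have "a = \<ominus>\<^bsub>M\<^esub> (inv\<^bsub>R\<^esub> s \<odot>\<^bsub>M\<^esub> n) \<oplus>\<^bsub>M\<^esub> inv\<^bsub>R\<^esub> s \<odot>\<^bsub>M\<^esub> y"
      using ns s a Nc by (simp add: M.r_neg1)
    then show ?thesis using s ns NE(3,4) by blast
  qed
  have zero: "r = \<zero>\<^bsub>R\<^esub>" if "r \<in> carrier R" "r \<odot>\<^bsub>M\<^esub> y \<in> N" for r
  proof (rule ccontr)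
    assume "r \<noteq> \<zero>\<^bsub>R\<^esub>"
    then have s: "inv\<^bsub>R\<^esub> r \<in> carrier R" "inv\<^bsub>R\<^esub> r \<otimes>\<^bsub>R\<^esub> r = \<one>\<^bsub>R\<^esub>"
      using that(1) field_Units by auto
    have "inv\<^bsub>R\<^esub> r \<odot>\<^bsub>M\<^esub> (r \<odot>\<^bsub>M\<^esub> y) \<in> N" using NE(4) that(2) s by blast
    then show False using N(3) s that(1) y by (simp add: smult_assoc1[symmetric])
  qed
  have uniq: "r = r'" if "r \<in> carrier R" "r' \<in> carrier R" "n \<in> N" "n' \<in> N"
    "n \<oplus>\<^bsub>M\<^esub> r \<odot>\<^bsub>M\<^esub> y = n' \<oplus>\<^bsub>M\<^esub> r' \<odot>\<^bsub>M\<^esub> y" for r r' n n'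
  proof -
    have c: "n \<in> carrier M" "n' \<in> carrier M" "r \<odot>\<^bsub>M\<^esub> y \<in> carrier M" "r' \<odot>\<^bsub>M\<^esub> y \<in> carrier M"
      using that y Nc by auto
    have "r \<odot>\<^bsub>M\<^esub> y \<ominus>\<^bsub>M\<^esub> r' \<odot>\<^bsub>M\<^esub> y = \<ominus>\<^bsub>M\<^esub> n \<oplus>\<^bsub>M\<^esub> (n \<oplus>\<^bsub>M\<^esub> r \<odot>\<^bsub>M\<^esub> y) \<ominus>\<^bsub>M\<^esub> r' \<odot>\<^bsub>M\<^esub> y"
      using c by (simp add: M.r_neg1)
    also have "\<dots> = \<ominus>\<^bsub>M\<^esub> n \<oplus>\<^bsub>M\<^esub> n'"
      unfolding that(5) using c by (simp add: a_minus_def M.a_assoc M.r_neg)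
    finally have "(r \<ominus>\<^bsub>R\<^esub> r') \<odot>\<^bsub>M\<^esub> y = \<ominus>\<^bsub>M\<^esub> n \<oplus>\<^bsub>M\<^esub> n'"
      using that y by (simp add: a_minus_def smult_l_distr smult_l_minus)
    then have "(r \<ominus>\<^bsub>R\<^esub> r') \<odot>\<^bsub>M\<^esub> y \<in> N" using that NE(3,5) by simp
    then have "r \<ominus>\<^bsub>R\<^esub> r' = \<zero>\<^bsub>R\<^esub>" using that by (intro zero) auto
    then show ?thesis using that by simp
  qed
  define \<beta> where "\<beta> a = (THE r. r \<in> carrier R \<and> (\<exists>n\<in>N. a = n \<oplus>\<^bsub>M\<^esub> r \<odot>\<^bsub>M\<^esub> y))" for a
  have \<beta>I: "\<beta> (n \<oplus>\<^bsub>M\<^esub> r \<odot>\<^bsub>M\<^esub> y) = r" if "r \<in> carrier R" "n \<in> N" for r n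
    unfolding \<beta>_def using that by (intro the_equality) (auto intro: uniq)
  have lin: "linear_functional R M \<beta>"
    unfolding linear_functional_def
  proof (intro conjI ballI)
    show "\<beta> a \<in> carrier R" if "a \<in> carrier M" for a
      using ex[OF that] \<beta>I by auto
    show "\<beta> (a \<oplus>\<^bsub>M\<^esub> b) = \<beta> a \<oplus>\<^bsub>R\<^esub> \<beta> b" if ab: "a \<in> carrier M" "b \<in> carrier M" for a b
    proof -
      obtain r n s k where a: "r \<in> carrier R" "n \<in> N" "a = n \<oplus>\<^bsub>M\<^esub> r \<odot>\<^bsub>M\<^esub> y"
        and b: "s \<in> carrier R" "k \<in> N" "b = k \<oplus>\<^bsub>M\<^esub> s \<odot>\<^bsub>M\<^esub> y"
        using ex[OF ab(1)] ex[OF ab(2)] by blast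
      have "a \<oplus>\<^bsub>M\<^esub> b = (n \<oplus>\<^bsub>M\<^esub> k) \<oplus>\<^bsub>M\<^esub> (r \<oplus>\<^bsub>R\<^esub> s) \<odot>\<^bsub>M\<^esub> y"
        using a b y Nc by (simp add: smult_l_distr M.a_ac)
      then show ?thesis using a b NE(5) by (simp add: \<beta>I)
    qed
    show "\<beta> (r \<odot>\<^bsub>M\<^esub> a) = r \<otimes>\<^bsub>R\<^esub> \<beta> a" if r: "r \<in> carrier R" and a: "a \<in> carrier M" for r a
    proof -
      obtain s n where a: "s \<in> carrier R" "n \<in> N" "a = n \<oplus>\<^bsub>M\<^esub> s \<odot>\<^bsub>M\<^esub> y"
        using ex[OF a] by blast
      have "r \<odot>\<^bsub>M\<^esub> a = r \<odot>\<^bsub>M\<^esub> n \<oplus>\<^bsub>M\<^esub> (r \<otimes>\<^bsub>R\<^esub> s) \<odot>\<^bsub>M\<^esub> y"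
        using a y r Nc by (simp add: smult_r_distr smult_assoc1)
      then show ?thesis using a r NE(4) by (simp add: \<beta>I)
    qed
  qed
  show thesis
  proof (rule functional[OF lin])
    show "\<beta> a = \<zero>\<^bsub>R\<^esub>" if "a \<in> M'" for a
      using \<beta>I[of "\<zero>\<^bsub>R\<^esub>" a] that N(2) Nc y by auto
    show "\<beta> y = \<one>\<^bsub>R\<^esub>"
      using \<beta>I[of "\<one>\<^bsub>R\<^esub>" "\<zero>\<^bsub>M\<^esub>"] N0 y by simp
  qed
qed

lemma endomorphism_algebra_apply:
  assumes "v \<in> carrier V"
  shows "(f \<otimes>\<^bsub>endomorphism_algebra R V\<^esub> g) v = f (g v)" "(f \<oplus>\<^bsub>endomorphism_algebra R V\<^esub> g) v = f v \<oplus>\<^bsub>V\<^esub> g v"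
    "(r \<odot>\<^bsub>endomorphism_algebra R V\<^esub> f) v = r \<odot>\<^bsub>V\<^esub> f v" "\<one>\<^bsub>endomorphism_algebra R V\<^esub> v = v"
    "\<zero>\<^bsub>endomorphism_algebra R V\<^esub> v = \<zero>\<^bsub>V\<^esub>"
  using assms by (simp_all add: endomorphism_algebra_def Let_def compose_eq)

lemma endomorphism_algebra_memI:
  assumes "f \<in> extensional (carrier V)" "\<And>x. x \<in> carrier V \<Longrightarrow> f x \<in> carrier V"
    "\<And>x y. \<lbrakk>x \<in> carrier V; y \<in> carrier V\<rbrakk> \<Longrightarrow> f (x \<oplus>\<^bsub>V\<^esub> y) = f x \<oplus>\<^bsub>V\<^esub> f y"
    "\<And>r x. \<lbrakk>r \<in> carrier R; x \<in> carrier V\<rbrakk> \<Longrightarrow> f (r \<odot>\<^bsub>V\<^esub> x) = r \<odot>\<^bsub>V\<^esub> f x"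
  shows "f \<in> carrier (endomorphism_algebra R V)"
  using assms by (auto simp: endomorphism_algebra_def Let_def)

section \<open>The triangular representations\<close>

text \<open>The action of the first factor on \<open>B \<times> B\<close>: the diagonal action \<open>(\<epsilon>(a)b, ac)\<close> conjugated by the
  automorphism \<open>(b, c) \<mapsto> (b, c + \<beta>(b))\<close>. The conjugation creates the off-diagonal term that detects
  products of letters from different factors.\<close>

definition left_triangular ::
  "('r, 'c) ring_scheme \<Rightarrow> ('r, 'a, 'x) galg_scheme \<Rightarrow> ('a \<Rightarrow> 'r) \<Rightarrow> 'a \<Rightarrow> 'a \<times> 'a \<Rightarrow> 'a \<times> 'a" where
  "left_triangular R B \<beta> = (\<lambda>a\<in>carrier B. \<lambda>(b, c)\<in>carrier B \<times> carrier B.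
     (augmentation R B a \<odot>\<^bsub>B\<^esub> b,
      a \<otimes>\<^bsub>B\<^esub> c \<oplus>\<^bsub>B\<^esub> \<beta> b \<odot>\<^bsub>B\<^esub> (a \<ominus>\<^bsub>B\<^esub> augmentation R B a \<odot>\<^bsub>B\<^esub> \<one>\<^bsub>B\<^esub>)))"

definition right_diagonal ::
  "('r, 'c) ring_scheme \<Rightarrow> ('r, 'a, 'x) galg_scheme \<Rightarrow> 'a \<Rightarrow> 'a \<times> 'a \<Rightarrow> 'a \<times> 'a" where
  "right_diagonal R B = (\<lambda>a\<in>carrier B. \<lambda>(b, c)\<in>carrier B \<times> carrier B.
     (a \<otimes>\<^bsub>B\<^esub> b, augmentation R B a \<odot>\<^bsub>B\<^esub> c))"

context connected_algebra
begin

abbreviation (input) "V \<equiv> product_module B"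
abbreviation (input) "E \<equiv> endomorphism_algebra R (product_module B)"

lemma E_graded_algebra: "graded_algebra R E"
  by (rule module.endomorphism_algebra_graded_algebra[OF product_module_module])

text \<open>The map \<open>a \<mapsto> a - \<epsilon>(a)\<close> is linear and, by \<open>aug_defect_mult\<close> below, a derivation of \<open>B\<close>
  into \<open>B\<close> with right multiplication replaced by multiplication with \<open>\<epsilon>\<close>. This is what makes the triangular action multiplicative.\<close>

lemma aug_defect_add:
  assumes "x \<in> carrier B" "y \<in> carrier B"
  shows "x \<oplus> y \<ominus> aug (x \<oplus> y) \<odot> \<one> =
    (x \<ominus> aug x \<odot> \<one>) \<oplus> (y \<ominus> aug y \<odot> \<one>)"
  using assms by (simp add: aug_add smult_l_distr a_minus_def M.minus_add M.a_ac)

lemma aug_defect_smult: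
  assumes "r \<in> carrier R" "x \<in> carrier B"
  shows "r \<odot> x \<ominus> aug (r \<odot> x) \<odot> \<one> = r \<odot> (x \<ominus> aug x \<odot> \<one>)"
  using assms by (simp add: aug_smult smult_assoc1 a_minus_def smult_r_distr smult_r_minus)

lemma aug_defect_mult:
  assumes "x \<in> carrier B" "y \<in> carrier B"
  shows "x \<otimes> y \<ominus> aug (x \<otimes> y) \<odot> \<one> =
    x \<otimes> (y \<ominus> aug y \<odot> \<one>) \<oplus> aug y \<odot> (x \<ominus> aug x \<odot> \<one>)"
proof -
  have c: "aug x \<in> carrier R" "aug y \<in> carrier R" using assms by auto
  have "x \<otimes> (y \<ominus> aug y \<odot> \<one>) = x \<otimes> y \<ominus> aug y \<odot> x"
    using assms by (simp add: a_minus_def r_distr r_minus smult_mult_right)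
  moreover have "aug y \<odot> (x \<ominus> aug x \<odot> \<one>) = aug y \<odot> x \<ominus> aug (x \<otimes> y) \<odot> \<one>"
    using assms c by (simp add: a_minus_def smult_r_distr smult_r_minus aug_mult smult_assoc1[symmetric] R.m_comm)
  ultimately show ?thesis
    using assms c by (simp add: a_minus_def M.a_assoc M.r_neg1)
qed

lemma right_diagonal_apply:
  "\<lbrakk>a \<in> carrier B; b \<in> carrier B; c \<in> carrier B\<rbrakk> \<Longrightarrow> right_diagonal R B a (b, c) = (a \<otimes> b, aug a \<odot> c)"
  by (simp add: right_diagonal_def)

lemma right_diagonal_mor: "right_diagonal R B \<in> mor R B E"
proof (rule morI)
  fix a assume a: "a \<in> carrier B"
  show cl: "right_diagonal R B a \<in> carrier E"
  proof (rule endomorphism_algebra_memI)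
    show "right_diagonal R B a \<in> extensional (carrier V)"
      using a by (simp add: right_diagonal_def)
  qed (use a in \<open>auto simp: right_diagonal_apply r_distr smult_r_distr smult_mult_right
      smult_assoc1[symmetric] R.m_comm\<close>)
next
  fix a n assume "a \<in> grade B n"
  then have a: "a \<in> carrier B" by (rule grade_carrier)
  have "right_diagonal R B a \<in> carrier E"
  proof (rule endomorphism_algebra_memI)
    show "right_diagonal R B a \<in> extensional (carrier V)"
      using a by (simp add: right_diagonal_def)
  qed (use a in \<open>auto simp: right_diagonal_apply r_distr smult_r_distr smult_mult_right
      smult_assoc1[symmetric] R.m_comm\<close>)
  then show "right_diagonal R B a \<in> grade E n"
    by (simp add: endomorphism_algebra_def Let_def)
next
  fix x y assume xy: "x \<in> carrier B" "y \<in> carrier B"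
  show "right_diagonal R B (x \<oplus> y) = right_diagonal R B x \<oplus>\<^bsub>E\<^esub> right_diagonal R B y"
    by (rule extensionalityI[of _ "carrier V"])
      (use xy in \<open>auto simp: right_diagonal_apply endomorphism_algebra_apply l_distr smult_l_distr aug_add\<close>,
        simp_all add: right_diagonal_def endomorphism_algebra_def Let_def)
  show "right_diagonal R B (x \<otimes> y) = right_diagonal R B x \<otimes>\<^bsub>E\<^esub> right_diagonal R B y"
    by (rule extensionalityI[of _ "carrier V"])
      (use xy in \<open>auto simp: right_diagonal_apply endomorphism_algebra_apply m_assoc smult_assoc1 aug_mult\<close>,
        simp_all add: right_diagonal_def endomorphism_algebra_def Let_def)
next
  show "right_diagonal R B \<one> = \<one>\<^bsub>E\<^esub>"
    by (rule extensionalityI[of _ "carrier V"])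
      (auto simp: right_diagonal_apply endomorphism_algebra_apply aug_one,
        simp_all add: right_diagonal_def endomorphism_algebra_def Let_def)
  fix r x assume rx: "r \<in> carrier R" "x \<in> carrier B"
  show "right_diagonal R B (r \<odot> x) = r \<odot>\<^bsub>E\<^esub> right_diagonal R B x"
    by (rule extensionalityI[of _ "carrier V"])
      (use rx in \<open>auto simp: right_diagonal_apply endomorphism_algebra_apply smult_mult_left smult_assoc1 aug_smult\<close>,
        simp_all add: right_diagonal_def endomorphism_algebra_def Let_def)
qed (simp add: right_diagonal_def)

context
  fixes \<beta> assumes \<beta>: "linear_functional R B \<beta>"
begin

lemma \<beta>_closed: "a \<in> carrier B \<Longrightarrow> \<beta> a \<in> carrier R"
  and \<beta>_add: "\<lbrakk>a \<in> carrier B; b \<in> carrier B\<rbrakk> \<Longrightarrow> \<beta> (a \<oplus> b) = \<beta> a \<oplus>\<^bsub>R\<^esub> \<beta> b"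
  and \<beta>_smult: "\<lbrakk>r \<in> carrier R; a \<in> carrier B\<rbrakk> \<Longrightarrow> \<beta> (r \<odot> a) = r \<otimes>\<^bsub>R\<^esub> \<beta> a"
  using \<beta> by (auto simp: linear_functional_def)

lemma left_triangular_apply:
  "\<lbrakk>a \<in> carrier B; b \<in> carrier B; c \<in> carrier B\<rbrakk> \<Longrightarrow> left_triangular R B \<beta> a (b, c) =
    (aug a \<odot> b, a \<otimes> c \<oplus> \<beta> b \<odot> (a \<ominus> aug a \<odot> \<one>))"
  by (simp add: left_triangular_def)

lemma left_triangular_closed:
  assumes a: "a \<in> carrier B"
  shows "left_triangular R B \<beta> a \<in> carrier E"
proof (rule endomorphism_algebra_memI)
  show "left_triangular R B \<beta> a \<in> extensional (carrier V)"
    using a by (simp add: left_triangular_def)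
  have d: "a \<ominus> aug a \<odot> \<one> \<in> carrier B" using a by simp
  fix x assume "x \<in> carrier V"
  then obtain b c where x: "x = (b, c)" "b \<in> carrier B" "c \<in> carrier B" by auto
  then show "left_triangular R B \<beta> a x \<in> carrier V"
    using a d by (simp add: left_triangular_apply \<beta>_closed)
  show "left_triangular R B \<beta> a (r \<odot>\<^bsub>V\<^esub> x) = r \<odot>\<^bsub>V\<^esub> left_triangular R B \<beta> a x" if r: "r \<in> carrier R" for r
    using a d x r by (simp add: left_triangular_apply \<beta>_closed \<beta>_smult smult_r_distr smult_mult_right
      smult_assoc1) (simp add: smult_assoc1[symmetric] R.m_comm)
  fix y assume "y \<in> carrier V"
  then obtain e f where y: "y = (e, f)" "e \<in> carrier B" "f \<in> carrier B" by auto
  show "left_triangular R B \<beta> a (x \<oplus>\<^bsub>V\<^esub> y) = left_triangular R B \<beta> a x \<oplus>\<^bsub>V\<^esub> left_triangular R B \<beta> a y"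
    using a d x y by (simp add: left_triangular_apply \<beta>_closed \<beta>_add r_distr smult_r_distr smult_l_distr M.a_ac)
qed

lemma left_triangular_mor: "left_triangular R B \<beta> \<in> mor R B E"
proof (rule morI)
  fix a n assume "a \<in> grade B n"
  then show "left_triangular R B \<beta> a \<in> grade E n"
    using left_triangular_closed[OF grade_carrier] by (simp add: endomorphism_algebra_def Let_def)
next
  fix x y assume xy: "x \<in> carrier B" "y \<in> carrier B"
  have d: "x \<ominus> aug x \<odot> \<one> \<in> carrier B" "y \<ominus> aug y \<odot> \<one> \<in> carrier B" using xy by auto
  show "left_triangular R B \<beta> (x \<oplus> y) = left_triangular R B \<beta> x \<oplus>\<^bsub>E\<^esub> left_triangular R B \<beta> y"
  proof (rule extensionalityI[of _ "carrier V"])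
    fix v assume "v \<in> carrier V"
    then obtain b c where v: "v = (b, c)" "b \<in> carrier B" "c \<in> carrier B" by auto
    show "left_triangular R B \<beta> (x \<oplus> y) v = (left_triangular R B \<beta> x \<oplus>\<^bsub>E\<^esub> left_triangular R B \<beta> y) v"
      using xy v d
      by (simp add: left_triangular_apply endomorphism_algebra_apply aug_defect_add \<beta>_closed)
        (simp add: aug_add \<beta>_closed l_distr smult_l_distr smult_r_distr M.a_ac)
  qed (use xy in \<open>simp_all add: left_triangular_def endomorphism_algebra_def Let_def\<close>)
  show "left_triangular R B \<beta> (x \<otimes> y) = left_triangular R B \<beta> x \<otimes>\<^bsub>E\<^esub> left_triangular R B \<beta> y"
  proof (rule extensionalityI[of _ "carrier V"])
    fix v assume "v \<in> carrier V"
    then obtain b c where v: "v = (b, c)" "b \<in> carrier B" "c \<in> carrier B" by auto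
    have k: "\<beta> b \<in> carrier R" "aug y \<in> carrier R" using v xy by (auto simp: \<beta>_closed)
    show "left_triangular R B \<beta> (x \<otimes> y) v = (left_triangular R B \<beta> x \<otimes>\<^bsub>E\<^esub> left_triangular R B \<beta> y) v"
      using xy v d k
      by (simp add: left_triangular_apply endomorphism_algebra_apply aug_defect_mult \<beta>_smult)
        (simp add: aug_mult r_distr smult_r_distr smult_mult_right smult_assoc1[symmetric] M.a_assoc m_assoc R.m_comm)
  qed (use xy in \<open>simp_all add: left_triangular_def endomorphism_algebra_def Let_def\<close>)
next
  show "left_triangular R B \<beta> \<one> = \<one>\<^bsub>E\<^esub>"
    by (rule extensionalityI[of _ "carrier V"])
      (auto simp: left_triangular_apply endomorphism_algebra_apply aug_one \<beta>_closed M.r_neg a_minus_def,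
        simp_all add: left_triangular_def endomorphism_algebra_def Let_def)
  fix r x assume rx: "r \<in> carrier R" "x \<in> carrier B"
  have d: "x \<ominus> aug x \<odot> \<one> \<in> carrier B" using rx by auto
  show "left_triangular R B \<beta> (r \<odot> x) = r \<odot>\<^bsub>E\<^esub> left_triangular R B \<beta> x"
  proof (rule extensionalityI[of _ "carrier V"])
    fix v assume "v \<in> carrier V"
    then obtain b c where v: "v = (b, c)" "b \<in> carrier B" "c \<in> carrier B" by auto
    have k: "\<beta> b \<in> carrier R" using v by (auto simp: \<beta>_closed)
    show "left_triangular R B \<beta> (r \<odot> x) v = (r \<odot>\<^bsub>E\<^esub> left_triangular R B \<beta> x) v"
      using rx v d k
      by (simp add: left_triangular_apply endomorphism_algebra_apply aug_defect_smult)
        (simp add: aug_smult smult_r_distr smult_mult_left smult_assoc1[symmetric] R.m_comm)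
  qed (use rx in \<open>simp_all add: left_triangular_def endomorphism_algebra_def Let_def\<close>)
qed (simp_all add: left_triangular_closed, simp add: left_triangular_def)

definition triangular_action where "triangular_action = copair R B B E (left_triangular R B \<beta>) (right_diagonal R B)"

lemma triangular_action_mor: "triangular_action \<in> mor R (free_product R B B) E"
  and triangular_action_incl1: "a \<in> carrier B \<Longrightarrow> triangular_action (incl1 R B B a) = left_triangular R B \<beta> a"
  and triangular_action_incl2: "a \<in> carrier B \<Longrightarrow> triangular_action (incl2 R B B a) = right_diagonal R B a"
  using copair_properties[OF graded_algebra_axioms graded_algebra_axioms E_graded_algebra
    left_triangular_mor right_diagonal_mor] unfolding triangular_action_def by auto

end

end

section \<open>Structure of cogroups\<close>

text \<open>In a word of degree \<open>m\<close> either all letters have degree less than \<open>m\<close>, or one letter has degree \<open>m\<close> and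
  the others have degree \<open>0\<close>, that is, are scalars. So modulo a subalgebra that contains all letters of
  degree less than \<open>m\<close>, an element of degree \<open>m\<close> is \<open>u' + v''\<close>.\<close>

lemma (in connected_algebra) free_product_low_degree:
  assumes S: "submodule S R (free_product R B B)" "\<one>\<^bsub>free_product R B B\<^esub> \<in> S"
    and mult: "\<And>s t. \<lbrakk>s \<in> S; t \<in> S\<rbrakk> \<Longrightarrow> s \<otimes>\<^bsub>free_product R B B\<^esub> t \<in> S"
    and low: "\<And>j b. \<lbrakk>j < m; b \<in> grade B j\<rbrakk> \<Longrightarrow> incl1 R B B b \<in> S \<and> incl2 R B B b \<in> S"
    and m: "m > 0" and z: "z \<in> grade (free_product R B B) m"
  obtains u v s where "u \<in> grade B m" "v \<in> grade B m" "s \<in> S"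
    "z = incl1 R B B u \<oplus>\<^bsub>free_product R B B\<^esub> incl2 R B B v \<oplus>\<^bsub>free_product R B B\<^esub> s"
proof -
  let ?P = "free_product R B B"
  note B = graded_algebra_axioms
  interpret P: graded_algebra R ?P by (rule free_product_graded_algebra[OF B B])
  note i1 = morD[OF incl1_mor[OF B B]] and i2 = morD[OF incl2_mor[OF B B]]
  note SE = P.submoduleE[OF S(1)]
  have Sz: "\<zero>\<^bsub>?P\<^esub> \<in> S" using subgroup.one_closed[OF submodule.axioms(1)[OF S(1)]] by simp
  have Sc: "s \<in> S \<Longrightarrow> s \<in> carrier ?P" for s using SE(1) by blast
  note gc = grade_carrier
  \<comment> \<open>The elements of the desired form; they are a submodule, so it is enough to treat words.\<close>
  define T where "T = {z. \<exists>u\<in>grade B m. \<exists>v\<in>grade B m. \<exists>s\<in>S. z = incl1 R B B u \<oplus>\<^bsub>?P\<^esub> incl2 R B B v \<oplus>\<^bsub>?P\<^esub> s}"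
  have TI: "incl1 R B B u \<oplus>\<^bsub>?P\<^esub> incl2 R B B v \<oplus>\<^bsub>?P\<^esub> s \<in> T" if "u \<in> grade B m" "v \<in> grade B m" "s \<in> S" for u v s
    using that by (auto simp: T_def)
  have z1: "incl1 R B B \<zero> = \<zero>\<^bsub>?P\<^esub>" and z2: "incl2 R B B \<zero> = \<zero>\<^bsub>?P\<^esub>"
    by (rule mor_zero[OF incl1_mor[OF B B] B P.graded_algebra_axioms],
        rule mor_zero[OF incl2_mor[OF B B] B P.graded_algebra_axioms])
  have ST: "s \<in> T" if "s \<in> S" for s
    using TI[OF grade_zero grade_zero that] Sc[OF that] by (simp add: z1 z2)
  have T1: "incl1 R B B u \<in> T" if "u \<in> grade B m" for u
    using TI[OF that grade_zero Sz] i1(1)[OF gc[OF that]] by (simp add: z2)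
  have T2: "incl2 R B B u \<in> T" if "u \<in> grade B m" for u
    using TI[OF grade_zero that Sz] i2(1)[OF gc[OF that]] by (simp add: z1)
  have Tsmult: "r \<odot>\<^bsub>?P\<^esub> t \<in> T" if r: "r \<in> carrier R" and t: "t \<in> T" for r t
  proof -
    obtain u v s where t: "u \<in> grade B m" "v \<in> grade B m" "s \<in> S" "t = incl1 R B B u \<oplus>\<^bsub>?P\<^esub> incl2 R B B v \<oplus>\<^bsub>?P\<^esub> s"
      using t by (auto simp: T_def)
    have "r \<odot>\<^bsub>?P\<^esub> t = incl1 R B B (r \<odot> u) \<oplus>\<^bsub>?P\<^esub> incl2 R B B (r \<odot> v) \<oplus>\<^bsub>?P\<^esub> r \<odot>\<^bsub>?P\<^esub> s"
      using r t gc[OF t(1)] gc[OF t(2)] Sc[OF t(3)] by (simp add: i1 i2 P.smult_r_distr)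
    then show ?thesis using TI[OF grade_smult[OF r t(1)] grade_smult[OF r t(2)] SE(4)[OF r t(3)]] by simp
  qed
  have Tadd: "t \<oplus>\<^bsub>?P\<^esub> t' \<in> T" if t: "t \<in> T" and t': "t' \<in> T" for t t'
  proof -
    obtain u v s where t: "u \<in> grade B m" "v \<in> grade B m" "s \<in> S" "t = incl1 R B B u \<oplus>\<^bsub>?P\<^esub> incl2 R B B v \<oplus>\<^bsub>?P\<^esub> s"
      using t by (auto simp: T_def)
    obtain u' v' s' where t': "u' \<in> grade B m" "v' \<in> grade B m" "s' \<in> S" "t' = incl1 R B B u' \<oplus>\<^bsub>?P\<^esub> incl2 R B B v' \<oplus>\<^bsub>?P\<^esub> s'"
      using t' by (auto simp: T_def)
    have "t \<oplus>\<^bsub>?P\<^esub> t' = incl1 R B B (u \<oplus> u') \<oplus>\<^bsub>?P\<^esub> incl2 R B B (v \<oplus> v') \<oplus>\<^bsub>?P\<^esub> (s \<oplus>\<^bsub>?P\<^esub> s')"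
      using t t' gc[OF t(1)] gc[OF t(2)] Sc[OF t(3)] gc[OF t'(1)] gc[OF t'(2)] Sc[OF t'(3)]
      by (simp add: i1 i2 P.M.a_ac)
    then show ?thesis using TI[OF grade_add[OF t(1) t'(1)] grade_add[OF t(2) t'(2)] SE(5)[OF t(3) t'(3)]] by simp
  qed
  have Tc: "t \<in> carrier ?P" if "t \<in> T" for t
    using that by (auto simp: T_def i1 i2 gc Sc)
  have Tsub: "submodule T R ?P"
  proof (rule P.submoduleI)
    show "T \<subseteq> carrier ?P" using Tc by blast
    show "\<zero>\<^bsub>?P\<^esub> \<in> T" by (rule ST[OF Sz])
    show "\<ominus>\<^bsub>?P\<^esub> t \<in> T" if "t \<in> T" for t
      using Tsmult[of "\<ominus>\<^bsub>R\<^esub> \<one>\<^bsub>R\<^esub>" t] Tc[OF that] that by (simp add: P.uminus_eq_smult)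
  qed (simp_all add: Tsmult Tadd)
  let ?incl = "case_sum (incl1 R B B) (incl2 R B B)"
  have letter_scalar: "\<exists>r\<in>carrier R. ?incl l = r \<odot>\<^bsub>?P\<^esub> \<one>\<^bsub>?P\<^esub>" if "l \<in> Sum_Type.Plus (grade B 0) (grade B 0)" for l
  proof -
    obtain b where b: "b \<in> grade B 0" "l = Inl b \<or> l = Inr b" using \<open>l \<in> _\<close> by blast
    then obtain r where "r \<in> carrier R" "b = r \<odot> \<one>" using grade_0E by blast
    then show ?thesis using b(2) by (auto simp: i1 i2)
  qed
  have letter_T: "?incl l \<in> T" if "l \<in> Sum_Type.Plus (grade B m) (grade B m)" for l
    using that T1 T2 by auto
  have letter_S: "?incl l \<in> S" if "l \<in> Sum_Type.Plus (grade B d) (grade B d)" "d < m" for l d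
    using that low by auto
  \<comment> \<open>Three claims at once: the induction over words meets factors of degree \<open>0\<close>, below \<open>m\<close>, and \<open>m\<close>.\<close>
  have word: "(k = 0 \<longrightarrow> (\<exists>r\<in>carrier R. coset_map R B B (word R w) = r \<odot>\<^bsub>?P\<^esub> \<one>\<^bsub>?P\<^esub>)) \<and>
      (k < m \<longrightarrow> coset_map R B B (word R w) \<in> S) \<and> (k = m \<longrightarrow> coset_map R B B (word R w) \<in> T)"
    if "w \<in> lists (Sum_Type.Plus (carrier B) (carrier B))" "letters_degree (\<lambda>l d. l \<in> Sum_Type.Plus (grade B d) (grade B d)) w k" for w k
    using that
  proof (induction w arbitrary: k)
    case Nil
    have "\<exists>r\<in>carrier R. \<one>\<^bsub>?P\<^esub> = r \<odot>\<^bsub>?P\<^esub> \<one>\<^bsub>?P\<^esub>"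
      by (rule bexI[of _ "\<one>\<^bsub>R\<^esub>"]) simp_all
    then show ?case
      using Nil m S(2) by (auto simp: coset_map_word_Nil[OF B B])
  next
    case (Cons l w)
    then obtain d j where d: "l \<in> Sum_Type.Plus (grade B d) (grade B d)"
      "letters_degree (\<lambda>l d. l \<in> Sum_Type.Plus (grade B d) (grade B d)) w j" "k = d + j"
      by (auto simp: letters_degree_Cons)
    have l: "l \<in> Sum_Type.Plus (carrier B) (carrier B)" and w: "w \<in> lists (Sum_Type.Plus (carrier B) (carrier B))" using Cons by auto
    note IH = Cons.IH[OF d(2)]
    let ?a = "?incl l" and ?c = "coset_map R B B (word R w)"
    have eq: "coset_map R B B (word R (l # w)) = ?a \<otimes>\<^bsub>?P\<^esub> ?c"
      by (rule coset_map_word_Cons[OF B B l w])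
    have ac: "?a \<in> carrier ?P" using l i1(1) i2(1) by auto
    have cases: "(d = 0 \<longrightarrow> (\<exists>r\<in>carrier R. ?a = r \<odot>\<^bsub>?P\<^esub> \<one>\<^bsub>?P\<^esub>))" "(d < m \<longrightarrow> ?a \<in> S)" "(d = m \<longrightarrow> ?a \<in> T)"
      using letter_scalar[of l] letter_S[of l d] letter_T[of l] d(1) by blast+
    show ?case
      unfolding eq
    proof (intro conjI impI)
      assume "k = 0"
      then obtain r s where "r \<in> carrier R" "?a = r \<odot>\<^bsub>?P\<^esub> \<one>\<^bsub>?P\<^esub>" "s \<in> carrier R" "?c = s \<odot>\<^bsub>?P\<^esub> \<one>\<^bsub>?P\<^esub>"
        using cases(1) IH d(3) by auto
      then have "?a \<otimes>\<^bsub>?P\<^esub> ?c = (r \<otimes>\<^bsub>R\<^esub> s) \<odot>\<^bsub>?P\<^esub> \<one>\<^bsub>?P\<^esub>" by (simp add: P.smult_one_mult P.smult_assoc1)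
      then show "\<exists>r\<in>carrier R. ?a \<otimes>\<^bsub>?P\<^esub> ?c = r \<odot>\<^bsub>?P\<^esub> \<one>\<^bsub>?P\<^esub>"
        using \<open>r \<in> _\<close> \<open>s \<in> _\<close> by (intro bexI[of _ "r \<otimes>\<^bsub>R\<^esub> s"]) auto
    next
      assume "k < m"
      then show "?a \<otimes>\<^bsub>?P\<^esub> ?c \<in> S" using cases(2) IH d(3) mult by simp
    next
      assume k: "k = m"
      consider "d = m" "j = 0" | "d = 0" "j = m" | "d < m" "j < m" using k d(3) by linarith
      then show "?a \<otimes>\<^bsub>?P\<^esub> ?c \<in> T"
      proof cases
        case 1
        then obtain r where "r \<in> carrier R" "?c = r \<odot>\<^bsub>?P\<^esub> \<one>\<^bsub>?P\<^esub>" using IH by blast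
        then show ?thesis using cases(3) 1 Tsmult ac by (simp add: P.mult_smult_one)
      next
        case 2
        then obtain r where "r \<in> carrier R" "?a = r \<odot>\<^bsub>?P\<^esub> \<one>\<^bsub>?P\<^esub>" using cases by blast
        then show ?thesis using IH 2 Tsmult Tc[of ?c] by (simp add: P.smult_one_mult)
      next
        case 3
        then show ?thesis using cases IH mult ST by simp
      qed
    qed
  qed
  have "z \<in> T"
    by (rule free_product_homogeneous_span[OF B B z Tsub]) (use word in blast)
  then show thesis using that by (auto simp: T_def)
qed

text \<open>The comultiplication is a parameter here, so that the theory below does not depend on the record type
  of cogroups.\<close>

locale counital_algebra = connected_algebra R B
  for R :: "('r, 'c) ring_scheme" and B :: "('r, 'a, 'x) galg_scheme" (structure) +
  fixes \<Phi> :: "'a \<Rightarrow> (('a + 'a) list \<Rightarrow> 'r) set"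
  assumes K: "field R"
    and comult_mor: "\<Phi> \<in> mor R B (free_product R B B)"
    and counit1: "a \<in> carrier B \<Longrightarrow> copair R B B B (id_mor B) (trivial_mor R B B) (\<Phi> a) = a"
    and counit2: "a \<in> carrier B \<Longrightarrow> copair R B B B (trivial_mor R B B) (id_mor B) (\<Phi> a) = a"

lemma cogroup_counital_algebra:
  assumes "field R" "is_cogroup R A"
  shows "counital_algebra R A (comult A)"
proof -
  note A = is_cogroupD[OF assms(2)]
  show ?thesis
  proof (intro counital_algebra.intro counital_algebra_axioms.intro assms(1) A(3))
    show "connected_algebra R A" using A(1) by (simp add: connected_algebra_iff)
    note c = A(4)[unfolded counital_def]
    show "copair R A A A (id_mor A) (trivial_mor R A A) (comult A a) = a" if "a \<in> carrier A" for a
      using fun_cong[OF conjunct1[OF c], of a] that by (simp add: compose_eq)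
    show "copair R A A A (trivial_mor R A A) (id_mor A) (comult A a) = a" if "a \<in> carrier A" for a
      using fun_cong[OF conjunct2[OF c], of a] that by (simp add: compose_eq)
  qed
qed

context counital_algebra
begin

abbreviation (input) "P \<equiv> free_product R B B"

abbreviation "fold1 \<equiv> copair R B B B (id_mor B) (trivial_mor R B B)"
abbreviation "fold2 \<equiv> copair R B B B (trivial_mor R B B) (id_mor B)"

lemma P_graded_algebra: "graded_algebra R P"
  by (rule free_product_graded_algebra[OF graded_algebra_axioms graded_algebra_axioms])

lemmas i1 = incl1_mor[OF graded_algebra_axioms graded_algebra_axioms]
lemmas i2 = incl2_mor[OF graded_algebra_axioms graded_algebra_axioms]

lemma triv: "trivial_mor R B B \<in> mor R B B" "a \<in> carrier B \<Longrightarrow> trivial_mor R B B a = aug a \<odot> \<one>"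
  by (rule trivial_mor_mor[OF connected_algebra_axioms graded_algebra_axioms])
    (rule trivial_mor_apply[OF connected_algebra_axioms graded_algebra_axioms])

lemma fold1: "fold1 \<in> mor R P B" "a \<in> carrier B \<Longrightarrow> fold1 (incl1 R B B a) = a"
  "a \<in> carrier B \<Longrightarrow> fold1 (incl2 R B B a) = aug a \<odot> \<one>"
  using copair_properties[OF graded_algebra_axioms graded_algebra_axioms graded_algebra_axioms
    id_mor_mor[OF graded_algebra_axioms] triv(1)] by (simp_all add: triv(2))

lemma fold2: "fold2 \<in> mor R P B" "a \<in> carrier B \<Longrightarrow> fold2 (incl1 R B B a) = aug a \<odot> \<one>"
  "a \<in> carrier B \<Longrightarrow> fold2 (incl2 R B B a) = a"
  using copair_properties[OF graded_algebra_axioms graded_algebra_axioms graded_algebra_axioms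
    triv(1) id_mor_mor[OF graded_algebra_axioms]] by (simp_all add: triv(2))

lemma smult_cancel_nonzero:
  assumes x: "x \<in> carrier B" "x \<noteq> \<zero>" and rs: "r \<in> carrier R" "s \<in> carrier R"
    and eq: "r \<odot> x = s \<odot> x"
  shows "r = s"
proof (rule ccontr)
  interpret field R by (rule K)
  assume "r \<noteq> s"
  then have d: "r \<ominus>\<^bsub>R\<^esub> s \<in> carrier R" "r \<ominus>\<^bsub>R\<^esub> s \<noteq> \<zero>\<^bsub>R\<^esub>" using rs by auto
  then have i: "inv\<^bsub>R\<^esub> (r \<ominus>\<^bsub>R\<^esub> s) \<in> carrier R" "inv\<^bsub>R\<^esub> (r \<ominus>\<^bsub>R\<^esub> s) \<otimes>\<^bsub>R\<^esub> (r \<ominus>\<^bsub>R\<^esub> s) = \<one>\<^bsub>R\<^esub>"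
    using field_Units by auto
  have "(r \<ominus>\<^bsub>R\<^esub> s) \<odot> x = \<zero>"
    using eq rs x by (simp add: a_minus_def smult_l_distr smult_l_minus M.r_neg)
  then have "inv\<^bsub>R\<^esub> (r \<ominus>\<^bsub>R\<^esub> s) \<odot> ((r \<ominus>\<^bsub>R\<^esub> s) \<odot> x) = \<zero>" using i by simp
  then have "x = \<zero>" using i d x by (simp add: smult_assoc1[symmetric])
  then show False using x by simp
qed

definition primitive :: "'a \<Rightarrow> bool" where
  "primitive x \<longleftrightarrow> x \<in> carrier B \<and> \<Phi> x = incl1 R B B x \<oplus>\<^bsub>P\<^esub> incl2 R B B x"

text \<open>The scalars contain all letters of degree less than \<open>n\<close>, so \<open>\<Phi>(x) = u' + v'' + r\<close> by
  \<open>free_product_low_degree\<close>. The two halves of the counit law give \<open>x = u + r = v + r\<close>, whence \<open>r = 0\<close> by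
  degree.\<close>

lemma lowest_degree_primitive:
  assumes n: "n > 0" and x: "x \<in> grade B n" and low: "\<And>j. \<lbrakk>0 < j; j < n\<rbrakk> \<Longrightarrow> grade B j \<subseteq> {\<zero>}"
  shows "primitive x"
proof -
  interpret P: graded_algebra R P by (rule P_graded_algebra)
  have z: "incl1 R B B \<zero> = \<zero>\<^bsub>P\<^esub>" "incl2 R B B \<zero> = \<zero>\<^bsub>P\<^esub>"
    by (rule mor_zero[OF i1 graded_algebra_axioms P_graded_algebra],
      rule mor_zero[OF i2 graded_algebra_axioms P_graded_algebra])
  note i1 = morD[OF i1] and i2 = morD[OF i2]
  note f1 = morD[OF fold1(1)] and f2 = morD[OF fold2(1)]
  let ?S = "{r \<odot>\<^bsub>P\<^esub> \<one>\<^bsub>P\<^esub> |r. r \<in> carrier R}"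
  have xc: "x \<in> carrier B" using x by (rule grade_carrier)
  have SI: "r \<in> carrier R \<Longrightarrow> r \<odot>\<^bsub>P\<^esub> \<one>\<^bsub>P\<^esub> \<in> ?S" for r by blast
  have one: "\<one>\<^bsub>P\<^esub> \<in> ?S" using SI[of "\<one>\<^bsub>R\<^esub>"] by simp
  have zero: "\<zero>\<^bsub>P\<^esub> \<in> ?S" using SI[of "\<zero>\<^bsub>R\<^esub>"] by simp
  have sub: "submodule ?S R P"
  proof (rule P.submoduleI)
    show "\<ominus>\<^bsub>P\<^esub> a \<in> ?S" if "a \<in> ?S" for a
      using that SI[OF R.a_inv_closed] by (auto simp: P.smult_l_minus[symmetric])
    show "a \<oplus>\<^bsub>P\<^esub> b \<in> ?S" if "a \<in> ?S" "b \<in> ?S" for a b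
      using that SI[OF R.a_closed] by (auto simp: P.smult_l_distr[symmetric])
    show "r \<odot>\<^bsub>P\<^esub> a \<in> ?S" if "r \<in> carrier R" "a \<in> ?S" for r a
      using that SI[OF R.m_closed] by (auto simp: P.smult_assoc1[symmetric])
  qed (use zero in auto)
  have mult: "s \<otimes>\<^bsub>P\<^esub> t \<in> ?S" if "s \<in> ?S" "t \<in> ?S" for s t
    using that SI[OF R.m_closed] by (auto simp: P.smult_one_mult P.smult_assoc1[symmetric])
  have lowS: "incl1 R B B b \<in> ?S \<and> incl2 R B B b \<in> ?S" if "j < n" "b \<in> grade B j" for j b
  proof (cases "j = 0")
    case True
    then obtain r where r: "r \<in> carrier R" "b = r \<odot> \<one>" using \<open>b \<in> grade B j\<close> grade_0E by blast
    then show ?thesis using SI[of r] by (simp add: i1 i2)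
  next
    case False
    then have "b = \<zero>" using low[of j] that by auto
    then show ?thesis
      using zero z by simp
  qed
  have Px: "\<Phi> x \<in> grade P n" by (rule morD(6)[OF comult_mor x])
  obtain u v s where uv: "u \<in> grade B n" "v \<in> grade B n" and s: "s \<in> ?S"
    and eq: "\<Phi> x = incl1 R B B u \<oplus>\<^bsub>P\<^esub> incl2 R B B v \<oplus>\<^bsub>P\<^esub> s"
    by (rule free_product_low_degree[OF sub one mult lowS n Px])
  obtain r where r: "r \<in> carrier R" "s = r \<odot>\<^bsub>P\<^esub> \<one>\<^bsub>P\<^esub>" using s by blast
  have c: "u \<in> carrier B" "v \<in> carrier B" using uv grade_carrier by auto
  have a: "aug u = \<zero>\<^bsub>R\<^esub>" "aug v = \<zero>\<^bsub>R\<^esub>" using aug_positive uv n by auto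
  have 1: "x = u \<oplus> r \<odot> \<one>"
    using counit1[OF xc] unfolding eq r(2) using c r(1) a
    by (simp add: f1 i1 i2 fold1)
  have 2: "x = v \<oplus> r \<odot> \<one>"
    using counit2[OF xc] unfolding eq r(2) using c r(1) a
    by (simp add: f2 i1 i2 fold2)
  have "component B x 0 = \<zero>" using component_homogeneous[OF x] n by simp
  moreover have "component B x 0 = r \<odot> \<one>"
    unfolding 1 using component_homogeneous[OF uv(1)] component_homogeneous[OF scalar_grade[OF r(1)]] n c r
    by (simp add: component_add)
  ultimately have "r \<odot> \<one> = \<zero>\<^bsub>R\<^esub> \<odot> \<one>" by simp
  then have "r = \<zero>\<^bsub>R\<^esub>" using scalar_eq_iff[OF r(1) R.zero_closed] by blast
  then show ?thesis
    using 1 2 eq r c xc unfolding primitive_def by (simp add: i1 i2)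
qed

definition comult_action where "comult_action \<beta> a = triangular_action \<beta> (\<Phi> a)"

context
  fixes \<beta> assumes \<beta>: "linear_functional R B \<beta>"
begin

lemma comult_action_mult_apply:
  assumes "a \<in> carrier B" "b \<in> carrier B" "v \<in> carrier V"
  shows "comult_action \<beta> (a \<otimes> b) v = comult_action \<beta> a (comult_action \<beta> b v)"
  using assms morD[OF comult_mor] morD[OF triangular_action_mor[OF \<beta>]]
  by (simp add: comult_action_def endomorphism_algebra_apply)

lemma comult_action_smult_apply:
  assumes "r \<in> carrier R" "a \<in> carrier B" "v \<in> carrier V"
  shows "comult_action \<beta> (r \<odot> a) v = r \<odot>\<^bsub>V\<^esub> comult_action \<beta> a v"
  using assms morD[OF comult_mor] morD[OF triangular_action_mor[OF \<beta>]]
  by (simp add: comult_action_def endomorphism_algebra_apply)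

lemma triangular_action_sum_apply:
  assumes "aug x = \<zero>\<^bsub>R\<^esub>" "x \<in> carrier B" "c \<in> carrier B" "d \<in> carrier B"
  shows "triangular_action \<beta> (incl1 R B B x \<oplus>\<^bsub>P\<^esub> incl2 R B B x) (c, d) = (x \<otimes> c, x \<otimes> d \<oplus> \<beta> c \<odot> x)"
proof -
  have "triangular_action \<beta> (incl1 R B B x \<oplus>\<^bsub>P\<^esub> incl2 R B B x) =
    left_triangular R B \<beta> x \<oplus>\<^bsub>E\<^esub> right_diagonal R B x"
    using assms(2) morD(2)[OF triangular_action_mor[OF \<beta>]] morD(1)[OF i1] morD(1)[OF i2]
    by (simp add: triangular_action_incl1[OF \<beta>] triangular_action_incl2[OF \<beta>])
  then show ?thesis
    using assms \<beta>_closed[OF \<beta> assms(3)]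
    by (simp add: endomorphism_algebra_apply left_triangular_apply[OF \<beta>] right_diagonal_apply
      a_minus_def)
qed

lemma comult_action_primitive_apply:
  assumes "primitive x" "aug x = \<zero>\<^bsub>R\<^esub>" "c \<in> carrier B" "d \<in> carrier B"
  shows "comult_action \<beta> x (c, d) = (x \<otimes> c, x \<otimes> d \<oplus> \<beta> c \<odot> x)"
  using assms triangular_action_sum_apply[of x c d] by (simp add: comult_action_def primitive_def)

text \<open>The second coordinate stays \<open>0\<close> as long as \<open>\<beta>\<close> kills the powers met so far, and becomes \<open>x\<close> in the first
  step at which it does not.\<close>

lemma comult_action_power_apply:
  assumes x: "primitive x" "aug x = \<zero>\<^bsub>R\<^esub>"
    and low: "\<And>i. i < k \<Longrightarrow> \<beta> (x [^] (i::nat)) = \<zero>\<^bsub>R\<^esub>"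
  shows "comult_action \<beta> (x [^] k) (\<one>, \<zero>) = (x [^] k, \<zero>)"
    and "\<beta> (x [^] k) = \<one>\<^bsub>R\<^esub> \<Longrightarrow> comult_action \<beta> (x [^] Suc k) (\<one>, \<zero>) = (x [^] Suc k, x)"
proof -
  have xc: "x \<in> carrier B" using x(1) by (simp add: primitive_def)
  have step: "comult_action \<beta> (x [^] Suc i) (\<one>, \<zero>) = comult_action \<beta> x (comult_action \<beta> (x [^] i) (\<one>, \<zero>))"
    "x [^] Suc i = x \<otimes> x [^] i" for i
    using comult_action_mult_apply[OF xc nat_pow_closed[OF xc, of i], of "(\<one>, \<zero>)"] nat_pow_Suc2[OF xc, of i]
    by (simp_all del: nat_pow_Suc)
  have *: "comult_action \<beta> (x [^] j) (\<one>, \<zero>) = (x [^] j, \<zero>)" if "j \<le> k" for j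
    using that
  proof (induction j)
    case 0
    have "comult_action \<beta> \<one> = \<one>\<^bsub>E\<^esub>"
      using morD(4)[OF comult_mor] morD(4)[OF triangular_action_mor[OF \<beta>]] by (simp add: comult_action_def)
    then show ?case by (simp add: endomorphism_algebra_apply)
  next
    case (Suc j)
    then have IH: "comult_action \<beta> (x [^] j) (\<one>, \<zero>) = (x [^] j, \<zero>)" by simp
    show ?case
      unfolding step(1) IH unfolding step(2)
      using low[of j] Suc.prems xc by (simp add: comult_action_primitive_apply[OF x])
  qed
  show "comult_action \<beta> (x [^] k) (\<one>, \<zero>) = (x [^] k, \<zero>)" by (rule *) simp
  assume 1: "\<beta> (x [^] k) = \<one>\<^bsub>R\<^esub>"
  show "comult_action \<beta> (x [^] Suc k) (\<one>, \<zero>) = (x [^] Suc k, x)"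
    unfolding step(1) *[OF order.refl] unfolding step(2)
    using xc 1 by (simp add: comult_action_primitive_apply[OF x])
qed

end

text \<open>The elements without component in degree \<open>kn\<close> form a submodule that contains the lower powers of \<open>x\<close>
  and misses \<open>x\<^sup>k\<close>.\<close>

lemma power_functional_exists:
  assumes n: "n > 0" and x: "x \<in> grade B n" and nz: "x [^] (k::nat) \<noteq> \<zero>"
  obtains \<beta> where "linear_functional R B \<beta>" "\<And>i. i < k \<Longrightarrow> \<beta> (x [^] (i::nat)) = \<zero>\<^bsub>R\<^esub>" "\<beta> (x [^] k) = \<one>\<^bsub>R\<^esub>"
proof -
  let ?M = "{a \<in> carrier B. component B a (k * n) = \<zero>}"
  have comp: "component B (x [^] i) (k * n) = (if k = i then x [^] i else \<zero>)" for i :: nat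
    using component_homogeneous[OF grade_pow[OF x, of i]] n by simp
  have xc: "x [^] i \<in> carrier B" for i :: nat using grade_carrier[OF x] by simp
  have sub: "submodule ?M R B"
  proof (rule submoduleI)
    show "\<zero> \<in> ?M" using component_homogeneous[OF grade_zero[of 0]] by simp
    show "\<ominus> a \<in> ?M" if "a \<in> ?M" for a
      using that by (simp add: uminus_eq_smult component_smult)
  qed (auto simp: component_add component_smult)
  have nM: "x [^] k \<notin> ?M" using comp[of k] nz by simp
  obtain \<beta> where "linear_functional R B \<beta>" "\<And>a. a \<in> ?M \<Longrightarrow> \<beta> a = \<zero>\<^bsub>R\<^esub>" "\<beta> (x [^] k) = \<one>\<^bsub>R\<^esub>"
    by (rule linear_functional_exists[OF K sub xc[of k] nM]) (rule that)
  moreover have "x [^] i \<in> ?M" if "i < k" for i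
    using comp[of i] xc that by simp
  ultimately show thesis using that by blast
qed

text \<open>If \<open>x\<^sup>k\<^sup>+\<^sup>1\<close> were zero it would act as zero, but its action has \<open>x\<close> in the second coordinate.\<close>

lemma primitive_power_nonzero:
  assumes n: "n > 0" and x: "x \<in> grade B n" "x \<noteq> \<zero>" "primitive x"
  shows "x [^] (k::nat) \<noteq> \<zero>"
proof (induction k)
  case 0
  have "\<one> \<noteq> \<zero>"
    using scalar_eq_iff[of "\<one>\<^bsub>R\<^esub>" "\<zero>\<^bsub>R\<^esub>"] domain.one_not_zero[OF field.axioms(1)[OF K]] by simp
  then show ?case by simp
next
  case (Suc k)
  then obtain \<beta> where \<beta>: "linear_functional R B \<beta>" "\<And>i. i < k \<Longrightarrow> \<beta> (x [^] (i::nat)) = \<zero>\<^bsub>R\<^esub>" "\<beta> (x [^] k) = \<one>\<^bsub>R\<^esub>"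
    using power_functional_exists[OF n x(1)] by blast
  show ?case
  proof
    assume 0: "x [^] Suc k = \<zero>"
    have "comult_action \<beta> \<zero> = \<zero>\<^bsub>E\<^esub>"
      using mor_zero[OF comult_mor graded_algebra_axioms P_graded_algebra]
        mor_zero[OF triangular_action_mor[OF \<beta>(1)] P_graded_algebra E_graded_algebra] by (simp add: comult_action_def)
    then have "comult_action \<beta> (x [^] Suc k) (\<one>, \<zero>) = (\<zero>, \<zero>)"
      unfolding 0 by (simp add: endomorphism_algebra_apply)
    then show False
      using comult_action_power_apply(2)[OF \<beta>(1) x(3) aug_positive[OF x(1) n] \<beta>(2,3)] x(2) by simp
  qed
qed

text \<open>With \<open>\<beta>\<close> equal to \<open>1\<close> at \<open>x\<^sup>k\<^sup>+\<^sup>1\<close> and \<open>0\<close> at lower powers, \<open>r x\<^sup>k\<^sup>+\<^sup>2\<close> moves \<open>(1, 0)\<close> to a vector with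
  second coordinate \<open>r x\<close>. For a primitive element this coordinate would be a multiple of \<open>\<beta>(1) = 0\<close>.\<close>

lemma primitive_power_not_primitive:
  assumes n: "n > 0" and x: "x \<in> grade B n" "x \<noteq> \<zero>" "primitive x"
    and r: "r \<in> carrier R" and p: "primitive (r \<odot> x [^] Suc (Suc k))"
  shows "r = \<zero>\<^bsub>R\<^esub>"
proof -
  let ?y = "x [^] Suc (Suc k)"
  have xc: "x \<in> carrier B" and yc: "?y \<in> carrier B" using grade_carrier[OF x(1)] by auto
  have a: "aug (r \<odot> ?y) = \<zero>\<^bsub>R\<^esub>"
    using aug_positive[OF grade_smult[OF r grade_pow[OF x(1), of "Suc (Suc k)"]]] n by simp
  obtain \<beta> where \<beta>: "linear_functional R B \<beta>" "\<And>i. i < Suc k \<Longrightarrow> \<beta> (x [^] (i::nat)) = \<zero>\<^bsub>R\<^esub>" "\<beta> (x [^] Suc k) = \<one>\<^bsub>R\<^esub>"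
    using power_functional_exists[OF n x(1) primitive_power_nonzero[OF n x]] by blast
  have b1: "\<beta> \<one> = \<zero>\<^bsub>R\<^esub>" using \<beta>(2)[of 0] by simp
  have "comult_action \<beta> (r \<odot> ?y) (\<one>, \<zero>) = (r \<odot> ?y, r \<odot> x)"
    using comult_action_power_apply(2)[OF \<beta>(1) x(3) aug_positive[OF x(1) n] \<beta>(2,3)] r yc
    by (simp add: comult_action_smult_apply[OF \<beta>(1)] del: nat_pow_Suc)
  moreover have "comult_action \<beta> (r \<odot> ?y) (\<one>, \<zero>) = (r \<odot> ?y, \<zero>)"
    using comult_action_primitive_apply[OF \<beta>(1) p a, of "\<one>" "\<zero>"] r yc b1 by (simp del: nat_pow_Suc)
  ultimately have rx: "r \<odot> x = \<zero>" by simp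
  show ?thesis
    by (rule smult_cancel_nonzero[OF xc x(2) r R.zero_closed]) (use rx xc in simp)
qed

end

subsection \<open>Graded commutative cogroups\<close>

text \<open>The subalgebra \<open>R[x]\<close>. The inductive form avoids sums with varying index sets.\<close>

inductive_set polynomials_in ::
  "('r, 'c) ring_scheme \<Rightarrow> ('r, 'a, 'x) galg_scheme \<Rightarrow> 'a \<Rightarrow> 'a set" for R B x where
  zero: "\<zero>\<^bsub>B\<^esub> \<in> polynomials_in R B x"
| add: "\<lbrakk>p \<in> polynomials_in R B x; r \<in> carrier R\<rbrakk> \<Longrightarrow>
    p \<oplus>\<^bsub>B\<^esub> r \<odot>\<^bsub>B\<^esub> x [^]\<^bsub>B\<^esub> (i::nat) \<in> polynomials_in R B x"

context graded_algebra
begin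

context
  fixes x assumes x: "x \<in> carrier B"
begin

private abbreviation (input) "N \<equiv> polynomials_in R B x"

lemma polynomials_closed: "p \<in> N \<Longrightarrow> p \<in> carrier B"
  by (induction rule: polynomials_in.induct) (simp_all add: x)

lemma polynomials_monomial: "r \<in> carrier R \<Longrightarrow> r \<odot> x [^] (i::nat) \<in> N"
  using polynomials_in.add[OF polynomials_in.zero, where i = i and r = r and R = R and B = B and x = x] x by simp

lemma polynomials_scalar: "r \<in> carrier R \<Longrightarrow> r \<odot> \<one> \<in> N"
  using polynomials_monomial[where i = 0] by simp

lemma polynomials_one: "\<one> \<in> N"
  using polynomials_scalar[of "\<one>\<^bsub>R\<^esub>"] by simp

lemma polynomials_power: "x [^] (i::nat) \<in> N"
  using polynomials_monomial[of "\<one>\<^bsub>R\<^esub>" i] x by simp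

lemma polynomials_add:
  assumes "p \<in> N" "q \<in> N"
  shows "p \<oplus> q \<in> N"
  using assms(2)
proof induction
  case zero
  then show ?case using assms polynomials_closed by simp
next
  case (add q r i)
  then show ?case
    using polynomials_in.add[OF add(3,2), of i] assms(1) x
    by (simp add: polynomials_closed M.a_assoc)
qed

lemma polynomials_smult:
  assumes "s \<in> carrier R" "p \<in> N"
  shows "s \<odot> p \<in> N"
  using assms(2)
proof induction
  case zero
  then show ?case using assms(1) polynomials_in.zero by simp
next
  case (add q r i)
  then show ?case
    using polynomials_in.add[OF add(3), of "s \<otimes>\<^bsub>R\<^esub> r" i] assms(1) x
    by (simp add: polynomials_closed smult_r_distr smult_assoc1)
qed

lemma polynomials_submodule: "submodule N R B"
proof (rule submoduleI)
  show "\<ominus> p \<in> N" if "p \<in> N" for p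
    using polynomials_smult[of "\<ominus>\<^bsub>R\<^esub> \<one>\<^bsub>R\<^esub>" p] that by (simp add: uminus_eq_smult polynomials_closed)
qed (auto simp: polynomials_closed polynomials_in.zero polynomials_add polynomials_smult)

lemma polynomials_power_mult:
  assumes "q \<in> N"
  shows "x [^] (i::nat) \<otimes> q \<in> N"
  using assms
proof induction
  case zero
  then show ?case using x by (simp add: polynomials_in.zero)
next
  case (add q r j)
  then show ?case
    using polynomials_in.add[OF add(3), of r "i + j"] x
    by (simp add: polynomials_closed r_distr smult_mult_right nat_pow_mult)
qed

lemma polynomials_mult:
  assumes "p \<in> N" "q \<in> N"
  shows "p \<otimes> q \<in> N"
  using assms(1)
proof induction
  case zero
  then show ?case using assms(2) by (simp add: polynomials_closed polynomials_in.zero)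
next
  case (add p r i)
  then show ?case
    using polynomials_add[OF add(3) polynomials_smult[OF add(2) polynomials_power_mult[OF assms(2), of i]]] x assms(2)
    by (simp add: polynomials_closed l_distr smult_mult_left)
qed

end

end

text \<open>The powers of \<open>x\<close> have different degrees, so a component of a polynomial is a single term.\<close>

lemma (in connected_algebra) polynomials_component:
  assumes n: "n > 0" and x: "x \<in> grade B n" and p: "p \<in> polynomials_in R B x"
  shows "component B p k = \<zero> \<or> (\<exists>r\<in>carrier R. \<exists>j. j * n = k \<and> component B p k = r \<odot> x [^] (j::nat))"
  using p
proof induction
  case zero
  then show ?case using component_homogeneous[OF grade_zero[of 0]] by simp
next
  case (add p r i)
  have xc: "x \<in> carrier B" using grade_carrier[OF x] .
  have pc: "p \<in> carrier B" using polynomials_closed[OF xc add(1)] .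
  have m: "r \<odot> x [^] i \<in> grade B (i * n)" using grade_smult[OF add(2) grade_pow[OF x]] .
  have eq: "component B (p \<oplus> r \<odot> x [^] i) k =
    component B p k \<oplus> (if k = i * n then r \<odot> x [^] i else \<zero>)"
    using component_homogeneous[OF m] pc add(2) xc by (simp add: component_add)
  show ?case
  proof (cases "k = i * n")
    case False
    then show ?thesis using add(3) eq component_closed[OF pc] by simp
  next
    case True
    from add(3) show ?thesis
    proof
      assume "component B p k = \<zero>"
      then show ?thesis using eq True add(2) xc by auto
    next
      assume "\<exists>r\<in>carrier R. \<exists>j. j * n = k \<and> component B p k = r \<odot> x [^] (j::nat)"
      then obtain s where s: "s \<in> carrier R" "component B p k = s \<odot> x [^] i"
        using True n by auto
      have "component B (p \<oplus> r \<odot> x [^] i) k = (s \<oplus>\<^bsub>R\<^esub> r) \<odot> x [^] i"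
        using eq True s add(2) xc by (simp add: smult_l_distr)
      then show ?thesis using s add(2) True R.a_closed by blast
    qed
  qed
qed

lemma (in ring) minus_one_power_cases:
  "(\<ominus> \<one>) [^] (k::nat) = (if even k then \<one> else \<ominus> \<one>)"
  by (induction k) (auto simp: r_minus)

context counital_algebra
begin

lemma graded_commutative_swap:
  assumes "graded_commutative B" "x \<in> grade B m" "y \<in> grade B n"
  shows "x \<otimes> y = (if even (m * n) then y \<otimes> x else \<ominus> (y \<otimes> x))"
proof -
  have c: "x \<in> carrier B" "y \<in> carrier B" using assms grade_carrier by auto
  have "x \<otimes> y = ((\<ominus> \<one>) [^] (m * n)) \<otimes> (y \<otimes> x)"
    using assms unfolding graded_commutative_def by blast
  then show ?thesis using c by (simp add: minus_one_power_cases l_minus)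
qed

text \<open>By induction on the degree \<open>m\<close>: an element \<open>y\<close> of degree \<open>m\<close> outside \<open>R[x]\<close> would not commute with \<open>x\<close>,
  even up to sign. The subalgebra \<open>S\<close> of \<open>B \<star> B\<close> collects what is needed of words in elements of \<open>R[x]\<close>:
  they preserve \<open>R[x] \<times> 0\<close>, and \<open>(\<epsilon>, 1) : B \<star> B \<rightarrow> B\<close> maps them into \<open>R[x]\<close>.\<close>

lemma generated_by_primitive:
  assumes comm: "graded_commutative B" and n: "n > 0" and x: "x \<in> grade B n" "x \<noteq> \<zero>" "primitive x"
  shows "grade B m \<subseteq> polynomials_in R B x"
proof (induction m rule: less_induct)
  case (less m)
  interpret P: graded_algebra R P by (rule P_graded_algebra)
  let ?N = "polynomials_in R B x"
  have xc: "x \<in> carrier B" using grade_carrier[OF x(1)] .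
  note N = polynomials_closed[OF xc] polynomials_one[OF xc] polynomials_add[OF xc]
    polynomials_smult[OF xc] polynomials_mult[OF xc] polynomials_scalar[OF xc]
  show ?case
  proof (rule ccontr)
    assume "\<not> ?thesis"
    then obtain y where y: "y \<in> grade B m" "y \<notin> ?N" by blast
    have yc: "y \<in> carrier B" using grade_carrier[OF y(1)] .
    have m: "m > 0"
    proof (rule ccontr)
      assume "\<not> ?thesis"
      then obtain r where "r \<in> carrier R" "y = r \<odot> \<one>" using y(1) grade_0E by auto
      then show False using y(2) N(6) by blast
    qed
    obtain \<beta> where \<beta>: "linear_functional R B \<beta>" and \<beta>N: "\<And>a. a \<in> ?N \<Longrightarrow> \<beta> a = \<zero>\<^bsub>R\<^esub>"
      and \<beta>y: "\<beta> y = \<one>\<^bsub>R\<^esub>"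
      by (rule linear_functional_exists[OF K polynomials_submodule[OF xc] yc y(2)]) (rule that)
    note act = morD[OF triangular_action_mor[OF \<beta>]] and f2 = morD[OF fold2(1)]
    note i1 = morD[OF i1] and i2 = morD[OF i2]
    have act1: "triangular_action \<beta> (incl1 R B B a) (b, \<zero>) = (aug a \<odot> b, \<zero>)" if "a \<in> carrier B" "b \<in> ?N" for a b
      using that \<beta>N[OF that(2)] N(1)[OF that(2)] by (simp add: triangular_action_incl1[OF \<beta>] left_triangular_apply[OF \<beta>])
    have act2: "triangular_action \<beta> (incl2 R B B a) (b, \<zero>) = (a \<otimes> b, \<zero>)" if "a \<in> carrier B" "b \<in> ?N" for a b
      using that N(1)[OF that(2)] by (simp add: triangular_action_incl2[OF \<beta>] right_diagonal_apply)
    define S where "S = {z \<in> carrier P. (\<forall>b\<in>?N. \<exists>b'\<in>?N. triangular_action \<beta> z (b, \<zero>) = (b', \<zero>)) \<and> fold2 z \<in> ?N}"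
    have bV: "(b, \<zero>) \<in> carrier V" if "b \<in> ?N" for b using N(1)[OF that] by simp
    have Ssmult: "r \<odot>\<^bsub>P\<^esub> z \<in> S" if r: "r \<in> carrier R" and z: "z \<in> S" for r z
      unfolding S_def
    proof (intro CollectI conjI ballI)
      have zc: "z \<in> carrier P" and z2: "fold2 z \<in> ?N" using z by (auto simp: S_def)
      show "r \<odot>\<^bsub>P\<^esub> z \<in> carrier P" using r zc by simp
      show "fold2 (r \<odot>\<^bsub>P\<^esub> z) \<in> ?N" using N(4)[OF r z2] by (simp add: f2(5)[OF r zc])
      fix b assume b: "b \<in> ?N"
      then obtain b' where b': "b' \<in> ?N" "triangular_action \<beta> z (b, \<zero>) = (b', \<zero>)" using z by (auto simp: S_def)
      have "triangular_action \<beta> (r \<odot>\<^bsub>P\<^esub> z) (b, \<zero>) = (r \<odot> b', \<zero>)"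
        using b' r by (simp add: act(5)[OF r zc] endomorphism_algebra_apply[OF bV[OF b]])
      then show "\<exists>b'\<in>?N. triangular_action \<beta> (r \<odot>\<^bsub>P\<^esub> z) (b, \<zero>) = (b', \<zero>)" using N(4)[OF r b'(1)] by blast
    qed
    have Sadd: "z \<oplus>\<^bsub>P\<^esub> w \<in> S" if z: "z \<in> S" and w: "w \<in> S" for z w
      unfolding S_def
    proof (intro CollectI conjI ballI)
      have zc: "z \<in> carrier P" "w \<in> carrier P" and z2: "fold2 z \<in> ?N" "fold2 w \<in> ?N" using z w by (auto simp: S_def)
      show "z \<oplus>\<^bsub>P\<^esub> w \<in> carrier P" using zc by simp
      show "fold2 (z \<oplus>\<^bsub>P\<^esub> w) \<in> ?N" using N(3)[OF z2] by (simp add: f2(2)[OF zc])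
      fix b assume b: "b \<in> ?N"
      then obtain b' b'' where b': "b' \<in> ?N" "triangular_action \<beta> z (b, \<zero>) = (b', \<zero>)" "b'' \<in> ?N" "triangular_action \<beta> w (b, \<zero>) = (b'', \<zero>)"
        using z w unfolding S_def by blast
      have "triangular_action \<beta> (z \<oplus>\<^bsub>P\<^esub> w) (b, \<zero>) = (b' \<oplus> b'', \<zero>)"
        using b' by (simp add: act(2)[OF zc] endomorphism_algebra_apply[OF bV[OF b]])
      then show "\<exists>b'\<in>?N. triangular_action \<beta> (z \<oplus>\<^bsub>P\<^esub> w) (b, \<zero>) = (b', \<zero>)" using N(3)[OF b'(1,3)] by blast
    qed
    have Smult: "z \<otimes>\<^bsub>P\<^esub> w \<in> S" if z: "z \<in> S" and w: "w \<in> S" for z w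
      unfolding S_def
    proof (intro CollectI conjI ballI)
      have zc: "z \<in> carrier P" "w \<in> carrier P" and z2: "fold2 z \<in> ?N" "fold2 w \<in> ?N" using z w by (auto simp: S_def)
      show "z \<otimes>\<^bsub>P\<^esub> w \<in> carrier P" using zc by simp
      show "fold2 (z \<otimes>\<^bsub>P\<^esub> w) \<in> ?N" using N(5)[OF z2] by (simp add: f2(3)[OF zc])
      fix b assume b: "b \<in> ?N"
      then obtain b' where b': "b' \<in> ?N" "triangular_action \<beta> w (b, \<zero>) = (b', \<zero>)"
        using w unfolding S_def by blast
      then obtain b'' where b'': "b'' \<in> ?N" "triangular_action \<beta> z (b', \<zero>) = (b'', \<zero>)"
        using z unfolding S_def by blast
      have "triangular_action \<beta> (z \<otimes>\<^bsub>P\<^esub> w) (b, \<zero>) = (b'', \<zero>)"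
        using b' b'' by (simp add: act(3)[OF zc] endomorphism_algebra_apply[OF bV[OF b]])
      then show "\<exists>b'\<in>?N. triangular_action \<beta> (z \<otimes>\<^bsub>P\<^esub> w) (b, \<zero>) = (b', \<zero>)" using b'' by blast
    qed
    have Sone: "\<one>\<^bsub>P\<^esub> \<in> S"
      unfolding S_def using bV N(2) by (auto simp: act(4) f2(4) endomorphism_algebra_apply)
    have Szero: "\<zero>\<^bsub>P\<^esub> \<in> S"
      using Ssmult[OF R.zero_closed Sone] by simp
    have Ssub: "submodule S R P"
    proof (rule P.submoduleI)
      show "S \<subseteq> carrier P" by (auto simp: S_def)
      then show "\<ominus>\<^bsub>P\<^esub> z \<in> S" if "z \<in> S" for z
        using that Ssmult[of "\<ominus>\<^bsub>R\<^esub> \<one>\<^bsub>R\<^esub>" z] by (auto simp: P.uminus_eq_smult)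
    qed (use Szero Ssmult Sadd in auto)
    have Slow: "incl1 R B B b \<in> S \<and> incl2 R B B b \<in> S" if "j < m" "b \<in> grade B j" for j b
    proof -
      have b: "b \<in> ?N" using less.IH[OF that(1)] that(2) by blast
      have bc: "b \<in> carrier B" using N(1)[OF b] .
      have "incl1 R B B b \<in> S"
        unfolding S_def using bc b act1[OF bc] N(4)[OF aug_closed[OF bc]] N(6)[OF aug_closed[OF bc]]
        by (auto simp: i1 fold2(2)[OF bc])
      moreover have "incl2 R B B b \<in> S"
        unfolding S_def using bc b act2[OF bc] N(5)[OF b]
        by (auto simp: i2 fold2(3)[OF bc])
      ultimately show ?thesis ..
    qed
    obtain u v s where uv: "u \<in> grade B m" "v \<in> grade B m" and s: "s \<in> S"
      and eq: "\<Phi> y = incl1 R B B u \<oplus>\<^bsub>P\<^esub> incl2 R B B v \<oplus>\<^bsub>P\<^esub> s"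
      by (rule free_product_low_degree[OF Ssub Sone Smult Slow m morD(6)[OF comult_mor y(1)]])
    have c: "u \<in> carrier B" "v \<in> carrier B" "s \<in> carrier P" using uv s grade_carrier by (auto simp: S_def)
    have a: "aug u = \<zero>\<^bsub>R\<^esub>" using aug_positive[OF uv(1) m] .
    have "y = v \<oplus> fold2 s"
      using counit2[OF yc] unfolding eq using c a by (simp add: f2 i1 i2 fold2)
    moreover have f2s: "fold2 s \<in> ?N" using s by (simp add: S_def)
    ultimately have "\<beta> y = \<beta> v \<oplus>\<^bsub>R\<^esub> \<beta> (fold2 s)"
      using \<beta>_add[OF \<beta> c(2) N(1)[OF f2s]] by simp
    then have \<beta>v: "\<beta> v = \<one>\<^bsub>R\<^esub>" using \<beta>y \<beta>N[OF f2s] \<beta>_closed[OF \<beta> c(2)] by simp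
    \<comment> \<open>The part \<open>u'\<close> acts as zero on \<open>R[x] \<times> 0\<close> because \<open>\<epsilon>(u) = 0\<close> and \<open>\<beta>\<close> vanishes on \<open>R[x]\<close>.\<close>
    have comult_action_y: "\<exists>b'\<in>?N. comult_action \<beta> y (b, \<zero>) = (v \<otimes> b \<oplus> b', \<zero>)" if b: "b \<in> ?N" for b
    proof -
      obtain b' where b': "b' \<in> ?N" "triangular_action \<beta> s (b, \<zero>) = (b', \<zero>)" using s b by (auto simp: S_def)
      have "comult_action \<beta> y (b, \<zero>) = (v \<otimes> b \<oplus> b', \<zero>)"
        unfolding comult_action_def eq using c b b' N(1)[OF b] N(1)[OF b'(1)] a
        by (simp add: act i1 i2 endomorphism_algebra_apply[OF bV[OF b]] act1 act2)
      then show ?thesis using b' by blast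
    qed
    have v1: "(\<one>, \<zero>) \<in> carrier V" using bV[OF N(2)] .
    note comult_action_x = comult_action_primitive_apply[OF \<beta> x(3) aug_positive[OF x(1) n]]
    obtain b' where b': "b' \<in> ?N" "comult_action \<beta> y (\<one>, \<zero>) = (v \<oplus> b', \<zero>)"
      using comult_action_y[OF N(2)] c by auto
    have "\<beta> (v \<oplus> b') = \<one>\<^bsub>R\<^esub>"
      using \<beta>_add[OF \<beta> c(2) N(1)[OF b'(1)]] \<beta>v \<beta>N[OF b'(1)] by simp
    then have xy: "snd (comult_action \<beta> (x \<otimes> y) (\<one>, \<zero>)) = x"
      using comult_action_mult_apply[OF \<beta> xc yc v1] b' c N(1)[OF b'(1)] xc by (simp add: comult_action_x)
    \<comment> \<open>In the other order \<open>x\<close> acts first and stays inside \<open>R[x] \<times> 0\<close>, as \<open>\<beta>(1) = 0\<close>.\<close>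
    have "x \<in> ?N" using polynomials_power[OF xc, of 1] xc by simp
    then obtain b'' where b'': "b'' \<in> ?N" "comult_action \<beta> y (x, \<zero>) = (v \<otimes> x \<oplus> b'', \<zero>)"
      using comult_action_y by blast
    have yx: "comult_action \<beta> (y \<otimes> x) (\<one>, \<zero>) = (v \<otimes> x \<oplus> b'', \<zero>)"
      using comult_action_mult_apply[OF \<beta> yc xc v1] xc b''(2) \<beta>N[OF N(2)] by (simp add: comult_action_x)
    have "snd (comult_action \<beta> (\<ominus> (y \<otimes> x)) (\<one>, \<zero>)) = \<zero>"
      using comult_action_smult_apply[OF \<beta> _ _ v1, of "\<ominus>\<^bsub>R\<^esub> \<one>\<^bsub>R\<^esub>" "y \<otimes> x"] yx yc xc
      by (simp add: uminus_eq_smult)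
    then have "x = \<zero>"
      using xy yx graded_commutative_swap[OF comm x(1) y(1)] by (auto split: if_splits)
    then show False using x(2) by simp
  qed
qed

lemma grade_eq_powers:
  assumes comm: "graded_commutative B" and n: "n > 0" and x: "x \<in> grade B n" "x \<noteq> \<zero>" "primitive x"
    and y: "y \<in> grade B k" "y \<noteq> \<zero>"
  obtains r j where "r \<in> carrier R" "j * n = k" "y = r \<odot> x [^] (j::nat)"
proof -
  have "y \<in> polynomials_in R B x" using generated_by_primitive[OF comm n x] y(1) by blast
  from polynomials_component[OF n x(1) this, of k] show thesis
    using component_homogeneous[OF y(1)] y(2) that by auto
qed

text \<open>In odd degree graded commutativity gives \<open>x\<^sup>2 = -x\<^sup>2\<close>, while \<open>x\<^sup>2\<close> does not vanish.\<close>

lemma odd_primitive_char_2: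
  assumes comm: "graded_commutative B" and n: "odd n" and x: "x \<in> grade B n" "x \<noteq> \<zero>" "primitive x"
  shows "\<one>\<^bsub>R\<^esub> \<oplus>\<^bsub>R\<^esub> \<one>\<^bsub>R\<^esub> = \<zero>\<^bsub>R\<^esub>"
proof (rule ccontr)
  assume ne: "\<one>\<^bsub>R\<^esub> \<oplus>\<^bsub>R\<^esub> \<one>\<^bsub>R\<^esub> \<noteq> \<zero>\<^bsub>R\<^esub>"
  have xc: "x \<in> carrier B" using grade_carrier[OF x(1)] .
  have "x \<otimes> x = \<ominus> (x \<otimes> x)"
    using graded_commutative_swap[OF comm x(1) x(1)] n by simp
  then have "x \<otimes> x \<oplus> x \<otimes> x = \<zero>"
    using xc M.r_neg[of "x \<otimes> x"] by simp
  then have "(\<one>\<^bsub>R\<^esub> \<oplus>\<^bsub>R\<^esub> \<one>\<^bsub>R\<^esub>) \<odot> (x \<otimes> x) = \<zero>\<^bsub>R\<^esub> \<odot> (x \<otimes> x)"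
    using xc by (simp add: smult_l_distr)
  then have "x \<otimes> x = \<zero>"
    using smult_cancel_nonzero[of "x \<otimes> x" "\<one>\<^bsub>R\<^esub> \<oplus>\<^bsub>R\<^esub> \<one>\<^bsub>R\<^esub>" "\<zero>\<^bsub>R\<^esub>"] xc ne by auto
  then have "x [^] Suc (Suc 0) = \<zero>" using xc by simp
  then show False
    using primitive_power_nonzero[OF _ x, of "Suc (Suc 0)"] odd_pos[OF n] by simp
qed

end

lemma ring_char_eq_2_iff:
  assumes "field R"
  shows "ring_char R = 2 \<longleftrightarrow> \<one>\<^bsub>R\<^esub> \<oplus>\<^bsub>R\<^esub> \<one>\<^bsub>R\<^esub> = \<zero>\<^bsub>R\<^esub>"
proof -
  interpret field R by fact
  have pow: "\<one>\<^bsub>R\<^esub> [^]\<^bsub>add_monoid R\<^esub> (k::nat) = \<zero>\<^bsub>R\<^esub> \<longleftrightarrow> ring_char R dvd k" for k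
    using group.pow_eq_id[OF a_group, of "\<one>\<^bsub>R\<^esub>" k] by (simp add: ring_char_def)
  have "\<one>\<^bsub>R\<^esub> [^]\<^bsub>add_monoid R\<^esub> (1::nat) = \<one>\<^bsub>R\<^esub>" "\<one>\<^bsub>R\<^esub> [^]\<^bsub>add_monoid R\<^esub> (2::nat) = \<one>\<^bsub>R\<^esub> \<oplus>\<^bsub>R\<^esub> \<one>\<^bsub>R\<^esub>"
    by (simp_all add: numeral_2_eq_2)
  then have 1: "ring_char R \<noteq> 1" and 2: "ring_char R dvd 2 \<longleftrightarrow> \<one>\<^bsub>R\<^esub> \<oplus>\<^bsub>R\<^esub> \<one>\<^bsub>R\<^esub> = \<zero>\<^bsub>R\<^esub>"
    using pow[of 1] pow[of 2] one_not_zero by auto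
  have "ring_char R dvd 2 \<longleftrightarrow> ring_char R = 2"
  proof
    assume d: "ring_char R dvd 2"
    then have "ring_char R \<le> 2" by (rule dvd_imp_le) simp
    moreover have "ring_char R \<noteq> 0" using d by (intro notI) simp
    ultimately show "ring_char R = 2" using 1 by linarith
  qed simp
  then show ?thesis using 2 by simp
qed

section \<open>Isomorphisms and connectedness\<close>

lemma graded_iso_inverse:
  assumes A: "graded_algebra R A" and B: "graded_algebra R B" and h: "h \<in> mor R A B"
    and bij: "bij_betw h (carrier A) (carrier B)" and grade: "\<And>n. grade B n \<subseteq> h ` grade A n"
  obtains g where "g \<in> mor R B A" "\<And>x. x \<in> carrier A \<Longrightarrow> g (h x) = x" "\<And>y. y \<in> carrier B \<Longrightarrow> h (g y) = y"
proof -
  interpret A: graded_algebra R A by fact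
  interpret B: graded_algebra R B by fact
  define g where "g = (\<lambda>y\<in>carrier B. inv_into (carrier A) h y)"
  note hD = morD[OF h]
  have gh: "g (h x) = x" if "x \<in> carrier A" for x
    using bij that hD(1) by (simp add: g_def bij_betw_def)
  have ex: "\<exists>x\<in>carrier A. y = h x" if "y \<in> carrier B" for y
    using bij that by (auto simp: bij_betw_def)
  have hg: "h (g y) = y" if "y \<in> carrier B" for y
    using ex[OF that] gh by auto
  have "g \<in> mor R B A"
  proof (rule morI)
    show "g x \<in> carrier A" if "x \<in> carrier B" for x
      using ex[OF that] gh by auto
    show "g (x \<oplus>\<^bsub>B\<^esub> y) = g x \<oplus>\<^bsub>A\<^esub> g y" if "x \<in> carrier B" "y \<in> carrier B" for x y
      using ex[OF that(1)] ex[OF that(2)] gh by (auto simp flip: hD(2))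
    show "g (x \<otimes>\<^bsub>B\<^esub> y) = g x \<otimes>\<^bsub>A\<^esub> g y" if "x \<in> carrier B" "y \<in> carrier B" for x y
      using ex[OF that(1)] ex[OF that(2)] gh by (auto simp flip: hD(3))
    show "g \<one>\<^bsub>B\<^esub> = \<one>\<^bsub>A\<^esub>" using gh[of "\<one>\<^bsub>A\<^esub>"] by (simp add: hD(4))
    show "g (r \<odot>\<^bsub>B\<^esub> x) = r \<odot>\<^bsub>A\<^esub> g x" if "r \<in> carrier R" "x \<in> carrier B" for r x
      using ex[OF that(2)] gh that(1) by (auto simp flip: hD(5))
    show "g x \<in> grade A n" if xn: "x \<in> grade B n" for x n
    proof -
      obtain a where a: "a \<in> grade A n" "x = h a" using subsetD[OF grade[of n] xn] by blast
      then show ?thesis using gh[OF A.grade_carrier[OF a(1)]] by simp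
    qed
    show "g \<in> extensional (carrier B)" by (simp add: g_def)
  qed
  then show thesis using gh hg that by blast
qed

text \<open>A family of additive projections onto the homogeneous parts gives existence of the decomposition, by
  induction over sums of homogeneous elements, and uniqueness, by applying the projections to a sum.\<close>

lemma connected_algebraI:
  assumes B: "graded_algebra R B"
    and proj: "\<And>n x. x \<in> carrier B \<Longrightarrow> \<pi> n x \<in> grade B n"
    and add: "\<And>n x y. \<lbrakk>x \<in> carrier B; y \<in> carrier B\<rbrakk> \<Longrightarrow> \<pi> n (x \<oplus>\<^bsub>B\<^esub> y) = \<pi> n x \<oplus>\<^bsub>B\<^esub> \<pi> n y"
    and hom: "\<And>m n x. x \<in> grade B m \<Longrightarrow> \<pi> n x = (if n = m then x else \<zero>\<^bsub>B\<^esub>)"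
    and span: "\<And>Q x. \<lbrakk>x \<in> carrier B; \<And>n x. x \<in> grade B n \<Longrightarrow> Q x;
        \<And>x y. \<lbrakk>x \<in> carrier B; y \<in> carrier B; Q x; Q y\<rbrakk> \<Longrightarrow> Q (x \<oplus>\<^bsub>B\<^esub> y)\<rbrakk> \<Longrightarrow> Q x"
    and conn: "bij_betw (\<lambda>r. r \<odot>\<^bsub>B\<^esub> \<one>\<^bsub>B\<^esub>) (carrier R) (grade B 0)"
  shows "connected_algebra R B"
proof (intro connected_algebra.intro B connected_algebra_axioms.intro conn)
  interpret graded_algebra R B by fact
  have pc: "x \<in> carrier B \<Longrightarrow> \<pi> n x \<in> carrier B" for n x by (rule grade_carrier[OF proj])
  have sum_support: "(\<Oplus>\<^bsub>B\<^esub>n\<in>S. c n) = (\<Oplus>\<^bsub>B\<^esub>n\<in>{n. c n \<noteq> \<zero>\<^bsub>B\<^esub>}. c n)"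
    if "finite S" "{n. c n \<noteq> \<zero>\<^bsub>B\<^esub>} \<subseteq> S" "\<And>n. c n \<in> carrier B" for S :: "nat set" and c
    by (rule M.add.finprod_mono_neutral_cong_right) (use that in auto)
  have proj_sum: "\<pi> m (\<Oplus>\<^bsub>B\<^esub>n\<in>S. c n) = (if m \<in> S then c m else \<zero>\<^bsub>B\<^esub>)"
    if "finite S" "\<And>n. c n \<in> grade B n" for S and c and m
    using that(1)
  proof (induction S)
    case empty
    then show ?case using hom[OF grade_zero[of m]] by simp
  next
    case (insert k S)
    have cc: "c n \<in> carrier B" for n by (rule grade_carrier[OF that(2)])
    have "\<pi> m (\<Oplus>\<^bsub>B\<^esub>n\<in>insert k S. c n) = \<pi> m (c k) \<oplus>\<^bsub>B\<^esub> \<pi> m (\<Oplus>\<^bsub>B\<^esub>n\<in>S. c n)"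
      using insert cc add[of "c k" "\<Oplus>\<^bsub>B\<^esub>n\<in>S. c n" m] by (simp add: Pi_iff)
    then show ?case
      using insert hom[OF that(2)[of k], of m] cc by auto
  qed
  fix x assume x: "x \<in> carrier B"
  have ex: "finite {n. \<pi> n x \<noteq> \<zero>\<^bsub>B\<^esub>} \<and> x = (\<Oplus>\<^bsub>B\<^esub>n\<in>{n. \<pi> n x \<noteq> \<zero>\<^bsub>B\<^esub>}. \<pi> n x)"
    using x
  proof (rule span)
    fix m y assume y: "y \<in> grade B m"
    have yc: "y \<in> carrier B" by (rule grade_carrier[OF y])
    have "(\<Oplus>\<^bsub>B\<^esub>n\<in>{m}. \<pi> n y) = (\<Oplus>\<^bsub>B\<^esub>n\<in>{n. \<pi> n y \<noteq> \<zero>\<^bsub>B\<^esub>}. \<pi> n y)"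
      by (rule sum_support) (auto simp: hom[OF y] yc)
    moreover have "finite {n. \<pi> n y \<noteq> \<zero>\<^bsub>B\<^esub>}"
      by (rule finite_subset[of _ "{m}"]) (auto simp: hom[OF y])
    moreover have "(\<Oplus>\<^bsub>B\<^esub>n\<in>{m}. \<pi> n y) = y" using hom[OF y, of m] yc by simp
    ultimately show "finite {n. \<pi> n y \<noteq> \<zero>\<^bsub>B\<^esub>} \<and> y = (\<Oplus>\<^bsub>B\<^esub>n\<in>{n. \<pi> n y \<noteq> \<zero>\<^bsub>B\<^esub>}. \<pi> n y)" by simp
  next
    fix y z assume yz: "y \<in> carrier B" "z \<in> carrier B"
      and y: "finite {n. \<pi> n y \<noteq> \<zero>\<^bsub>B\<^esub>} \<and> y = (\<Oplus>\<^bsub>B\<^esub>n\<in>{n. \<pi> n y \<noteq> \<zero>\<^bsub>B\<^esub>}. \<pi> n y)"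
      and z: "finite {n. \<pi> n z \<noteq> \<zero>\<^bsub>B\<^esub>} \<and> z = (\<Oplus>\<^bsub>B\<^esub>n\<in>{n. \<pi> n z \<noteq> \<zero>\<^bsub>B\<^esub>}. \<pi> n z)"
    let ?S = "{n. \<pi> n y \<noteq> \<zero>\<^bsub>B\<^esub>} \<union> {n. \<pi> n z \<noteq> \<zero>\<^bsub>B\<^esub>}"
    have S: "finite ?S" using y z by blast
    have sub: "{n. \<pi> n (y \<oplus>\<^bsub>B\<^esub> z) \<noteq> \<zero>\<^bsub>B\<^esub>} \<subseteq> ?S" by (auto simp: add[OF yz])
    have "(\<Oplus>\<^bsub>B\<^esub>n\<in>{n. \<pi> n (y \<oplus>\<^bsub>B\<^esub> z) \<noteq> \<zero>\<^bsub>B\<^esub>}. \<pi> n (y \<oplus>\<^bsub>B\<^esub> z)) = (\<Oplus>\<^bsub>B\<^esub>n\<in>?S. \<pi> n y \<oplus>\<^bsub>B\<^esub> \<pi> n z)"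
      using sum_support[OF S sub] yz pc by (simp add: add[OF yz])
    also have "\<dots> = (\<Oplus>\<^bsub>B\<^esub>n\<in>?S. \<pi> n y) \<oplus>\<^bsub>B\<^esub> (\<Oplus>\<^bsub>B\<^esub>n\<in>?S. \<pi> n z)"
      by (rule finsum_addf) (use yz pc in auto)
    also have "\<dots> = y \<oplus>\<^bsub>B\<^esub> z"
      using y z sum_support[OF S, of "\<lambda>n. \<pi> n y"] sum_support[OF S, of "\<lambda>n. \<pi> n z"] yz pc by simp
    finally show "finite {n. \<pi> n (y \<oplus>\<^bsub>B\<^esub> z) \<noteq> \<zero>\<^bsub>B\<^esub>} \<and>
        y \<oplus>\<^bsub>B\<^esub> z = (\<Oplus>\<^bsub>B\<^esub>n\<in>{n. \<pi> n (y \<oplus>\<^bsub>B\<^esub> z) \<noteq> \<zero>\<^bsub>B\<^esub>}. \<pi> n (y \<oplus>\<^bsub>B\<^esub> z))"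
      using finite_subset[OF sub S] by simp
  qed
  show "\<exists>!c. (\<forall>n. c n \<in> grade B n) \<and> finite {n. c n \<noteq> \<zero>\<^bsub>B\<^esub>} \<and> x = (\<Oplus>\<^bsub>B\<^esub>n\<in>{n. c n \<noteq> \<zero>\<^bsub>B\<^esub>}. c n)"
  proof (rule ex1I[of _ "\<lambda>n. \<pi> n x"])
    show "(\<forall>n. \<pi> n x \<in> grade B n) \<and> finite {n. \<pi> n x \<noteq> \<zero>\<^bsub>B\<^esub>} \<and> x = (\<Oplus>\<^bsub>B\<^esub>n\<in>{n. \<pi> n x \<noteq> \<zero>\<^bsub>B\<^esub>}. \<pi> n x)"
      using ex proj[OF x] by blast
    fix c assume c: "(\<forall>n. c n \<in> grade B n) \<and> finite {n. c n \<noteq> \<zero>\<^bsub>B\<^esub>} \<and> x = (\<Oplus>\<^bsub>B\<^esub>n\<in>{n. c n \<noteq> \<zero>\<^bsub>B\<^esub>}. c n)"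
    show "c = (\<lambda>n. \<pi> n x)"
    proof
      fix m
      have "\<pi> m x = \<pi> m (\<Oplus>\<^bsub>B\<^esub>n\<in>{n. c n \<noteq> \<zero>\<^bsub>B\<^esub>}. c n)" using c by simp
      also have "\<dots> = (if m \<in> {n. c n \<noteq> \<zero>\<^bsub>B\<^esub>} then c m else \<zero>\<^bsub>B\<^esub>)"
        by (rule proj_sum) (use c in auto)
      also have "\<dots> = c m" by simp
      finally show "c m = \<pi> m x" ..
    qed
  qed
qed

lemma connected_algebra_iso:
  assumes A: "connected_algebra R A" and B: "graded_algebra R B" and h: "h \<in> mor R A B"
    and bij: "bij_betw h (carrier A) (carrier B)" and grade: "\<And>n. grade B n \<subseteq> h ` grade A n"
  shows "connected_algebra R B"
proof -
  interpret A: connected_algebra R A by fact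
  interpret B: graded_algebra R B by fact
  obtain g where g: "g \<in> mor R B A" and gh: "\<And>x. x \<in> carrier A \<Longrightarrow> g (h x) = x"
    and hg: "\<And>y. y \<in> carrier B \<Longrightarrow> h (g y) = y"
    using graded_iso_inverse[OF A.graded_algebra_axioms B h bij grade] by blast
  note hD = morD[OF h] and gD = morD[OF g]
  have h0: "h \<zero>\<^bsub>A\<^esub> = \<zero>\<^bsub>B\<^esub>" by (rule mor_zero[OF h A.graded_algebra_axioms B])
  show ?thesis
  proof (rule connected_algebraI[OF B, where \<pi> = "\<lambda>n x. h (component A (g x) n)"])
    show "h (component A (g x) n) \<in> grade B n" if "x \<in> carrier B" for n x
      using that by (intro hD A.component_props gD)
    show "h (component A (g (x \<oplus>\<^bsub>B\<^esub> y)) n) = h (component A (g x) n) \<oplus>\<^bsub>B\<^esub> h (component A (g y) n)"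
      if "x \<in> carrier B" "y \<in> carrier B" for n x y
      using that by (simp add: gD A.component_add hD A.component_closed)
    show "h (component A (g x) n) = (if n = m then x else \<zero>\<^bsub>B\<^esub>)" if "x \<in> grade B m" for m n x
      using A.component_homogeneous[OF gD(6)[OF that]] hg[OF B.grade_carrier[OF that]] h0 by simp
    show "bij_betw (\<lambda>r. r \<odot>\<^bsub>B\<^esub> \<one>\<^bsub>B\<^esub>) (carrier R) (grade B 0)"
    proof -
      have "bij_betw h (grade A 0) (grade B 0)"
        unfolding bij_betw_def
      proof
        show "inj_on h (grade A 0)"
          by (rule inj_on_subset[of _ "carrier A"]) (use bij A.grade_carrier in \<open>auto simp: bij_betw_def\<close>)
        show "h ` grade A 0 = grade B 0" using grade[of 0] hD(6) by blast
      qed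
      from bij_betw_trans[OF A.connected this] show ?thesis
        by (rule bij_betw_cong[THEN iffD1, rotated]) (simp add: hD)
    qed
    fix Q x assume x: "x \<in> carrier B" and homog: "\<And>n x. x \<in> grade B n \<Longrightarrow> Q x"
      and add: "\<And>x y. \<lbrakk>x \<in> carrier B; y \<in> carrier B; Q x; Q y\<rbrakk> \<Longrightarrow> Q (x \<oplus>\<^bsub>B\<^esub> y)"
    have "Q (h a)" if "a \<in> carrier A" for a
      using that
    proof (induction rule: A.homogeneous_induct)
      case (homogeneous n a)
      then show ?case by (intro homog hD)
    next
      case (add a b)
      then show ?case using assms by (simp add: hD \<open>\<And>x y. \<lbrakk>x \<in> carrier B; y \<in> carrier B; Q x; Q y\<rbrakk> \<Longrightarrow> Q (x \<oplus>\<^bsub>B\<^esub> y)\<close>)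
    qed
    from this[OF gD(1)[OF x]] show "Q x" using hg[OF x] by simp
  qed
qed

lemma component_mor:
  assumes A: "connected_algebra R A" and B: "connected_algebra R B" and f: "f \<in> mor R A B" and x: "x \<in> carrier A"
  shows "component B (f x) k = f (component A x k)"
proof -
  interpret A: connected_algebra R A by fact
  interpret B: connected_algebra R B by fact
  note fD = morD[OF f]
  have f0: "f \<zero>\<^bsub>A\<^esub> = \<zero>\<^bsub>B\<^esub>" by (rule mor_zero[OF f A.graded_algebra_axioms B.graded_algebra_axioms])
  show ?thesis
    using x
  proof (induction rule: A.homogeneous_induct)
    case (homogeneous n x)
    then show ?case
      using A.component_homogeneous[OF homogeneous] B.component_homogeneous[OF fD(6)[OF homogeneous]] f0 by simp
  next
    case (add x y)
    then show ?case by (simp add: fD A.component_add B.component_add A.component_closed)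
  qed
qed

lemma bij_betw_grade_0:
  assumes A: "connected_algebra R A" and B: "connected_algebra R B" and f: "f \<in> mor R A B"
  shows "bij_betw f (grade A 0) (grade B 0)"
proof -
  interpret A: connected_algebra R A by fact
  interpret B: connected_algebra R B by fact
  note fD = morD[OF f]
  have fr: "f (r \<odot>\<^bsub>A\<^esub> \<one>\<^bsub>A\<^esub>) = r \<odot>\<^bsub>B\<^esub> \<one>\<^bsub>B\<^esub>" if "r \<in> carrier R" for r
    using that by (simp add: fD)
  show ?thesis
    unfolding bij_betw_def
  proof
    show "inj_on f (grade A 0)"
    proof (rule inj_onI)
      fix x y assume x: "x \<in> grade A 0" and y: "y \<in> grade A 0" and "f x = f y"
      obtain r where "r \<in> carrier R" "x = r \<odot>\<^bsub>A\<^esub> \<one>\<^bsub>A\<^esub>" using A.grade_0E[OF x] .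
      moreover obtain s where "s \<in> carrier R" "y = s \<odot>\<^bsub>A\<^esub> \<one>\<^bsub>A\<^esub>" using A.grade_0E[OF y] .
      ultimately show "x = y" using \<open>f x = f y\<close> by (simp add: fr B.scalar_eq_iff)
    qed
    show "f ` grade A 0 = grade B 0"
    proof
      show "f ` grade A 0 \<subseteq> grade B 0" using fD(6) by blast
      show "grade B 0 \<subseteq> f ` grade A 0"
      proof
        fix y assume "y \<in> grade B 0"
        then obtain r where "r \<in> carrier R" "y = r \<odot>\<^bsub>B\<^esub> \<one>\<^bsub>B\<^esub>" using B.grade_0E by blast
        then show "y \<in> f ` grade A 0" using imageI[OF A.scalar_grade[of r], of f] fr[of r] by simp
      qed
    qed
  qed
qed

text \<open>Bijectivity can be tested in each degree, since morphisms commute with taking components.\<close>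

lemma mor_bijective_on_grades:
  assumes A: "connected_algebra R A" and B: "connected_algebra R B" and f: "f \<in> mor R A B"
    and bij: "\<And>k. bij_betw f (grade A k) (grade B k)"
  obtains g where "g \<in> mor R B A" "\<And>x. x \<in> carrier A \<Longrightarrow> g (f x) = x" "\<And>y. y \<in> carrier B \<Longrightarrow> f (g y) = y"
proof -
  interpret A: connected_algebra R A by fact
  interpret B: connected_algebra R B by fact
  note fD = morD[OF f]
  have f0: "f \<zero>\<^bsub>A\<^esub> = \<zero>\<^bsub>B\<^esub>" by (rule mor_zero[OF f A.graded_algebra_axioms B.graded_algebra_axioms])
  have "inj_on f (carrier A)"
  proof (rule inj_onI)
    fix x y assume xy: "x \<in> carrier A" "y \<in> carrier A" "f x = f y"
    have "component A x k = component A y k" for k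
    proof -
      have "f (component A x k) = f (component A y k)"
        using component_mor[OF A B f, of x k] component_mor[OF A B f, of y k] xy by simp
      then show ?thesis
        using bij[of k] A.component_props(1)[OF xy(1)] A.component_props(1)[OF xy(2)]
        by (auto simp: bij_betw_def inj_on_def)
    qed
    then have "component A x = component A y" by blast
    then show "x = y" using A.component_props(3)[OF xy(1)] A.component_props(3)[OF xy(2)] by simp
  qed
  moreover have "y \<in> f ` carrier A" if "y \<in> carrier B" for y
    using that
  proof (induction rule: B.homogeneous_induct)
    case (homogeneous n y)
    then have "y \<in> f ` grade A n" using bij[of n] by (simp add: bij_betw_def)
    then show ?case using A.grade_carrier by blast
  next
    case (add y z)
    then obtain a b where "a \<in> carrier A" "y = f a" "b \<in> carrier A" "z = f b" by blast
    then show ?case using fD(2)[of a b] imageI[of "a \<oplus>\<^bsub>A\<^esub> b" "carrier A" f] by simp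
  qed
  ultimately have "bij_betw f (carrier A) (carrier B)"
    using fD(1) by (auto simp: bij_betw_def)
  moreover have "\<And>n. grade B n \<subseteq> f ` grade A n" using bij by (auto simp: bij_betw_def)
  ultimately show thesis
    using graded_iso_inverse[OF A.graded_algebra_axioms B.graded_algebra_axioms f] that by blast
qed

text \<open>When every letter has exactly one degree, the words of degree \<open>k\<close> span a complement of the other words,
  and truncation to them is the projection. Positivity of the degrees leaves only the empty word in
  degree \<open>0\<close>.\<close>

lemma (in cring) free_galg_connected:
  assumes D: "\<And>l d. l \<in> L \<Longrightarrow> D l d \<longleftrightarrow> d = \<delta> l" and pos: "\<And>l. l \<in> L \<Longrightarrow> \<delta> l > 0"
  shows "connected_algebra R (free_galg R L D)"
proof -
  let ?F = "free_galg R L D"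
  interpret F: graded_algebra R ?F by (rule free_galg_graded_algebra)
  have ld: "letters_degree D w k \<longleftrightarrow> k = sum_list (map \<delta> w)" if "w \<in> lists L" for w k
    using that by (induction w arbitrary: k) (auto simp: letters_degree_Cons D)
  have sL: "w \<in> lists L" if "p \<in> carrier ?F" "p w \<noteq> \<zero>" for p w
    using that by (simp add: free_galg_simps(1))
  define tr where "tr k p = (\<lambda>w. if sum_list (map \<delta> w) = k then p w else \<zero>)" for k and p :: "'c list \<Rightarrow> 'a"
  show ?thesis
  proof (rule connected_algebraI[OF F.graded_algebra_axioms, where \<pi> = tr])
    show "tr n p \<in> grade ?F n" if "p \<in> carrier ?F" for n p
    proof -
      have "finite {w. tr n p w \<noteq> \<zero>}"
        by (rule finite_subset[of _ "{w. p w \<noteq> \<zero>}"]) (use that in \<open>auto simp: free_galg_simps(1) tr_def\<close>)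
      moreover have "w \<in> lists L \<and> letters_degree D w n" if "tr n p w \<noteq> \<zero>" for w
        using that sL[OF \<open>p \<in> carrier ?F\<close>, of w] ld[of w n] by (auto simp: tr_def split: if_splits)
      moreover have "tr n p \<in> UNIV \<rightarrow> carrier R" using that by (auto simp: free_galg_simps(1) tr_def)
      ultimately show ?thesis unfolding free_galg_simps(1,2) by blast
    qed
    show "tr n (x \<oplus>\<^bsub>?F\<^esub> y) = tr n x \<oplus>\<^bsub>?F\<^esub> tr n y" for n x y
      by (auto simp: tr_def free_galg_simps fun_eq_iff)
    show "tr n x = (if n = m then x else \<zero>\<^bsub>?F\<^esub>)" if x: "x \<in> grade ?F m" for m n x
    proof
      fix w
      show "tr n x w = (if n = m then x else \<zero>\<^bsub>?F\<^esub>) w"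
      proof (cases "x w = \<zero>")
        case False
        then have "w \<in> lists L" "letters_degree D w m"
          using x sL[of x w] by (auto simp: free_galg_simps(2))
        then show ?thesis using ld[of w m] by (auto simp: tr_def free_galg_simps(5))
      qed (auto simp: tr_def free_galg_simps(5))
    qed
    show "Q x" if x: "x \<in> carrier ?F" and h: "\<And>n x. x \<in> grade ?F n \<Longrightarrow> Q x"
      and a: "\<And>x y. \<lbrakk>x \<in> carrier ?F; y \<in> carrier ?F; Q x; Q y\<rbrakk> \<Longrightarrow> Q (x \<oplus>\<^bsub>?F\<^esub> y)" for Q x
      using x
    proof (induction x rule: free_galg_induct)
      case zero
      then show ?case using h[OF F.grade_zero] by (simp add: free_galg_simps(5))
    next
      case (add q r w)
      have w: "word R w \<in> grade ?F (sum_list (map \<delta> w))"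
        using ld[OF \<open>w \<in> lists L\<close>] word_closed[OF \<open>w \<in> lists L\<close>, of D]
        by (auto simp: free_galg_simps(2) word_def)
      have rw: "r \<odot>\<^bsub>?F\<^esub> word R w \<in> grade ?F (sum_list (map \<delta> w))" using F.grade_smult[OF \<open>r \<in> carrier R\<close> w] .
      have "Q (q \<oplus>\<^bsub>?F\<^esub> r \<odot>\<^bsub>?F\<^esub> word R w)"
        using add F.grade_carrier[OF rw] h[OF rw] by (intro a) auto
      then show ?case by (simp add: free_galg_simps)
    qed
    show "bij_betw (\<lambda>r. r \<odot>\<^bsub>?F\<^esub> \<one>\<^bsub>?F\<^esub>) (carrier R) (grade ?F 0)"
      unfolding bij_betw_def
    proof
      show "inj_on (\<lambda>r. r \<odot>\<^bsub>?F\<^esub> \<one>\<^bsub>?F\<^esub>) (carrier R)"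
        by (rule inj_onI, drule fun_cong[of _ _ "[]"]) (simp add: free_galg_simps word_def)
      show "(\<lambda>r. r \<odot>\<^bsub>?F\<^esub> \<one>\<^bsub>?F\<^esub>) ` carrier R = grade ?F 0"
      proof
        show "(\<lambda>r. r \<odot>\<^bsub>?F\<^esub> \<one>\<^bsub>?F\<^esub>) ` carrier R \<subseteq> grade ?F 0"
          using F.grade_smult[OF _ F.grade_one] by blast
        show "grade ?F 0 \<subseteq> (\<lambda>r. r \<odot>\<^bsub>?F\<^esub> \<one>\<^bsub>?F\<^esub>) ` carrier R"
        proof
          fix p assume p: "p \<in> grade ?F 0"
          then have pc: "p \<in> carrier ?F" by (simp add: free_galg_simps(2))
          have "p w = \<zero>" if "w \<noteq> []" for w
          proof (rule ccontr)
            assume "p w \<noteq> \<zero>"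
            then have "w \<in> lists L" "sum_list (map \<delta> w) = 0"
              using p sL[OF pc, of w] ld[of w 0] by (auto simp: free_galg_simps(2))
            then show False using that pos[of "hd w"] by (cases w) auto
          qed
          then have "p = p [] \<odot>\<^bsub>?F\<^esub> \<one>\<^bsub>?F\<^esub>"
            using pc by (auto simp: free_galg_simps word_def fun_eq_iff Pi_iff)
          moreover have "p [] \<in> carrier R" using pc by (auto simp: free_galg_simps)
          ultimately show "p \<in> (\<lambda>r. r \<odot>\<^bsub>?F\<^esub> \<one>\<^bsub>?F\<^esub>) ` carrier R" by blast
        qed
      qed
    qed
  qed
qed

section \<open>The cogroups of the polynomial rings\<close>

lemma A_cogroup_simps [simp]:
  "carrier (A_cogroup R \<iota> n) = carrier (A_alg R \<iota> n)" "mult (A_cogroup R \<iota> n) = mult (A_alg R \<iota> n)"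
  "one (A_cogroup R \<iota> n) = one (A_alg R \<iota> n)" "zero (A_cogroup R \<iota> n) = zero (A_alg R \<iota> n)"
  "add (A_cogroup R \<iota> n) = add (A_alg R \<iota> n)" "smult (A_cogroup R \<iota> n) = smult (A_alg R \<iota> n)"
  "grade (A_cogroup R \<iota> n) = grade (A_alg R \<iota> n)" "comult (A_cogroup R \<iota> n) = A_comult R \<iota> n"
  by (simp_all add: A_cogroup_def galg.extend_def cogroup.fields_def)

text \<open>A word in one letter is determined by its length, so the free algebra on one letter is \<open>R[X]\<close>; the
  definition reads off the coefficients of the polynomial.\<close>

definition coefficients :: "(unit list \<Rightarrow> 'r) \<Rightarrow> nat \<Rightarrow> 'r" where
  "coefficients p = (\<lambda>k. p (replicate k ()))"

text \<open>For \<open>n = 0\<close> there are no letters and the free algebra is the ground ring, so that all \<open>A(n)\<close> are treated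
  alike.\<close>

definition A_free :: "('r, 'c) ring_scheme \<Rightarrow> nat \<Rightarrow> ('r, unit list \<Rightarrow> 'r) galg" where
  "A_free R n = free_galg R (if n = 0 then {} else {()}) (\<lambda>_ d. d = n)"

lemma unit_list_eq: "replicate (length w) () = w"
  by (induction w) auto

lemma coefficients_length: "coefficients p (length w) = p w"
  by (simp add: coefficients_def unit_list_eq)

lemma coefficients_inj: "coefficients p = coefficients q \<Longrightarrow> p = q"
  by (metis coefficients_length ext)

lemma UP_eval:
  "carrier (UP R) = up R" "one (UP R) = (\<lambda>i. if i = 0 then \<one>\<^bsub>R\<^esub> else \<zero>\<^bsub>R\<^esub>)" "zero (UP R) = (\<lambda>i. \<zero>\<^bsub>R\<^esub>)"
  "\<lbrakk>p \<in> up R; q \<in> up R\<rbrakk> \<Longrightarrow> p \<otimes>\<^bsub>UP R\<^esub> q = (\<lambda>n. \<Oplus>\<^bsub>R\<^esub>i \<in> {..n}. p i \<otimes>\<^bsub>R\<^esub> q (n - i))"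
  "\<lbrakk>p \<in> up R; q \<in> up R\<rbrakk> \<Longrightarrow> p \<oplus>\<^bsub>UP R\<^esub> q = (\<lambda>n. p n \<oplus>\<^bsub>R\<^esub> q n)"
  "\<lbrakk>r \<in> carrier R; q \<in> up R\<rbrakk> \<Longrightarrow> r \<odot>\<^bsub>UP R\<^esub> q = (\<lambda>n. r \<otimes>\<^bsub>R\<^esub> q n)"
  "p \<in> up R \<Longrightarrow> coeff (UP R) p = p"
  "r \<in> carrier R \<Longrightarrow> monom (UP R) r n = (\<lambda>i. if i = n then r else \<zero>\<^bsub>R\<^esub>)"
  by (simp_all add: UP_def)

context
  fixes R :: "('r, 'c) ring_scheme" and \<iota> :: "(nat \<Rightarrow> 'r) \<Rightarrow> 'u"
  assumes K: "field R" and inj: "inj_on \<iota> (carrier (UP R))"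
begin

interpretation R: field R by (rule K)

private abbreviation (input) "A \<equiv> A_cogroup R \<iota>"
private abbreviation (input) "FA \<equiv> A_free R"

interpretation FA: graded_algebra R "FA n" for n
  unfolding A_free_def by (rule R.free_galg_graded_algebra)

lemma A_free_carrier_zero: "p \<in> carrier (FA 0) \<Longrightarrow> w \<noteq> [] \<Longrightarrow> p w = \<zero>\<^bsub>R\<^esub>"
  by (cases w) (auto simp: A_free_def free_galg_simps)

lemma A_free_coeff_closed: "p \<in> carrier (FA n) \<Longrightarrow> p w \<in> carrier R"
  by (auto simp: A_free_def free_galg_simps)

lemma A_free_simps:
  "mult (FA n) = convolution R" "one (FA n) = word R []" "zero (FA n) = (\<lambda>w. \<zero>\<^bsub>R\<^esub>)"
  "add (FA n) = (\<lambda>p q w. p w \<oplus>\<^bsub>R\<^esub> q w)" "smult (FA n) = (\<lambda>r p w. r \<otimes>\<^bsub>R\<^esub> p w)"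
  by (simp_all add: A_free_def free_galg_simps)

lemma coefficients_closed:
  assumes p: "p \<in> carrier (FA n)"
  shows "coefficients p \<in> up R"
proof (rule mem_upI)
  show "coefficients p k \<in> carrier R" for k
    using A_free_coeff_closed[OF p] by (simp add: coefficients_def)
  have fin: "finite {w. p w \<noteq> \<zero>\<^bsub>R\<^esub>}" using p by (simp add: A_free_def free_galg_simps)
  define m where "m = Max (insert 0 (length ` {w. p w \<noteq> \<zero>\<^bsub>R\<^esub>}))"
  have "coefficients p k = \<zero>\<^bsub>R\<^esub>" if "m < k" for k
  proof (rule ccontr)
    assume "coefficients p k \<noteq> \<zero>\<^bsub>R\<^esub>"
    then have "k \<in> insert 0 (length ` {w. p w \<noteq> \<zero>\<^bsub>R\<^esub>})"
      by (intro insertI2 image_eqI[of _ _ "replicate k ()"]) (auto simp: coefficients_def)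
    then have "k \<le> m" unfolding m_def by (intro Max_ge) (use fin in auto)
    then show False using that by simp
  qed
  then show "\<exists>m. bound \<zero>\<^bsub>R\<^esub> m (coefficients p)" by (auto intro!: exI[of _ m])
qed

lemma coefficients_surj:
  assumes n: "n > 0" and q: "q \<in> up R"
  shows "\<exists>p\<in>carrier (FA n). coefficients p = q"
proof (rule bexI)
  show "coefficients (\<lambda>w. q (length w)) = q" by (simp add: coefficients_def)
  obtain m where m: "bound \<zero>\<^bsub>R\<^esub> m q" using q by (auto simp: up_def)
  have "{w :: unit list. q (length w) \<noteq> \<zero>\<^bsub>R\<^esub>} \<subseteq> (\<lambda>k. replicate k ()) ` {..m}"
  proof
    fix w :: "unit list" assume "w \<in> {w. q (length w) \<noteq> \<zero>\<^bsub>R\<^esub>}"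
    then have "length w \<le> m" using bound_below[OF m] by simp
    then show "w \<in> (\<lambda>k. replicate k ()) ` {..m}"
      by (intro image_eqI[of _ _ "length w"]) (auto simp: unit_list_eq)
  qed
  then have "finite {w :: unit list. q (length w) \<noteq> \<zero>\<^bsub>R\<^esub>}" by (rule finite_subset) simp
  then show "(\<lambda>w. q (length w)) \<in> carrier (FA n)"
    using n q by (auto simp: A_free_def free_galg_simps)
qed

lemma coefficients_mult:
  assumes "p \<in> carrier (FA n)" "q \<in> carrier (FA n)"
  shows "coefficients (p \<otimes>\<^bsub>FA n\<^esub> q) = (\<lambda>k. \<Oplus>\<^bsub>R\<^esub>i\<in>{..k}. coefficients p i \<otimes>\<^bsub>R\<^esub> coefficients q (k - i))"
proof
  fix k
  show "coefficients (p \<otimes>\<^bsub>FA n\<^esub> q) k = (\<Oplus>\<^bsub>R\<^esub>i\<in>{..k}. coefficients p i \<otimes>\<^bsub>R\<^esub> coefficients q (k - i))"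
    unfolding coefficients_def A_free_simps convolution_def length_replicate
    by (rule R.finsum_cong')
      (use A_free_coeff_closed[OF assms(1)] A_free_coeff_closed[OF assms(2)] in \<open>auto simp: min_def\<close>)
qed

lemma coefficients_F0:
  assumes "p \<in> carrier (FA 0)"
  shows "coefficients p = monom (UP R) (p []) 0"
  using A_free_carrier_zero[OF assms] A_free_coeff_closed[OF assms]
  by (auto simp: coefficients_def UP_eval fun_eq_iff)

text \<open>The isomorphism from the free algebra to the underlying algebra of \<open>A(n)\<close>.\<close>

definition A_map where "A_map n = (\<lambda>p\<in>carrier (FA n). \<iota> (coefficients p))"

lemma \<iota>_inv: "q \<in> up R \<Longrightarrow> inv_into (up R) \<iota> (\<iota> q) = q"
  using inj by (simp add: UP_eval)

lemma monom_closed: "r \<in> carrier R \<Longrightarrow> monom (UP R) r 0 \<in> up R"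
  by (rule mem_upI) (auto simp: UP_eval intro!: exI[of _ 0])

lemma \<iota>_monom_inj: "inj_on (\<lambda>r. \<iota> (monom (UP R) r 0)) (carrier R)"
proof (rule inj_onI)
  fix r s assume rs: "r \<in> carrier R" "s \<in> carrier R" "\<iota> (monom (UP R) r 0) = \<iota> (monom (UP R) s 0)"
  then have "monom (UP R) r 0 = monom (UP R) s 0"
    using inj monom_closed by (auto simp: inj_on_def UP_eval(1))
  from fun_cong[OF this, of 0] show "r = s" using rs by (simp add: UP_eval)
qed

lemma \<iota>_monom_inv: "r \<in> carrier R \<Longrightarrow> inv_into (carrier R) (\<lambda>r. \<iota> (monom (UP R) r 0)) (\<iota> (monom (UP R) r 0)) = r"
  by (rule inv_into_f_f[OF \<iota>_monom_inj])

lemma A_alg_0: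
  "carrier (A_alg R \<iota> 0) = (\<lambda>r. \<iota> (monom (UP R) r 0)) ` carrier R"
  "one (A_alg R \<iota> 0) = \<iota> (monom (UP R) \<one>\<^bsub>R\<^esub> 0)"
  "zero (A_alg R \<iota> 0) = \<iota> (monom (UP R) \<zero>\<^bsub>R\<^esub> 0)"
  "\<lbrakk>r \<in> carrier R; s \<in> carrier R\<rbrakk> \<Longrightarrow>
    \<iota> (monom (UP R) r 0) \<otimes>\<^bsub>A_alg R \<iota> 0\<^esub> \<iota> (monom (UP R) s 0) = \<iota> (monom (UP R) (r \<otimes>\<^bsub>R\<^esub> s) 0)"
  "\<lbrakk>r \<in> carrier R; s \<in> carrier R\<rbrakk> \<Longrightarrow>
    \<iota> (monom (UP R) r 0) \<oplus>\<^bsub>A_alg R \<iota> 0\<^esub> \<iota> (monom (UP R) s 0) = \<iota> (monom (UP R) (r \<oplus>\<^bsub>R\<^esub> s) 0)"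
  "\<lbrakk>r \<in> carrier R; s \<in> carrier R\<rbrakk> \<Longrightarrow>
    r \<odot>\<^bsub>A_alg R \<iota> 0\<^esub> \<iota> (monom (UP R) s 0) = \<iota> (monom (UP R) (r \<otimes>\<^bsub>R\<^esub> s) 0)"
  "grade (A_alg R \<iota> 0) k = (\<lambda>r. \<iota> (monom (UP R) r 0)) ` (if k = 0 then carrier R else {\<zero>\<^bsub>R\<^esub>})"
  by (simp_all add: A_alg_def copy_alg_def ground_alg_def Let_def \<iota>_monom_inv)

lemma A_alg_pos:
  assumes n: "n > 0"
  shows "carrier (A_alg R \<iota> n) = \<iota> ` up R"
  "one (A_alg R \<iota> n) = \<iota> (\<lambda>i. if i = 0 then \<one>\<^bsub>R\<^esub> else \<zero>\<^bsub>R\<^esub>)"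
  "zero (A_alg R \<iota> n) = \<iota> (\<lambda>i. \<zero>\<^bsub>R\<^esub>)"
  "\<lbrakk>p \<in> up R; q \<in> up R\<rbrakk> \<Longrightarrow> \<iota> p \<otimes>\<^bsub>A_alg R \<iota> n\<^esub> \<iota> q = \<iota> (\<lambda>n. \<Oplus>\<^bsub>R\<^esub>i \<in> {..n}. p i \<otimes>\<^bsub>R\<^esub> q (n - i))"
  "\<lbrakk>p \<in> up R; q \<in> up R\<rbrakk> \<Longrightarrow> \<iota> p \<oplus>\<^bsub>A_alg R \<iota> n\<^esub> \<iota> q = \<iota> (\<lambda>n. p n \<oplus>\<^bsub>R\<^esub> q n)"
  "\<lbrakk>r \<in> carrier R; q \<in> up R\<rbrakk> \<Longrightarrow> r \<odot>\<^bsub>A_alg R \<iota> n\<^esub> \<iota> q = \<iota> (\<lambda>n. r \<otimes>\<^bsub>R\<^esub> q n)"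
  "grade (A_alg R \<iota> n) k = \<iota> ` {p \<in> up R. \<forall>j. p j \<noteq> \<zero>\<^bsub>R\<^esub> \<longrightarrow> j * n = k}"
  using n by (auto simp: A_alg_def copy_alg_def poly_alg_def Let_def UP_eval \<iota>_inv)

lemma letters_degree_A_free:
  "letters_degree (\<lambda>_ d. d = n) w k \<longleftrightarrow> length w * n = k"
  by (induction w arbitrary: k) (auto simp: letters_degree_Cons)

lemma A_map_surj: "A_map n ` carrier (FA n) = carrier (A n)"
proof (cases "n = 0")
  case True
  have "\<exists>p\<in>carrier (FA 0). p [] = r" if "r \<in> carrier R" for r
  proof (rule bexI)
    show "r \<odot>\<^bsub>FA 0\<^esub> \<one>\<^bsub>FA 0\<^esub> \<in> carrier (FA 0)" using that by simp
    show "(r \<odot>\<^bsub>FA 0\<^esub> \<one>\<^bsub>FA 0\<^esub>) [] = r" using that by (simp add: A_free_simps word_def)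
  qed
  then have "(\<lambda>p. p []) ` carrier (FA 0) = carrier R"
    using A_free_coeff_closed by auto
  moreover have "A_map 0 ` carrier (FA 0) = (\<lambda>r. \<iota> (monom (UP R) r 0)) ` (\<lambda>p. p []) ` carrier (FA 0)"
    unfolding image_image by (rule image_cong) (simp_all add: A_map_def coefficients_F0)
  ultimately show ?thesis using True by (simp add: A_alg_0)
next
  case False
  have "coefficients ` carrier (FA n) = up R"
    using coefficients_closed coefficients_surj False by blast
  moreover have "A_map n ` carrier (FA n) = \<iota> ` coefficients ` carrier (FA n)"
    unfolding image_image by (rule image_cong) (simp_all add: A_map_def)
  ultimately show ?thesis using False by (simp add: A_alg_pos)
qed

lemma A_map_inj: "inj_on (A_map n) (carrier (FA n))"
proof (rule inj_onI)
  fix p q assume pq: "p \<in> carrier (FA n)" "q \<in> carrier (FA n)" "A_map n p = A_map n q"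
  then have "coefficients p = coefficients q"
    using inj coefficients_closed[OF pq(1)] coefficients_closed[OF pq(2)] by (auto simp: inj_on_def A_map_def UP_eval(1))
  then show "p = q" by (rule coefficients_inj)
qed

lemma A_map_hom:
  "\<lbrakk>x \<in> carrier (FA n); y \<in> carrier (FA n)\<rbrakk> \<Longrightarrow> A_map n (x \<oplus>\<^bsub>FA n\<^esub> y) = A_map n x \<oplus>\<^bsub>A n\<^esub> A_map n y"
  "\<lbrakk>x \<in> carrier (FA n); y \<in> carrier (FA n)\<rbrakk> \<Longrightarrow> A_map n (x \<otimes>\<^bsub>FA n\<^esub> y) = A_map n x \<otimes>\<^bsub>A n\<^esub> A_map n y"
  "\<lbrakk>r \<in> carrier R; x \<in> carrier (FA n)\<rbrakk> \<Longrightarrow> A_map n (r \<odot>\<^bsub>FA n\<^esub> x) = r \<odot>\<^bsub>A n\<^esub> A_map n x"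
  "A_map n \<one>\<^bsub>FA n\<^esub> = \<one>\<^bsub>A n\<^esub>" "A_map n \<zero>\<^bsub>FA n\<^esub> = \<zero>\<^bsub>A n\<^esub>"
proof -
  have one: "coefficients \<one>\<^bsub>FA n\<^esub> = (\<lambda>i. if i = 0 then \<one>\<^bsub>R\<^esub> else \<zero>\<^bsub>R\<^esub>)" for n
    by (auto simp: coefficients_def A_free_simps word_def)
  show "A_map n (x \<oplus>\<^bsub>FA n\<^esub> y) = A_map n x \<oplus>\<^bsub>A n\<^esub> A_map n y" if xy: "x \<in> carrier (FA n)" "y \<in> carrier (FA n)"
  proof (cases "n = 0")
    case True
    then show ?thesis
      using xy A_free_coeff_closed[OF xy(1)] A_free_coeff_closed[OF xy(2)] FA.M.a_closed[OF xy]
      by (simp add: A_map_def coefficients_F0 A_alg_0, simp add: A_free_simps)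
  next
    case False
    have "coefficients (x \<oplus>\<^bsub>FA n\<^esub> y) = (\<lambda>k. coefficients x k \<oplus>\<^bsub>R\<^esub> coefficients y k)"
      by (simp add: coefficients_def A_free_simps)
    then show ?thesis using xy False by (simp add: A_map_def A_alg_pos coefficients_closed)
  qed
  show "A_map n (x \<otimes>\<^bsub>FA n\<^esub> y) = A_map n x \<otimes>\<^bsub>A n\<^esub> A_map n y" if xy: "x \<in> carrier (FA n)" "y \<in> carrier (FA n)"
  proof (cases "n = 0")
    case True
    have "(x \<otimes>\<^bsub>FA n\<^esub> y) [] = x [] \<otimes>\<^bsub>R\<^esub> y []"
      using A_free_coeff_closed[OF xy(1)] A_free_coeff_closed[OF xy(2)]
      by (simp add: A_free_simps R.convolution_Nil)
    then show ?thesis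
      using xy True A_free_coeff_closed[OF xy(1)] A_free_coeff_closed[OF xy(2)] FA.m_closed[OF xy]
      by (simp add: A_map_def coefficients_F0 A_alg_0)
  next
    case False
    then show ?thesis using xy by (simp add: A_map_def A_alg_pos coefficients_closed coefficients_mult)
  qed
  show "A_map n (r \<odot>\<^bsub>FA n\<^esub> x) = r \<odot>\<^bsub>A n\<^esub> A_map n x" if rx: "r \<in> carrier R" "x \<in> carrier (FA n)"
  proof (cases "n = 0")
    case True
    then show ?thesis
      using rx A_free_coeff_closed[OF rx(2)] FA.smult_closed[OF rx]
      by (simp add: A_map_def coefficients_F0 A_alg_0, simp add: A_free_simps)
  next
    case False
    have "coefficients (r \<odot>\<^bsub>FA n\<^esub> x) = (\<lambda>k. r \<otimes>\<^bsub>R\<^esub> coefficients x k)"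
      by (simp add: coefficients_def A_free_simps)
    then show ?thesis using rx False by (simp add: A_map_def A_alg_pos coefficients_closed)
  qed
  show "A_map n \<one>\<^bsub>FA n\<^esub> = \<one>\<^bsub>A n\<^esub>"
    by (cases "n = 0") (simp_all add: A_map_def one A_alg_0 A_alg_pos UP_eval)
  have "coefficients \<zero>\<^bsub>FA n\<^esub> = (\<lambda>i. \<zero>\<^bsub>R\<^esub>)"
    by (simp add: coefficients_def A_free_simps)
  then show "A_map n \<zero>\<^bsub>FA n\<^esub> = \<zero>\<^bsub>A n\<^esub>"
    by (cases "n = 0") (simp_all add: A_map_def A_alg_0 A_alg_pos UP_eval)
qed

lemma A_map_grade: "grade (A n) k = A_map n ` grade (FA n) k"
proof -
  have gF: "p \<in> grade (FA n) k \<longleftrightarrow> p \<in> carrier (FA n) \<and> (\<forall>j. coefficients p j \<noteq> \<zero>\<^bsub>R\<^esub> \<longrightarrow> j * n = k)" for p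
  proof -
    have "(\<forall>w. p w \<noteq> \<zero>\<^bsub>R\<^esub> \<longrightarrow> length w * n = k) \<longleftrightarrow> (\<forall>j. coefficients p j \<noteq> \<zero>\<^bsub>R\<^esub> \<longrightarrow> j * n = k)"
    proof (intro iffI allI impI)
      fix j assume "\<forall>w. p w \<noteq> \<zero>\<^bsub>R\<^esub> \<longrightarrow> length w * n = k" "coefficients p j \<noteq> \<zero>\<^bsub>R\<^esub>"
      from this(1)[rule_format, of "replicate j ()"] this(2) show "j * n = k"
        by (simp add: coefficients_def)
    next
      fix w assume "\<forall>j. coefficients p j \<noteq> \<zero>\<^bsub>R\<^esub> \<longrightarrow> j * n = k" "p w \<noteq> \<zero>\<^bsub>R\<^esub>"
      then show "length w * n = k" by (simp add: coefficients_length)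
    qed
    then show ?thesis by (simp add: A_free_def free_galg_simps(2) letters_degree_A_free)
  qed
  show ?thesis
  proof (cases "n = 0")
    case n: False
    show ?thesis
    proof
      show "grade (A n) k \<subseteq> A_map n ` grade (FA n) k"
      proof
        fix y assume "y \<in> grade (A n) k"
        then obtain q where q: "q \<in> up R" "\<forall>j. q j \<noteq> \<zero>\<^bsub>R\<^esub> \<longrightarrow> j * n = k" "y = \<iota> q" using n by (auto simp: A_alg_pos)
        obtain p where p: "p \<in> carrier (FA n)" "coefficients p = q" using coefficients_surj q(1) n by blast
        then have "p \<in> grade (FA n) k" "A_map n p = y" using q gF by (auto simp: A_map_def)
        then show "y \<in> A_map n ` grade (FA n) k" by blast
      qed
      show "A_map n ` grade (FA n) k \<subseteq> grade (A n) k"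
        using n by (auto simp: A_alg_pos gF A_map_def coefficients_closed)
    qed
  next
    case n: True
    show ?thesis
    proof (cases "k = 0")
      case True
      have "grade (FA n) k = carrier (FA n)" using gF n True by auto
      moreover have "grade (A n) k = carrier (A n)" using n True by (simp add: A_alg_0)
      ultimately show ?thesis using A_map_surj by simp
    next
      case False
      have "p \<in> grade (FA n) k \<longleftrightarrow> p = \<zero>\<^bsub>FA n\<^esub>" for p
      proof
        assume "p \<in> grade (FA n) k"
        then have "coefficients p j = \<zero>\<^bsub>R\<^esub>" for j using n False unfolding gF by auto
        then have "p w = \<zero>\<^bsub>R\<^esub>" for w by (metis coefficients_length)
        then show "p = \<zero>\<^bsub>FA n\<^esub>" by (auto simp: A_free_simps)
      qed (simp add: FA.grade_zero)
      then have "grade (FA n) k = {\<zero>\<^bsub>FA n\<^esub>}" by blast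
      then show ?thesis using n False by (simp add: A_map_hom(5)) (simp add: A_alg_0)
    qed
  qed
qed

lemma A_graded_algebra: "graded_algebra R (A n)"
  by (rule graded_algebra_surjective_image[OF FA.graded_algebra_axioms A_map_surj A_map_hom A_map_grade])

interpretation A: graded_algebra R "A n" for n by (rule A_graded_algebra)

lemma A_map_mor: "A_map n \<in> mor R (FA n) (A n)"
proof (rule morI)
  show "A_map n x \<in> carrier (A n)" if "x \<in> carrier (FA n)" for x using that A_map_surj by blast
  show "A_map n x \<in> grade (A n) k" if "x \<in> grade (FA n) k" for x k using that A_map_grade by blast
  show "A_map n \<in> extensional (carrier (FA n))" by (simp add: A_map_def)
qed (simp_all only: A_map_hom)

lemma A_map_bij: "bij_betw (A_map n) (carrier (FA n)) (carrier (A n))"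
  unfolding bij_betw_def using A_map_inj A_map_surj by blast

lemma A_connected_algebra: "connected_algebra R (A n)"
proof (rule connected_algebra_iso[OF _ A_graded_algebra A_map_mor A_map_bij])
  show "connected_algebra R (FA n)"
    unfolding A_free_def
    by (rule R.free_galg_connected[where \<delta> = "\<lambda>_. n"]) (auto split: if_splits)
  show "grade (A n) k \<subseteq> A_map n ` grade (FA n) k" for k by (rule equalityD1[OF A_map_grade])
qed

lemma gen_eq: "n > 0 \<Longrightarrow> gen R \<iota> = A_map n (word R [()])" "n > 0 \<Longrightarrow> word R [()] \<in> grade (FA n) n"
proof -
  assume n: "n > 0"
  have w: "word R [()] \<in> carrier (FA n)" unfolding A_free_def by (rule R.word_closed) (use n in simp)
  then show "word R [()] \<in> grade (FA n) n"
    by (auto simp: A_free_def free_galg_simps(2) letters_degree_A_free word_def)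
  have "coefficients (word R [()]) = monom (UP R) \<one>\<^bsub>R\<^esub> 1"
  proof
    fix k
    have "replicate k () = [()] \<longleftrightarrow> k = 1" by (cases k) simp_all
    then show "coefficients (word R [()]) k = monom (UP R) \<one>\<^bsub>R\<^esub> 1 k"
      by (simp add: coefficients_def word_def UP_eval(8))
  qed
  then show "gen R \<iota> = A_map n (word R [()])" using w by (simp add: gen_def A_map_def)
qed

lemma gen_grade: "n > 0 \<Longrightarrow> gen R \<iota> \<in> grade (A n) n"
  using gen_eq morD(6)[OF A_map_mor] by simp

lemma gen_closed: "n > 0 \<Longrightarrow> gen R \<iota> \<in> carrier (A n)"
  by (rule A.grade_carrier[OF gen_grade])

text \<open>The universal property of \<open>R[X]\<close>, with values in algebras that need not be commutative: the
  comultiplication takes values in a free product. It comes from that of the free algebra on one letter.\<close>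

lemma A_mor_exists:
  assumes C: "graded_algebra R C" and c: "n > 0 \<Longrightarrow> c \<in> grade C n"
  obtains f where "f \<in> mor R (A n) C" "n > 0 \<Longrightarrow> f (gen R \<iota>) = c"
proof -
  interpret C: graded_algebra R C by fact
  obtain g where g: "g \<in> mor R (A n) (FA n)" and gh: "\<And>x. x \<in> carrier (FA n) \<Longrightarrow> g (A_map n x) = x"
    by (rule graded_iso_inverse[OF FA.graded_algebra_axioms[of n] A_graded_algebra[of n] A_map_mor A_map_bij equalityD1[OF A_map_grade]])
      (rule that)
  obtain f where f: "f \<in> mor R (FA n) C" and fl: "\<And>l. l \<in> (if n = 0 then {} else {()}) \<Longrightarrow> f (word R [l]) = c"
    unfolding A_free_def
    by (rule C.free_galg_mor_exists[of "if n = 0 then {} else {()}" "\<lambda>_. c" "\<lambda>_ d. d = n"])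
      (use c C.grade_carrier in \<open>auto split: if_splits\<close>)
  have "compose (carrier (A n)) f g (gen R \<iota>) = c" if "n > 0"
    using gen_closed[OF that] gen_eq[OF that] gh FA.grade_carrier[OF gen_eq(2)[OF that]] fl[of "()"] that
    by (simp add: compose_eq)
  with mor_comp[OF A_graded_algebra g f] show thesis by (rule that)
qed

lemma A_mor_eqI:
  assumes C: "graded_algebra R C" and f: "f \<in> mor R (A n) C" and g: "g \<in> mor R (A n) C"
    and eq: "n > 0 \<Longrightarrow> f (gen R \<iota>) = g (gen R \<iota>)"
  shows "f = g"
proof (rule mor_eqI[OF f g])
  have eqF: "compose (carrier (FA n)) f (A_map n) = compose (carrier (FA n)) g (A_map n)"
  proof (rule free_galg_mor_eqI[OF C])
    show "compose (carrier (FA n)) f (A_map n) \<in> mor R (free_galg R (if n = 0 then {} else {()}) (\<lambda>_ d. d = n)) C"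
      "compose (carrier (FA n)) g (A_map n) \<in> mor R (free_galg R (if n = 0 then {} else {()}) (\<lambda>_ d. d = n)) C"
      using mor_comp[OF FA.graded_algebra_axioms A_map_mor f] mor_comp[OF FA.graded_algebra_axioms A_map_mor g]
      by (simp_all add: A_free_def)
    show "compose (carrier (FA n)) f (A_map n) (word R [l]) = compose (carrier (FA n)) g (A_map n) (word R [l])"
      if "l \<in> (if n = 0 then {} else {()})" for l
      using that eq gen_eq[of n] FA.grade_carrier[OF gen_eq(2)[of n]] by (simp add: compose_eq split: if_splits)
  qed
  have fg: "f (A_map n p) = g (A_map n p)" if "p \<in> carrier (FA n)" for p
    using fun_cong[OF eqF, of p]
    by (simp add: compose_eq[OF that])
  fix x assume "x \<in> carrier (A n)"
  then have "x \<in> A_map n ` carrier (FA n)" by (simp only: A_map_surj)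
  then show "f x = g x" by (elim imageE) (simp only: fg)
qed

lemma A_grade_cases:
  assumes n: "n > 0" and y: "y \<in> grade (A n) k" "y \<noteq> \<zero>\<^bsub>A n\<^esub>"
  obtains r j where "r \<in> carrier R" "j * n = k" "y = r \<odot>\<^bsub>A n\<^esub> gen R \<iota> [^]\<^bsub>A n\<^esub> (j::nat)"
proof -
  obtain p where p: "p \<in> grade (FA n) k" "y = A_map n p" using y A_map_grade by blast
  have pc: "p \<in> carrier (FA n)" by (rule FA.grade_carrier[OF p(1)])
  have supp: "length w * n = k" if "p w \<noteq> \<zero>\<^bsub>R\<^esub>" for w
    using p(1) that by (simp add: A_free_def free_galg_simps(2) letters_degree_A_free)
  have "p \<noteq> \<zero>\<^bsub>FA n\<^esub>" using y(2) p(2) A_map_hom(5) by auto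
  then obtain w where w: "p w \<noteq> \<zero>\<^bsub>R\<^esub>" by (auto simp: A_free_simps fun_eq_iff)
  have "p v = \<zero>\<^bsub>R\<^esub>" if "v \<noteq> w" for v
    using supp[of v] supp[OF w] that n by (metis mult_cancel2 not_gr_zero unit_list_eq)
  then have pw: "p = p w \<odot>\<^bsub>FA n\<^esub> word R w"
    using A_free_coeff_closed[OF pc] by (auto simp: A_free_simps word_def fun_eq_iff)
  have word: "A_map n (word R v) = gen R \<iota> [^]\<^bsub>A n\<^esub> length v \<and> word R v \<in> carrier (FA n)" for v
  proof (induction v)
    case Nil
    have "word R [] = \<one>\<^bsub>FA n\<^esub>" by (simp add: A_free_simps)
    then show ?case using A_map_hom(4) by simp
  next
    case (Cons l v)
    have eq: "word R (l # v) = word R [()] \<otimes>\<^bsub>FA n\<^esub> word R v"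
      using R.convolution_word[of "[()]" v] by (simp add: A_free_simps)
    show ?case
      unfolding eq using Cons FA.grade_carrier[OF gen_eq(2)[OF n]] gen_eq(1)[OF n] gen_closed[OF n]
        A.nat_pow_Suc2[of "gen R \<iota>" n "length v"]
      by (simp add: A_map_hom(2)[of "word R [()]" n "word R v"] del: A_cogroup_simps)
  qed
  have "y = p w \<odot>\<^bsub>A n\<^esub> gen R \<iota> [^]\<^bsub>A n\<^esub> length w"
    unfolding p(2) by (subst pw, subst A_map_hom(3)) (use A_free_coeff_closed[OF pc] word in auto)
  then show thesis using that[of "p w" "length w"] supp[OF w] A_free_coeff_closed[OF pc] by blast
qed

lemma gen_nonzero: "n > 0 \<Longrightarrow> gen R \<iota> \<noteq> \<zero>\<^bsub>A n\<^esub>"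
proof
  assume n: "n > 0" and "gen R \<iota> = \<zero>\<^bsub>A n\<^esub>"
  then have "A_map n (word R [()]) = A_map n \<zero>\<^bsub>FA n\<^esub>" using gen_eq(1)[OF n] A_map_hom(5) by simp
  then have "word R [()] = \<zero>\<^bsub>FA n\<^esub>"
    using A_map_inj FA.grade_carrier[OF gen_eq(2)[OF n]] FA.M.zero_closed by (auto simp: inj_on_def)
  from fun_cong[OF this, of "[()]"] show False by (simp add: A_free_simps word_def)
qed

lemma A_grade_0_pos: "k > 0 \<Longrightarrow> grade (A 0) k = {\<zero>\<^bsub>A 0\<^esub>}"
  by (simp add: A_alg_0)

text \<open>The comultiplication is defined by a unique description in terms of the underlying algebra; the free
  products of the algebra and of the cogroup coincide because they use the same operations.\<close>

lemma A_comult_properties: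
  shows "A_comult R \<iota> n \<in> mor R (A n) (free_product R (A n) (A n))"
    and "n > 0 \<Longrightarrow> A_comult R \<iota> n (gen R \<iota>) =
      incl1 R (A n) (A n) (gen R \<iota>) \<oplus>\<^bsub>free_product R (A n) (A n)\<^esub> incl2 R (A n) (A n) (gen R \<iota>)"
proof -
  let ?A = "A_alg R \<iota> n"
  have rel: "hom_relations R L ?A j = hom_relations R L (A n) j" for L and j :: "'u \<Rightarrow> 'l"
    by (simp add: hom_relations_def)
  have cov: "free_product_cover R ?A ?A = free_product_cover R (A n) (A n)"
    by (simp add: free_product_cover_def)
  have idl: "free_product_ideal R ?A ?A = free_product_ideal R (A n) (A n)"
    by (simp add: free_product_ideal_def rel cov)
  have wd: "word_degree ?A ?A = word_degree (A n) (A n)"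
    by (simp add: word_degree_def fun_eq_iff)
  have fp: "free_product R ?A ?A = free_product R (A n) (A n)"
    by (simp add: free_product_def cov idl wd)
  have i: "incl1 R ?A ?A = incl1 R (A n) (A n)" "incl2 R ?A ?A = incl2 R (A n) (A n)"
    by (simp_all add: incl1_def incl2_def cov idl)
  have m: "mor R ?A C = mor R (A n) C" for C :: "('r, 'd, 'z) galg_scheme"
    by (simp add: mor_def ring_hom_def)
  let ?P = "free_product R (A n) (A n)"
  let ?c = "incl1 R (A n) (A n) (gen R \<iota>) \<oplus>\<^bsub>?P\<^esub> incl2 R (A n) (A n) (gen R \<iota>)"
  note P = free_product_graded_algebra[OF A_graded_algebra[of n] A_graded_algebra[of n]]
  interpret P: graded_algebra R ?P by (rule P)
  have c: "?c \<in> grade ?P n" if "n > 0"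
    by (rule P.grade_add[OF morD(6)[OF incl1_mor[OF A_graded_algebra A_graded_algebra] gen_grade[OF that]]
      morD(6)[OF incl2_mor[OF A_graded_algebra A_graded_algebra] gen_grade[OF that]]])
  obtain f where f: "f \<in> mor R (A n) ?P" "n > 0 \<Longrightarrow> f (gen R \<iota>) = ?c"
    by (rule A_mor_exists[OF P c]) auto
  have "A_comult R \<iota> n = (THE \<Phi>. \<Phi> \<in> mor R (A n) ?P \<and> (n > 0 \<longrightarrow> \<Phi> (gen R \<iota>) = ?c))"
    by (simp add: A_comult_def Let_def fp i m)
  also have "\<dots> = f"
  proof (rule the_equality)
    show "f \<in> mor R (A n) ?P \<and> (n > 0 \<longrightarrow> f (gen R \<iota>) = ?c)" using f by blast
    fix g assume g: "g \<in> mor R (A n) ?P \<and> (n > 0 \<longrightarrow> g (gen R \<iota>) = ?c)"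
    show "g = f"
      by (rule A_mor_eqI[OF P conjunct1[OF g] f(1)]) (simp only: f(2) g)
  qed
  finally show "A_comult R \<iota> n \<in> mor R (A n) ?P" "n > 0 \<Longrightarrow> A_comult R \<iota> n (gen R \<iota>) = ?c"
    using f by auto
qed

(* From here on terms are kept in terms of the cogroup, not of its underlying algebra. *)
declare A_cogroup_simps [simp del]

section \<open>The objects A(n) and their morphisms\<close>

private abbreviation (input) "X \<equiv> gen R \<iota>"

interpretation A: connected_algebra R "A n" for n by (rule A_connected_algebra)

lemma A_comult_mor: "comult (A n) \<in> mor R (A n) (free_product R (A n) (A n))"
  using A_comult_properties(1)[of n] by (simp add: A_cogroup_simps(8))

lemma A_comult_gen: "n > 0 \<Longrightarrow> comult (A n) X =
    incl1 R (A n) (A n) X \<oplus>\<^bsub>free_product R (A n) (A n)\<^esub> incl2 R (A n) (A n) X"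
  using A_comult_properties(2)[of n] by (simp add: A_cogroup_simps(8))

text \<open>On the generator both sides are the sum of its three images.\<close>

lemma A_coassociative: "coassociative R (A n)"
proof -
  note G = A.graded_algebra_axioms[of n]
  let ?P = "free_product R (A n) (A n)"
  have P: "graded_algebra R ?P" by (rule free_product_graded_algebra[OF G G])
  let ?Q = "free_product R (A n) ?P"
  have Q: "graded_algebra R ?Q" by (rule free_product_graded_algebra[OF G P])
  note D = A_comult_mor[of n] and I = id_mor_mor[OF G] and c = assoc_mor_properties[OF G]
  note l = free_product_mor_properties[OF G G P G D I]
  note r = free_product_mor_properties[OF G G G P I D]
  let ?f = "compose (carrier (A n)) (assoc_mor R (A n))
       (compose (carrier (A n)) (free_product_mor R (A n) (A n) ?P (A n) (comult (A n)) (id_mor (A n))) (comult (A n)))"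
  let ?g = "compose (carrier (A n)) (free_product_mor R (A n) (A n) (A n) ?P (id_mor (A n)) (comult (A n))) (comult (A n))"
  have "?f = ?g"
  proof (rule A_mor_eqI[OF Q])
    show "?f \<in> mor R (A n) ?Q" by (rule mor_comp[OF G mor_comp[OF G D l(1)] c(1)])
    show "?g \<in> mor R (A n) ?Q" by (rule mor_comp[OF G D r(1)])
    assume n: "n > 0"
    have X: "X \<in> carrier (A n)" by (rule gen_closed[OF n])
    note i1 = incl1_mor[OF G G] and i2 = incl2_mor[OF G G]
    have X1: "incl1 R (A n) (A n) X \<in> carrier ?P" and X2: "incl2 R (A n) (A n) X \<in> carrier ?P"
      by (rule morD(1)[OF i1 X], rule morD(1)[OF i2 X])
    let ?a = "incl1 R (A n) ?P X" and ?b = "incl2 R (A n) ?P (incl1 R (A n) (A n) X)"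
      and ?c = "incl2 R (A n) ?P (incl2 R (A n) (A n) X)"
    note j1 = incl1_mor[OF P G] and j2 = incl2_mor[OF P G]
    have "?f X = assoc_mor R (A n) (incl1 R ?P (A n) (comult (A n) X) \<oplus>\<^bsub>free_product R ?P (A n)\<^esub> incl2 R ?P (A n) X)"
      using X X1 X2 by (simp add: compose_eq A_comult_gen[OF n] morD(2)[OF l(1)] l(2,3))
    also have "\<dots> = (?a \<oplus>\<^bsub>?Q\<^esub> ?b) \<oplus>\<^bsub>?Q\<^esub> ?c"
      using X X1 X2 unfolding A_comult_gen[OF n]
      by (simp add: morD(2)[OF j1] morD(2)[OF c(1)] morD(1)[OF j1] morD(1)[OF j2] c(2-4)
        morD(1)[OF free_product_graded_algebra[OF P G, THEN id_mor_mor]]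
        ring.ring_simprules(1)[OF graded_algebra.axioms(2)[OF free_product_graded_algebra[OF P G]]])
    also have "\<dots> = ?a \<oplus>\<^bsub>?Q\<^esub> (?b \<oplus>\<^bsub>?Q\<^esub> ?c)"
    proof -
      interpret Q: graded_algebra R ?Q by (rule Q)
      show ?thesis
        by (rule Q.M.a_assoc)
          (use X X1 X2 morD(1)[OF incl1_mor[OF G P]] morD(1)[OF incl2_mor[OF G P]] in auto)
    qed
    also have "\<dots> = ?g X"
      using X X1 X2 by (simp add: compose_eq A_comult_gen[OF n] morD(2)[OF r(1)] r(2,3) morD(2)[OF incl2_mor[OF G P]])
    finally show "?f X = ?g X" .
  qed
  then show ?thesis by (simp add: coassociative_def Let_def)
qed

lemma A_aug_gen: "n > 0 \<Longrightarrow> augmentation R (A n) X = \<zero>\<^bsub>R\<^esub>"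
  by (rule A.aug_positive[OF gen_grade]) auto

lemma A_trivial:
  "trivial_mor R (A n) (A n) \<in> mor R (A n) (A n)" "n > 0 \<Longrightarrow> trivial_mor R (A n) (A n) X = \<zero>\<^bsub>A n\<^esub>"
  using trivial_mor_mor[OF A.connected_algebra_axioms A.graded_algebra_axioms]
    trivial_mor_apply[OF A.connected_algebra_axioms A.graded_algebra_axioms gen_closed] A_aug_gen
  by auto

text \<open>The form common to the counit and inverse laws of \<open>A(n)\<close>.\<close>

lemma A_copair_comult:
  assumes f: "f \<in> mor R (A n) (A n)" and g: "g \<in> mor R (A n) (A n)" and h: "h \<in> mor R (A n) (A n)"
    and eq: "n > 0 \<Longrightarrow> f X \<oplus>\<^bsub>A n\<^esub> g X = h X"
  shows "compose (carrier (A n)) (copair R (A n) (A n) (A n) f g) (comult (A n)) = h"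
proof -
  note G = A.graded_algebra_axioms[of n]
  note c = copair_properties[OF G G G f g]
  show ?thesis
  proof (rule A_mor_eqI[OF G mor_comp[OF G A_comult_mor c(1)] h])
    assume n: "n > 0"
    have X: "X \<in> carrier (A n)" by (rule gen_closed[OF n])
    show "compose (carrier (A n)) (copair R (A n) (A n) (A n) f g) (comult (A n)) X = h X"
      using X morD(1)[OF incl1_mor[OF G G] X] morD(1)[OF incl2_mor[OF G G] X]
      by (simp add: compose_eq A_comult_gen[OF n] morD(2)[OF c(1)] c(2,3) eq[OF n])
  qed
qed

lemma A_is_cogroup: "is_cogroup R (A n)"
proof -
  note G = A.graded_algebra_axioms[of n]
  note I = id_mor_mor[OF G] and T = A_trivial(1)[of n]
  have u: "n > 0 \<Longrightarrow> \<ominus>\<^bsub>A n\<^esub> X \<in> grade (A n) n"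
    by (rule A.grade_uminus[OF gen_grade])
  obtain \<nu> where \<nu>: "\<nu> \<in> mor R (A n) (A n)" "n > 0 \<Longrightarrow> \<nu> X = \<ominus>\<^bsub>A n\<^esub> X"
    by (rule A_mor_exists[OF G u]) (assumption | rule that)+
  have "counital R (A n)"
    unfolding counital_def
    by (intro conjI A_copair_comult I T) (simp_all add: A_trivial(2) gen_closed)
  moreover have "coinverse R (A n) \<nu>"
    unfolding coinverse_def
    by (intro conjI A_copair_comult I T \<nu>(1))
      (simp_all add: A_trivial(2) \<nu>(2) gen_closed A.M.r_neg A.M.l_neg)
  ultimately show ?thesis
    unfolding is_cogroup_def connected_algebra_iff
    using A.connected_algebra_axioms A_comult_mor A_coassociative by blast
qed

interpretation A: counital_algebra R "A n" "comult (A n)" for n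
  by (rule cogroup_counital_algebra[OF K A_is_cogroup])

lemma gen_primitive: "n > 0 \<Longrightarrow> A.primitive n X"
  unfolding A.primitive_def using gen_closed A_comult_gen by blast

text \<open>\<open>R[X]\<close> is commutative, and the sign in the commutation rule is \<open>1\<close>: nonzero homogeneous elements have
  degrees divisible by \<open>n\<close>, so a sign \<open>-1\<close> can only occur for odd \<open>n\<close>, that is, in characteristic \<open>2\<close>.\<close>

lemma A_graded_commutative:
  assumes n: "even n \<or> ring_char R = 2"
  shows "graded_commutative (A n)"
  unfolding graded_commutative_def
proof (intro allI ballI)
  fix p q x y assume x: "x \<in> grade (A n) p" and y: "y \<in> grade (A n) q"
  have xc: "x \<in> carrier (A n)" and yc: "y \<in> carrier (A n)" using x y A.grade_carrier by auto
  show "x \<otimes>\<^bsub>A n\<^esub> y = (\<ominus>\<^bsub>A n\<^esub> \<one>\<^bsub>A n\<^esub>) [^]\<^bsub>A n\<^esub> (p * q) \<otimes>\<^bsub>A n\<^esub> (y \<otimes>\<^bsub>A n\<^esub> x)"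
  proof (cases "x = \<zero>\<^bsub>A n\<^esub> \<or> y = \<zero>\<^bsub>A n\<^esub>")
    case True
    then show ?thesis using xc yc by auto
  next
    case nz: False
    have comm: "x \<otimes>\<^bsub>A n\<^esub> y = y \<otimes>\<^bsub>A n\<^esub> x \<and> (odd (p * q) \<longrightarrow> odd n)"
    proof (cases "n = 0")
      case True
      then have "p = 0" "q = 0" using x y nz A_grade_0_pos by auto
      then obtain r s where rs: "r \<in> carrier R" "x = r \<odot>\<^bsub>A n\<^esub> \<one>\<^bsub>A n\<^esub>" "s \<in> carrier R" "y = s \<odot>\<^bsub>A n\<^esub> \<one>\<^bsub>A n\<^esub>"
        using A.grade_0E[of x n] A.grade_0E[of y n] x y by metis
      then show ?thesis
        using \<open>p = 0\<close> by (simp add: A.smult_one_mult A.smult_assoc1[symmetric] R.m_comm)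
    next
      case False
      then have n0: "n > 0" by simp
      have X: "X \<in> carrier (A n)" by (rule gen_closed[OF n0])
      obtain r i where r: "r \<in> carrier R" "i * n = p" "x = r \<odot>\<^bsub>A n\<^esub> X [^]\<^bsub>A n\<^esub> (i::nat)"
        using A_grade_cases[OF n0 x] nz by blast
      obtain s j where s: "s \<in> carrier R" "j * n = q" "y = s \<odot>\<^bsub>A n\<^esub> X [^]\<^bsub>A n\<^esub> (j::nat)"
        using A_grade_cases[OF n0 y] nz by blast
      have "x \<otimes>\<^bsub>A n\<^esub> y = y \<otimes>\<^bsub>A n\<^esub> x"
        using r s X by (simp add: A.smult_mult_left A.smult_mult_right A.smult_assoc1[symmetric]
          R.m_comm A.nat_pow_mult add.commute)
      then show ?thesis using r(2) by auto
    qed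
    have "\<ominus>\<^bsub>A n\<^esub> \<one>\<^bsub>A n\<^esub> = \<one>\<^bsub>A n\<^esub>" if "odd n"
    proof -
      have "\<one>\<^bsub>R\<^esub> \<oplus>\<^bsub>R\<^esub> \<one>\<^bsub>R\<^esub> = \<zero>\<^bsub>R\<^esub>" using n that ring_char_eq_2_iff[OF K] by blast
      then have "\<ominus>\<^bsub>R\<^esub> \<one>\<^bsub>R\<^esub> = \<one>\<^bsub>R\<^esub>" by (simp add: R.minus_equality)
      then show ?thesis by (simp add: A.uminus_eq_smult)
    qed
    then show ?thesis
      using comm xc yc by (auto simp: A.minus_one_power_cases)
  qed
qed

text \<open>Compatibility with the comultiplications is an equality of two morphisms out of \<open>A(n)\<close>, so only the
  generator matters.\<close>

lemma A_cogroup_mor_iff: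
  assumes B: "is_cogroup R B" and f: "f \<in> mor R (A n) B"
  shows "f \<in> cogroup_mor R (A n) B \<longleftrightarrow>
    (n > 0 \<longrightarrow> comult B (f X) = incl1 R B B (f X) \<oplus>\<^bsub>free_product R B B\<^esub> incl2 R B B (f X))"
proof -
  note B = is_cogroupD[OF B] and G = A.graded_algebra_axioms[of n]
  have P: "graded_algebra R (free_product R B B)" by (rule free_product_graded_algebra[OF B(2) B(2)])
  note m = free_product_mor_properties[OF G G B(2) B(2) f f]
  let ?l = "compose (carrier (A n)) (comult B) f"
  let ?r = "compose (carrier (A n)) (free_product_mor R (A n) (A n) B B f f) (comult (A n))"
  have l: "?l \<in> mor R (A n) (free_product R B B)" by (rule mor_comp[OF G f B(3)])
  have r: "?r \<in> mor R (A n) (free_product R B B)" by (rule mor_comp[OF G A_comult_mor m(1)])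
  have lX: "?l X = comult B (f X)"
    and rX: "?r X = incl1 R B B (f X) \<oplus>\<^bsub>free_product R B B\<^esub> incl2 R B B (f X)" if "n > 0"
  proof -
    have X: "X \<in> carrier (A n)" by (rule gen_closed[OF that])
    show "?l X = comult B (f X)" by (rule compose_eq[OF X])
    show "?r X = incl1 R B B (f X) \<oplus>\<^bsub>free_product R B B\<^esub> incl2 R B B (f X)"
      using X morD(1)[OF incl1_mor[OF G G] X] morD(1)[OF incl2_mor[OF G G] X]
      by (simp add: compose_eq A_comult_gen[OF that] morD(2)[OF m(1)] m(2,3))
  qed
  have "f \<in> cogroup_mor R (A n) B \<longleftrightarrow> ?l = ?r" using f by (simp add: cogroup_mor_def)
  also have "\<dots> \<longleftrightarrow> (n > 0 \<longrightarrow> ?l X = ?r X)"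
    using A_mor_eqI[OF P l r] by metis
  finally show ?thesis using lX rX by auto
qed

lemma trivial_cogroup_mor:
  assumes B: "is_cogroup R B"
  shows "trivial_mor R (A m) B \<in> cogroup_mor R (A m) B"
    and "m > 0 \<Longrightarrow> trivial_mor R (A m) B X = \<zero>\<^bsub>B\<^esub>"
proof -
  note BD = is_cogroupD[OF B]
  interpret B: graded_algebra R B by (rule BD(2))
  have P: "graded_algebra R (free_product R B B)" by (rule free_product_graded_algebra[OF BD(2) BD(2)])
  interpret P: graded_algebra R "free_product R B B" by (rule P)
  have t: "trivial_mor R (A m) B \<in> mor R (A m) B"
    by (rule trivial_mor_mor[OF A.connected_algebra_axioms BD(2)])
  show X: "trivial_mor R (A m) B X = \<zero>\<^bsub>B\<^esub>" if "m > 0"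
    using trivial_mor_apply[OF A.connected_algebra_axioms BD(2) gen_closed[OF that]] A_aug_gen[OF that] by simp
  show "trivial_mor R (A m) B \<in> cogroup_mor R (A m) B"
    unfolding A_cogroup_mor_iff[OF B t]
    by (simp add: X mor_zero[OF BD(3) BD(2) P] mor_zero[OF incl1_mor[OF BD(2) BD(2)] BD(2) P]
      mor_zero[OF incl2_mor[OF BD(2) BD(2)] BD(2) P])
qed

text \<open>For \<open>m > 0\<close> the generator goes to zero or to some \<open>r X\<^sup>j\<close> with \<open>jn = m\<close>. Here \<open>j \<ge> 2\<close>, since \<open>m > 0\<close> and \<open>m \<noteq> n\<close>,
  and then \<open>r = 0\<close> because the image of the generator is primitive.\<close>

lemma hom_trivial:
  assumes "\<not> (m = n \<and> n > 0)"
  shows "cogroup_mor R (A m) (A n) = {trivial_mor R (A m) (A n)}"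
proof -
  have "f = trivial_mor R (A m) (A n)" if f: "f \<in> cogroup_mor R (A m) (A n)" for f
  proof -
    have fm: "f \<in> mor R (A m) (A n)" using f by (rule cogroup_mor_mor)
    show ?thesis
    proof (rule A_mor_eqI[OF A.graded_algebra_axioms fm cogroup_mor_mor[OF trivial_cogroup_mor(1)[OF A_is_cogroup]]])
      assume m: "m > 0"
      have fX: "f X \<in> grade (A n) m" by (rule morD(6)[OF fm gen_grade[OF m]])
      have "f X = \<zero>\<^bsub>A n\<^esub>"
      proof (cases "n = 0")
        case True
        then show ?thesis using fX A_grade_0_pos[OF m] by simp
      next
        case False
        then have n: "n > 0" by simp
        show ?thesis
        proof (rule ccontr)
          assume "f X \<noteq> \<zero>\<^bsub>A n\<^esub>"
          then obtain r j where r: "r \<in> carrier R" "j * n = m" "f X = r \<odot>\<^bsub>A n\<^esub> X [^]\<^bsub>A n\<^esub> (j::nat)"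
            using A_grade_cases[OF n fX] by blast
          have "j \<noteq> 0" "j \<noteq> 1" using r(2) m assms n by auto
          then obtain k where k: "j = Suc (Suc k)" by (metis One_nat_def not0_implies_Suc)
          have "A.primitive n (f X)"
            unfolding A.primitive_def
            using A.grade_carrier[OF fX] f A_cogroup_mor_iff[OF A_is_cogroup fm] m by blast
          then have "r = \<zero>\<^bsub>R\<^esub>"
            using A.primitive_power_not_primitive[OF n gen_grade[OF n] gen_nonzero[OF n] gen_primitive[OF n] r(1)]
              r(3) k by simp
          then show False using r(3) \<open>f X \<noteq> \<zero>\<^bsub>A n\<^esub>\<close> gen_closed[OF n] by simp
        qed
      qed
      then show "f X = trivial_mor R (A m) (A n) X" using trivial_cogroup_mor(2)[OF A_is_cogroup m] by simp
    qed
  qed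
  then show ?thesis using trivial_cogroup_mor(1)[OF A_is_cogroup] by blast
qed

text \<open>The part of \<open>A(n)\<close> in degree \<open>n\<close> consists of the multiples of the generator, all of which are primitive.\<close>

lemma hom_scalars:
  assumes n: "n > 0"
  obtains \<phi> where "bij_betw \<phi> (carrier R) (cogroup_mor R (A n) (A n))"
    "\<And>r. r \<in> carrier R \<Longrightarrow> \<phi> r X = r \<odot>\<^bsub>A n\<^esub> X"
proof -
  note G = A.graded_algebra_axioms[of n]
  have X: "X \<in> carrier (A n)" by (rule gen_closed[OF n])
  have "\<exists>f. f \<in> mor R (A n) (A n) \<and> f X = r \<odot>\<^bsub>A n\<^esub> X" if r: "r \<in> carrier R" for r
  proof -
    obtain f where "f \<in> mor R (A n) (A n)" "n > 0 \<Longrightarrow> f X = r \<odot>\<^bsub>A n\<^esub> X"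
      by (rule A_mor_exists[OF G A.grade_smult[OF r gen_grade]]) (assumption | rule that)+
    then show ?thesis using n by blast
  qed
  then obtain \<phi> where \<phi>: "\<And>r. r \<in> carrier R \<Longrightarrow> \<phi> r \<in> mor R (A n) (A n)"
    "\<And>r. r \<in> carrier R \<Longrightarrow> \<phi> r X = r \<odot>\<^bsub>A n\<^esub> X" by metis
  have \<phi>c: "\<phi> r \<in> cogroup_mor R (A n) (A n)" if r: "r \<in> carrier R" for r
  proof -
    let ?P = "free_product R (A n) (A n)"
    interpret P: graded_algebra R ?P by (rule free_product_graded_algebra[OF G G])
    have "comult (A n) (r \<odot>\<^bsub>A n\<^esub> X) =
        incl1 R (A n) (A n) (r \<odot>\<^bsub>A n\<^esub> X) \<oplus>\<^bsub>?P\<^esub> incl2 R (A n) (A n) (r \<odot>\<^bsub>A n\<^esub> X)"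
      using X r morD(1)[OF incl1_mor[OF G G] X] morD(1)[OF incl2_mor[OF G G] X]
      by (simp add: morD(5)[OF A_comult_mor] A_comult_gen[OF n] morD(5)[OF incl1_mor[OF G G]]
        morD(5)[OF incl2_mor[OF G G]] P.smult_r_distr)
    then show ?thesis unfolding A_cogroup_mor_iff[OF A_is_cogroup \<phi>(1)[OF r]] \<phi>(2)[OF r] by blast
  qed
  have scal: "r = s" if "r \<in> carrier R" "s \<in> carrier R" "r \<odot>\<^bsub>A n\<^esub> X = s \<odot>\<^bsub>A n\<^esub> X" for r s
    using A.smult_cancel_nonzero[OF X gen_nonzero[OF n] that] .
  have "bij_betw \<phi> (carrier R) (cogroup_mor R (A n) (A n))"
    unfolding bij_betw_def
  proof
    show "inj_on \<phi> (carrier R)"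
      by (rule inj_onI) (metis \<phi>(2) scal)
    have "f \<in> \<phi> ` carrier R" if f: "f \<in> cogroup_mor R (A n) (A n)" for f
    proof -
      have fm: "f \<in> mor R (A n) (A n)" using f by (rule cogroup_mor_mor)
      have fX: "f X \<in> grade (A n) n" by (rule morD(6)[OF fm gen_grade[OF n]])
      have "\<exists>r\<in>carrier R. f X = r \<odot>\<^bsub>A n\<^esub> X"
      proof (cases "f X = \<zero>\<^bsub>A n\<^esub>")
        case True
        then show ?thesis using X by (intro bexI[of _ "\<zero>\<^bsub>R\<^esub>"]) auto
      next
        case False
        then obtain r j where r: "r \<in> carrier R" "j * n = n" "f X = r \<odot>\<^bsub>A n\<^esub> X [^]\<^bsub>A n\<^esub> (j::nat)"
          using A_grade_cases[OF n fX] by blast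
        then have "j = 1" using n by simp
        then show ?thesis using r X by auto
      qed
      then obtain r where r: "r \<in> carrier R" "f X = r \<odot>\<^bsub>A n\<^esub> X" by blast
      then have "f = \<phi> r" using \<phi> by (intro A_mor_eqI[OF G fm]) auto
      then show ?thesis using r by blast
    qed
    then show "\<phi> ` carrier R = cogroup_mor R (A n) (A n)" using \<phi>c by blast
  qed
  then show thesis using \<phi>(2) that by blast
qed

text \<open>If \<open>B\<close> vanishes in positive degrees it is \<open>A(0)\<close>. Otherwise send \<open>X\<close> to an element \<open>x \<noteq> 0\<close> of the least
  positive degree \<open>n\<close> in which \<open>B\<close> does not vanish. In degree \<open>k\<close> both sides are spanned by the power with
  exponent \<open>k / n\<close>, or vanish, and the powers of \<open>x\<close> are nonzero.\<close>

lemma graded_commutative_cogroup_iso: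
  assumes B: "is_cogroup R B" and comm: "graded_commutative B"
  obtains (iso) n f g where "even n \<or> ring_char R = 2" "f \<in> cogroup_mor R (A n) B" "g \<in> cogroup_mor R B (A n)"
    "\<And>x. x \<in> carrier (A n) \<Longrightarrow> g (f x) = x" "\<And>y. y \<in> carrier B \<Longrightarrow> f (g y) = y"
proof -
  interpret B: counital_algebra R B "comult B" by (rule cogroup_counital_algebra[OF K B])
  have main: thesis if n: "even n \<or> ring_char R = 2" and f: "f \<in> cogroup_mor R (A n) B"
    and bij: "\<And>k. k > 0 \<Longrightarrow> bij_betw f (grade (A n) k) (grade B k)" for n f
  proof -
    have fm: "f \<in> mor R (A n) B" using f by (rule cogroup_mor_mor)
    have "bij_betw f (grade (A n) k) (grade B k)" for k
      using bij[of k] bij_betw_grade_0[OF A.connected_algebra_axioms B.connected_algebra_axioms fm] by (cases k) auto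
    then obtain g where g: "g \<in> mor R B (A n)" "\<And>x. x \<in> carrier (A n) \<Longrightarrow> g (f x) = x" "\<And>y. y \<in> carrier B \<Longrightarrow> f (g y) = y"
      using mor_bijective_on_grades[OF A.connected_algebra_axioms B.connected_algebra_axioms fm] by blast
    have "g \<in> cogroup_mor R B (A n)" by (rule cogroup_mor_inverse[OF A_is_cogroup B f g])
    from n f this g(2,3) show thesis by (rule iso)
  qed
  show thesis
  proof (cases "\<exists>k>0. \<not> grade B k \<subseteq> {\<zero>\<^bsub>B\<^esub>}")
    case False
    then have z: "grade B k = {\<zero>\<^bsub>B\<^esub>}" if "k > 0" for k using that B.grade_zero[of k] by blast
    note f = trivial_cogroup_mor(1)[OF B, of 0]
    have "bij_betw (trivial_mor R (A 0) B) (grade (A 0) k) (grade B k)" if "k > 0" for k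
      using z[OF that] A_grade_0_pos[OF that]
        mor_zero[OF cogroup_mor_mor[OF f] A.graded_algebra_axioms B.graded_algebra_axioms]
      by (simp add: bij_betw_def)
    then show thesis using main[of 0, OF _ f] by simp
  next
    case True
    define n where "n = (LEAST k. k > 0 \<and> \<not> grade B k \<subseteq> {\<zero>\<^bsub>B\<^esub>})"
    have n: "n > 0" and ne: "\<not> grade B n \<subseteq> {\<zero>\<^bsub>B\<^esub>}"
      using LeastI_ex[OF True] unfolding n_def by blast+
    have low: "grade B j \<subseteq> {\<zero>\<^bsub>B\<^esub>}" if "0 < j" "j < n" for j
      using not_less_Least[of j "\<lambda>k. k > 0 \<and> \<not> grade B k \<subseteq> {\<zero>\<^bsub>B\<^esub>}"] that unfolding n_def by blast
    obtain x where x: "x \<in> grade B n" "x \<noteq> \<zero>\<^bsub>B\<^esub>" using ne by blast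
    have prim: "B.primitive x" by (rule B.lowest_degree_primitive[OF n x(1) low])
    note P = n x prim
    obtain f where fm: "f \<in> mor R (A n) B" and fX0: "n > 0 \<Longrightarrow> f X = x"
      by (rule A_mor_exists[OF B.graded_algebra_axioms x(1)]) (rule that)
    note fX = fX0[OF n]
    have f: "f \<in> cogroup_mor R (A n) B"
      unfolding A_cogroup_mor_iff[OF B fm] fX using prim by (simp add: B.primitive_def)
    have X: "X \<in> carrier (A n)" by (rule gen_closed[OF n])
    have frX: "f (r \<odot>\<^bsub>A n\<^esub> X [^]\<^bsub>A n\<^esub> j) = r \<odot>\<^bsub>B\<^esub> x [^]\<^bsub>B\<^esub> j" if "r \<in> carrier R" for r and j :: nat
      using that X by (simp add: morD(5)[OF fm] mor_pow[OF fm A.graded_algebra_axioms B.graded_algebra_axioms] fX)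
    have f0: "f \<zero>\<^bsub>A n\<^esub> = \<zero>\<^bsub>B\<^esub>" by (rule mor_zero[OF fm A.graded_algebra_axioms B.graded_algebra_axioms])
    have "bij_betw f (grade (A n) k) (grade B k)" for k
      unfolding bij_betw_def
    proof
      show "inj_on f (grade (A n) k)"
      proof (rule inj_onI)
        fix u v assume uv: "u \<in> grade (A n) k" "v \<in> grade (A n) k" "f u = f v"
        have c: "u \<in> carrier (A n)" "v \<in> carrier (A n)" using uv A.grade_carrier by auto
        have w: "u \<ominus>\<^bsub>A n\<^esub> v \<in> grade (A n) k" by (rule A.grade_minus[OF uv(1,2)])
        have fw: "f (u \<ominus>\<^bsub>A n\<^esub> v) = \<zero>\<^bsub>B\<^esub>"
          using uv(3) morD(1)[OF fm c(2)] mor_minus[OF fm A.graded_algebra_axioms B.graded_algebra_axioms c]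
          by (simp add: a_minus_def B.M.r_neg)
        have "u \<ominus>\<^bsub>A n\<^esub> v = \<zero>\<^bsub>A n\<^esub>"
        proof (rule ccontr)
          assume "u \<ominus>\<^bsub>A n\<^esub> v \<noteq> \<zero>\<^bsub>A n\<^esub>"
          then obtain r j where r: "r \<in> carrier R" "u \<ominus>\<^bsub>A n\<^esub> v = r \<odot>\<^bsub>A n\<^esub> X [^]\<^bsub>A n\<^esub> (j::nat)"
            using A_grade_cases[OF n w] by blast
          have xj: "x [^]\<^bsub>B\<^esub> j \<in> carrier B" using B.grade_carrier[OF x(1)] by simp
          have "r \<odot>\<^bsub>B\<^esub> x [^]\<^bsub>B\<^esub> j = \<zero>\<^bsub>R\<^esub> \<odot>\<^bsub>B\<^esub> x [^]\<^bsub>B\<^esub> j"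
            using fw r frX xj by simp
          then have "r = \<zero>\<^bsub>R\<^esub>"
            using B.smult_cancel_nonzero[OF xj B.primitive_power_nonzero[OF P] r(1)] by simp
          then show False using r X \<open>u \<ominus>\<^bsub>A n\<^esub> v \<noteq> \<zero>\<^bsub>A n\<^esub>\<close> by simp
        qed
        then show "u = v" using c by simp
      qed
      show "f ` grade (A n) k = grade B k"
      proof
        show "f ` grade (A n) k \<subseteq> grade B k" using morD(6)[OF fm] by blast
        show "grade B k \<subseteq> f ` grade (A n) k"
        proof
          fix y assume y: "y \<in> grade B k"
          show "y \<in> f ` grade (A n) k"
          proof (cases "y = \<zero>\<^bsub>B\<^esub>")
            case True
            then show ?thesis using imageI[OF A.grade_zero[of n k], of f] f0 by simp
          next
            case False
            then obtain r j where r: "r \<in> carrier R" "j * n = k" "y = r \<odot>\<^bsub>B\<^esub> x [^]\<^bsub>B\<^esub> (j::nat)"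
              using B.grade_eq_powers[OF comm P y] by blast
            have "r \<odot>\<^bsub>A n\<^esub> X [^]\<^bsub>A n\<^esub> j \<in> grade (A n) k"
              using A.grade_smult[OF r(1) A.grade_pow[OF gen_grade[OF n]], of j] r(2) by simp
            from imageI[OF this, of f] show ?thesis using frX[OF r(1), of j] r(3) by simp
          qed
        qed
      qed
    qed
    moreover have "even n \<or> ring_char R = 2"
      using B.odd_primitive_char_2[OF comm _ x prim] ring_char_eq_2_iff[OF K] by blast
    ultimately show thesis using main[OF _ f] by blast
  qed
qed

end

theorem corollary1p5:
  fixes R :: "'r ring" and \<iota> :: "(nat \<Rightarrow> 'r) \<Rightarrow> 'u" and N :: "nat set"
    and \<C> :: "(('r, 'u) cogroup, 'u \<Rightarrow> 'u) category" and A :: "nat \<Rightarrow> ('r, 'u) cogroup"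
  assumes "field R"
    and "inj_on \<iota> (carrier (UP R))"
    and "\<C> = comm_cogroup_category R"
    and "A = A_cogroup R \<iota>"
    and "N = (if ring_char R = 2 then UNIV else {n. even n})"
  shows "is_equivalence (full_subcategory \<C> (A ` N)) \<C> inclusion_functor \<and>
    (\<forall>m\<in>N. \<forall>n\<in>N.
      (if m = n \<and> n > 0
       then \<exists>\<phi>. bij_betw \<phi> (carrier R) (hom_set \<C> (A m) (A n)) \<and>
              (\<forall>r\<in>carrier R. \<phi> r (gen R \<iota>) = r \<odot>\<^bsub>A n\<^esub> gen R \<iota>)
       else hom_set \<C> (A m) (A n) = {trivial_mor R (A m) (A n)}))"
proof (intro conjI ballI)
  note KI = assms(1,2)
  have N: "n \<in> N \<longleftrightarrow> even n \<or> ring_char R = 2" for n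
    by (simp add: assms(5))
  show "is_equivalence (full_subcategory \<C> (A ` N)) \<C> inclusion_functor"
  proof (rule full_subcategory_inclusion_equivalence)
    show "is_category \<C>" unfolding assms(3) by (rule comm_cogroup_category_is_category)
    show "A ` N \<subseteq> objects \<C>"
      using A_is_cogroup[OF KI] A_graded_commutative[OF KI] by (auto simp: assms(3,4) N)
    fix B assume "B \<in> objects \<C>"
    then have B: "is_cogroup R B" "graded_commutative B" by (simp_all add: assms(3))
    obtain n f g where n: "even n \<or> ring_char R = 2" and f: "f \<in> cogroup_mor R (A_cogroup R \<iota> n) B"
      and g: "g \<in> cogroup_mor R B (A_cogroup R \<iota> n)"
      and gf: "\<And>x. x \<in> carrier (A_cogroup R \<iota> n) \<Longrightarrow> g (f x) = x" and fg: "\<And>y. y \<in> carrier B \<Longrightarrow> f (g y) = y"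
      by (rule graded_commutative_cogroup_iso[OF KI B]) (rule that)
    have "compose (carrier B) f g = id_mor B" "compose (carrier (A n)) g f = id_mor (A n)"
      using gf fg by (auto simp: compose_def id_mor_def assms(4))
    then have "is_iso \<C> B (A n) g"
      unfolding is_iso_def using f g by (auto simp: assms(3,4))
    then show "\<exists>A'\<in>A ` N. \<exists>f. is_iso \<C> B A' f" using n N by blast
  qed
next
  note KI = assms(1,2)
  fix m n
  show "if m = n \<and> n > 0
       then \<exists>\<phi>. bij_betw \<phi> (carrier R) (hom_set \<C> (A m) (A n)) \<and>
              (\<forall>r\<in>carrier R. \<phi> r (gen R \<iota>) = r \<odot>\<^bsub>A n\<^esub> gen R \<iota>)
       else hom_set \<C> (A m) (A n) = {trivial_mor R (A m) (A n)}"
  proof (cases "m = n \<and> n > 0")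
    case True
    then obtain \<phi> where "bij_betw \<phi> (carrier R) (cogroup_mor R (A n) (A n))"
      "\<And>r. r \<in> carrier R \<Longrightarrow> \<phi> r (gen R \<iota>) = r \<odot>\<^bsub>A n\<^esub> gen R \<iota>"
      using hom_scalars[OF KI, of n] assms(4) by metis
    then show ?thesis using True by (auto simp: assms(3))
  next
    case False
    then show ?thesis
      unfolding if_not_P[OF False] using hom_trivial[OF KI False] by (simp add: assms(3,4))
  qed
qed

end
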